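(* Let $1\le q\le\infty$, let $\alpha>0$ with $\alpha\notin\mathbb{N}$, and let $\mu=f\,dx$ be a compactly supported finite measure on $\mathbb{R}^d$ such that $f\in B^{\alpha}_{q,1}(\mathbb{R}^d)$. Then for every $1\le p\le\infty$, $$\|\mu\|_{\mathrm{SBE}^{\alpha,p}_q}\le C\,\|\mu\|_{B^{\alpha}_{q,1}},$$ with a constant $C$ independent of $\mu$, where $\|\mu\|_{B^\alpha_{q,1}}=\|f\|_{B^\alpha_{q,1}}$.
   Context: $\mathbb{R}^+=(0,\infty)$. For a finite measure $\mu$ on $\mathbb{R}^d$ set $F_\mu(r,y)=\mu(\{x\in\mathbb{R}^d:|x-y|\le r\})$, $r\in\mathbb{R}^+$, $y\in\mathbb{R}^d$. For a function $F$ of $r$ define recursively $\Delta_0F(r)=F(r)-F(r/2)$, $\Delta_{k+1}F(r)=\Delta_kF(r)-2^{k+1}\Delta_kF(r/2)$. For $\alpha>0$, $1\le p,q\le\infty$ and $k=\lceil\alpha+d-1\rceil$, set $$\|\mu\|_{\mathrm{SBE}^{\alpha,p}_q}=\big\|r^{-\alpha-d}(\Delta_k)_rF_\mu(r,y)\big\|_{L^q_yL^p_r(\mathbb{R}^d\times\mathbb{R}^+,\,dy\otimes\frac{dr}{r})},$$ where $(\Delta_k)_r$ acts in the variable $r$, the $L^p$ norm in $r$ (w.r.t. $dr/r$) is taken first and then the $L^q$ norm in $y$. $B^s_{p,q}=B^s_{p,q}(\mathbb{R}^d)$ are the standard (inhomogeneous) Besov spaces. *)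

theory Defs
  imports "HOL-Analysis.Analysis" "HOL-Probability.Essential_Supremum"
begin

section \<open>Lebesgue norms with values in \<open>[0,\<infinity>]\<close>\<close>

(* Only used with exponents a > 0; then epowr is continuous and maps \<infinity> to \<infinity>. *)
definition epowr :: "ennreal \<Rightarrow> real \<Rightarrow> ennreal" where
  "epowr x a = (if x = \<infinity> then \<infinity> else ennreal (enn2real x powr a))"

(* The integrand is ennreal-valued so that norms can be iterated even when an inner norm is
   infinite; the norm of a real or complex function u is Lp_norm p M (\<lambda>x. ennreal (norm (u x))). *)
definition Lp_norm :: "ennreal \<Rightarrow> 'a measure \<Rightarrow> ('a \<Rightarrow> ennreal) \<Rightarrow> ennreal" where
  "Lp_norm p M g =
     (if p = \<infinity> then esssup M g
      else epowr (\<integral>\<^sup>+ x. epowr (g x) (enn2real p) \<partial>M) (1 / enn2real p))"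

section \<open>Inhomogeneous Besov spaces\<close>

definition fourier :: "('a::euclidean_space \<Rightarrow> complex) \<Rightarrow> 'a \<Rightarrow> complex" where
  "fourier f \<xi> = (\<integral>x. cis (- (x \<bullet> \<xi>)) * f x \<partial>lborel)"

definition inv_fourier :: "('a::euclidean_space \<Rightarrow> complex) \<Rightarrow> 'a \<Rightarrow> complex" where
  "inv_fourier g x = (\<integral>\<xi>. cis (x \<bullet> \<xi>) * g \<xi> \<partial>lborel) / of_real ((2 * pi) ^ DIM('a))"

primrec Ck :: "nat \<Rightarrow> ('a::euclidean_space \<Rightarrow> real) \<Rightarrow> bool" where
  "Ck 0 f \<longleftrightarrow> continuous_on UNIV f"
| "Ck (Suc n) f \<longleftrightarrow>
     (\<forall>x. f differentiable (at x)) \<and> (\<forall>v. Ck n (\<lambda>x. frechet_derivative f (at x) v))"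

definition smooth :: "('a::euclidean_space \<Rightarrow> real) \<Rightarrow> bool" where
  "smooth f \<longleftrightarrow> (\<forall>n. Ck n f)"

(* The low-frequency cutoff of a smooth dyadic resolution of unity (lp_piece \<phi> j), j = 0, 1, ...
   Different cutoffs give the same Besov spaces with equivalent norms, so the cutoff is kept as a
   parameter of the norm. *)
definition lp_cutoff :: "('a::euclidean_space \<Rightarrow> real) \<Rightarrow> bool" where
  "lp_cutoff \<phi> \<longleftrightarrow>
     smooth \<phi> \<and> (\<forall>\<xi>. norm \<xi> \<le> 1 \<longrightarrow> \<phi> \<xi> = 1) \<and> (\<forall>\<xi>. norm \<xi> \<ge> 2 \<longrightarrow> \<phi> \<xi> = 0)"

definition lp_piece :: "('a::euclidean_space \<Rightarrow> real) \<Rightarrow> nat \<Rightarrow> 'a \<Rightarrow> real" where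
  "lp_piece \<phi> j \<xi> =
     (if j = 0 then \<phi> \<xi> else \<phi> (\<xi> /\<^sub>R 2 ^ j) - \<phi> (\<xi> /\<^sub>R 2 ^ (j - 1)))"

(* For integrable f the Fourier transform is a bounded continuous function, so this is a
   convergent integral and agrees with the block of f as a tempered distribution. *)
definition lp_block :: "('a::euclidean_space \<Rightarrow> real) \<Rightarrow> nat \<Rightarrow> ('a \<Rightarrow> real) \<Rightarrow> 'a \<Rightarrow> complex" where
  "lp_block \<phi> j f =
     inv_fourier (\<lambda>\<xi>. of_real (lp_piece \<phi> j \<xi>) * fourier (\<lambda>x. of_real (f x)) \<xi>)"

(* s: smoothness, p: integrability in space, q: summability over the dyadic blocks. *)
definition besov_norm ::
  "('a::euclidean_space \<Rightarrow> real) \<Rightarrow> real \<Rightarrow> ennreal \<Rightarrow> ennreal \<Rightarrow> ('a \<Rightarrow> real) \<Rightarrow> ennreal" where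
  "besov_norm \<phi> s p q f =
     Lp_norm q (count_space UNIV)
       (\<lambda>j. ennreal (2 powr (real j * s)) *
            Lp_norm p lborel (\<lambda>x. ennreal (norm (lp_block \<phi> j f x))))"

(* The integrable elements of the Besov space; the density of a finite measure is always
   integrable, so no general tempered distributions are needed. *)
definition besov_space ::
  "('a::euclidean_space \<Rightarrow> real) \<Rightarrow> real \<Rightarrow> ennreal \<Rightarrow> ennreal \<Rightarrow> ('a \<Rightarrow> real) set" where
  "besov_space \<phi> s p q = {f. integrable lborel f \<and> besov_norm \<phi> s p q f < \<infinity>}"

section \<open>The SBE norm\<close>

definition ball_mass :: "'a::euclidean_space measure \<Rightarrow> real \<Rightarrow> 'a \<Rightarrow> real" where
  "ball_mass \<mu> r y = measure \<mu> (cball y r)"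

primrec Delta :: "nat \<Rightarrow> (real \<Rightarrow> real) \<Rightarrow> real \<Rightarrow> real" where
  "Delta 0 F = (\<lambda>r. F r - F (r / 2))"
| "Delta (Suc k) F = (\<lambda>r. Delta k F r - 2 ^ (k + 1) * Delta k F (r / 2))"

(* The measure dr/r on (0,\<infinity>), as a measure on the real line that vanishes off (0,\<infinity>). *)
definition dr_over_r :: "real measure" where
  "dr_over_r = density lborel (\<lambda>r. indicator {0<..} r * ennreal (1 / r))"

definition SBE_norm :: "real \<Rightarrow> ennreal \<Rightarrow> ennreal \<Rightarrow> 'a::euclidean_space measure \<Rightarrow> ennreal" where
  "SBE_norm \<alpha> p q \<mu> =
     (let d = DIM('a); k = nat \<lceil>\<alpha> + real d - 1\<rceil> in
      Lp_norm q lborel (\<lambda>y.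
        Lp_norm p dr_over_r (\<lambda>r.
          ennreal \<bar>r powr (- \<alpha> - real d) * Delta k (\<lambda>\<rho>. ball_mass \<mu> \<rho> y) r\<bar>)))"

definition compactly_supported :: "'a::euclidean_space measure \<Rightarrow> bool" where
  "compactly_supported \<mu> \<longleftrightarrow> (\<exists>K. compact K \<and> emeasure \<mu> (- K) = 0)"

end

theory Submission
  imports Defs "HOL-Probability.Characteristic_Functions"
begin

text \<open>
  Let \<open>m = \<lfloor>\<alpha>\<rfloor>\<close> and \<open>d = DIM('a)\<close>. The operator \<open>Delta k\<close> is the product of the factors \<open>1 - 2 ^ j * H\<close>,
  \<open>j \<le> k\<close>, where \<open>H\<close> halves the radius, so it annihilates \<open>r ^ l\<close> for all \<open>l \<le> k\<close>. The mass of the ball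
  of radius \<open>r\<close> around \<open>y\<close> is \<open>r ^ d\<close> times the integral of \<open>f (y + r w)\<close> over the unit ball, to which the
  Taylor polynomial of \<open>f\<close> of degree \<open>m\<close> contributes the powers \<open>r ^ d, \<dots>, r ^ (d + m)\<close>. Since \<open>\<alpha>\<close> is not an
  integer, \<open>d + m \<le> k\<close>, and the differences are of order \<open>r ^ (d + m + 1)\<close> for smooth \<open>f\<close>, while for large
  radii they are trivially of order \<open>r ^ d\<close>. As \<open>0 < \<alpha> < m + 1\<close>, the weight \<open>r powr (- \<alpha> - d)\<close> makes the
  former small for small \<open>r\<close> and the latter small for large \<open>r\<close>.

  This is made quantitative on a Littlewood-Paley block \<open>f\<^sub>j\<close>. The inverse Fourier transform \<open>\<psi>\<close> of the
  cutoff, dilated to the scale \<open>2 powr (- j - 1)\<close>, reproduces \<open>f\<^sub>j\<close> under convolution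
  (\<open>lp_block_reproducing\<close>), so the differences of \<open>f\<^sub>j\<close> are the convolution of \<open>f\<^sub>j\<close> with the dilated
  differences of \<open>\<psi>\<close> (\<open>ball_delta_lp_block\<close>). For \<open>\<psi>\<close> the two regimes combine into a bound with separated
  variables, \<open>min (r powr \<gamma>) (r powr (- \<gamma>)) * G z\<close> with \<open>\<gamma> > 0\<close> and \<open>G\<close> integrable
  (\<open>ball_delta_kernel_bound\<close>). It rests on the rapid decay of \<open>\<psi>\<close> and of its directional derivatives,
  uniformly in the direction (\<open>inv_fourier_Taylor\<close>).

  The dilated profiles \<open>min (r powr \<gamma>) (r powr (- \<gamma>))\<close> are bounded and have the same finite integral with respect
  to \<open>dr / r\<close>, so the norm in \<open>r\<close> is controlled for all exponents at once
  (\<open>Lp_norm_le_of_sup_and_integral_le\<close>). The norm in \<open>y\<close> of the convolutions and of the sum over \<open>j\<close> is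
  controlled by Minkowski's inequality (\<open>Minkowski_integral\<close>), and the dilation produces the factor
  \<open>2 powr (j * \<alpha>)\<close>: the result is the Besov norm with summation exponent \<open>1\<close>. That the blocks add up to
  \<open>f\<close> when tested on balls follows from the fact that the partial sums are mollifications of \<open>f\<close>
  (\<open>ball_delta_sum_lp_blocks\<close>); this, as well as the reproducing formula, uses Fourier inversion for the
  cutoff, which is derived from the Gaussian (\<open>fourier_inversion\<close>).
\<close>

section \<open>Lebesgue norms and Minkowski's integral inequality\<close>

lemma epowr_ennreal: "0 \<le> x \<Longrightarrow> epowr (ennreal x) a = ennreal (x powr a)"
  by (simp add: epowr_def)

lemma epowr_top [simp]: "epowr \<infinity> a = \<infinity>" "epowr top a = \<infinity>"
  by (simp_all add: epowr_def)

lemma epowr_zero [simp]: "epowr 0 a = 0"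
  by (simp add: epowr_def)

lemma epowr_one [simp]: "epowr x 1 = x"
  by (cases x) (auto simp: epowr_ennreal)

lemma epowr_mono: "x \<le> y \<Longrightarrow> 0 < a \<Longrightarrow> epowr x a \<le> epowr y a"
  by (cases x; cases y) (auto simp: epowr_ennreal top_unique intro!: ennreal_leI powr_mono2)

lemma epowr_mult: "0 < a \<Longrightarrow> epowr (x * y) a = epowr x a * epowr y a"
  by (cases x; cases y)
    (auto simp: epowr_ennreal ennreal_mult_top ennreal_top_mult powr_mult top_unique
       simp flip: ennreal_mult split: if_splits)

lemma epowr_epowr: "0 < a \<Longrightarrow> 0 < b \<Longrightarrow> epowr (epowr x a) b = epowr x (a * b)"
  by (cases x) (auto simp: epowr_ennreal powr_powr)

lemma measurable_epowr [measurable]: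
  assumes [measurable]: "f \<in> borel_measurable M"
  shows "(\<lambda>x. epowr (f x) a) \<in> borel_measurable M"
  unfolding epowr_def by measurable

lemma one_le_enn2real:
  fixes p :: ennreal
  assumes "1 \<le> p" "p \<noteq> \<infinity>"
  shows "1 \<le> enn2real p"
  using assms by (cases p) auto

text \<open>
  Young's inequality with exponents \<open>q\<close> and \<open>q / (q - 1)\<close>, applied to \<open>x\<close> and
  \<open>m powr (q - 1)\<close>, says that \<open>x powr q\<close> lies above its tangent line at \<open>m\<close>.
\<close>
lemma powr_above_tangent:
  fixes x m q :: real
  assumes "0 \<le> x" "0 < m" "1 \<le> q"
  shows "q * m powr (q - 1) * x \<le> x powr q + (q - 1) * m powr q"
proof (cases "q = 1")
  case True
  then show ?thesis using assms by simp
next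
  case False
  then have q: "q > 1" using assms by simp
  have "x * m powr (q - 1) \<le> x powr q / q + (m powr (q - 1)) powr (q / (q - 1)) / (q / (q - 1))"
    using q assms by (intro Youngs_inequality) (auto simp: field_simps)
  also have "(m powr (q - 1)) powr (q / (q - 1)) = m powr q"
    using q by (simp add: powr_powr)
  finally have "q * (x * m powr (q - 1)) \<le> q * (x powr q / q + m powr q / (q / (q - 1)))"
    using q by (intro mult_left_mono) auto
  also have "\<dots> = x powr q + (q - 1) * m powr q"
    using q by (simp add: field_simps)
  finally show ?thesis by (simp add: mult_ac)
qed

text \<open>
  Integrating the tangent line inequality at the mean \<open>m\<close> of \<open>h\<close> gives the claim when \<open>m\<close> is
  positive and finite. If the mean is infinite, then so is the right-hand side, because
  \<open>t \<le> t powr q + 1\<close>.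
\<close>
lemma jensen_epowr:
  assumes P: "prob_space P" and h [measurable]: "h \<in> borel_measurable P" and q: "1 \<le> q"
  shows "epowr (\<integral>\<^sup>+ x. h x \<partial>P) q \<le> (\<integral>\<^sup>+ x. epowr (h x) q \<partial>P)"
proof -
  interpret prob_space P by fact
  let ?I = "\<integral>\<^sup>+ x. epowr (h x) q \<partial>P"
  show ?thesis
  proof (cases "\<integral>\<^sup>+ x. h x \<partial>P")
    case top
    have "h x \<le> epowr (h x) q + 1" for x
    proof (cases "h x")
      case (real r)
      have "r \<le> r powr q + 1"
      proof (cases "r \<le> 1")
        case False
        then have "r powr 1 \<le> r powr q" using q by (intro powr_mono) auto
        then show ?thesis using False by simp
      qed (simp add: add_increasing)
      then have "ennreal r \<le> ennreal (r powr q + 1)" by (rule ennreal_leI)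
      then show ?thesis using real by (simp add: epowr_ennreal)
    qed simp
    then have "(\<integral>\<^sup>+ x. h x \<partial>P) \<le> (\<integral>\<^sup>+ x. epowr (h x) q + 1 \<partial>P)"
      by (intro nn_integral_mono) auto
    also have "\<dots> = ?I + 1" by (subst nn_integral_add) (auto simp: emeasure_space_1)
    finally have "?I = \<infinity>" using top by (simp add: top_unique)
    then show ?thesis by simp
  next
    case (real m)
    show ?thesis
    proof (cases "m = 0")
      case False
      then have m: "m > 0" using real by simp
      have pt: "ennreal (q * m powr (q - 1)) * h x \<le> epowr (h x) q + ennreal ((q - 1) * m powr q)" for x
      proof (cases "h x")
        case (real r)
        then have "ennreal (q * m powr (q - 1) * r) \<le> ennreal (r powr q + (q - 1) * m powr q)"
          using powr_above_tangent[of r m q] m q by (intro ennreal_leI) auto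
        then show ?thesis using real q m by (simp add: epowr_ennreal ennreal_mult ennreal_plus)
      qed simp
      have "ennreal (m powr q + (q - 1) * m powr q) = ennreal (q * m powr (q - 1)) * ennreal m"
        using m q by (subst ennreal_mult[symmetric]) (auto simp: powr_diff field_simps)
      also have "\<dots> = (\<integral>\<^sup>+ x. ennreal (q * m powr (q - 1)) * h x \<partial>P)"
        using real by (simp add: nn_integral_cmult)
      also have "\<dots> \<le> (\<integral>\<^sup>+ x. epowr (h x) q + ennreal ((q - 1) * m powr q) \<partial>P)"
        by (intro nn_integral_mono pt)
      also have "\<dots> = ?I + ennreal ((q - 1) * m powr q)"
        by (subst nn_integral_add) (auto simp: emeasure_space_1)
      finally have "ennreal (m powr q) + ennreal ((q - 1) * m powr q) \<le> ?I + ennreal ((q - 1) * m powr q)"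
        using q m by (simp add: ennreal_plus)
      then have "ennreal (m powr q) \<le> ?I"
        by (simp add: ennreal_add_left_cancel_le add.commute)
      then show ?thesis using real m by (simp add: epowr_ennreal)
    qed (use real in simp)
  qed
qed

lemma Lp_norm_mono:
  assumes "g \<in> borel_measurable M" "1 \<le> p" "\<And>x. g x \<le> h x"
  shows "Lp_norm p M g \<le> Lp_norm p M h"
proof (cases "p = \<infinity>")
  case True
  then show ?thesis using assms by (auto simp: Lp_norm_def intro: esssup_mono)
next
  case False
  then have "1 \<le> enn2real p" using assms one_le_enn2real by blast
  then show ?thesis using False assms(3)
    by (auto simp: Lp_norm_def intro!: epowr_mono nn_integral_mono)
qed

lemma Lp_norm_cmult_le:
  assumes [measurable]: "g \<in> borel_measurable M" and "1 \<le> p"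
  shows "Lp_norm p M (\<lambda>x. c * g x) \<le> c * Lp_norm p M g"
proof (cases "p = \<infinity>")
  case True
  have "AE x in M. c * g x \<le> c * esssup M g"
    using esssup_AE[of g M] by eventually_elim (rule mult_left_mono, auto)
  then show ?thesis using True by (auto simp: Lp_norm_def)
next
  case False
  define q where "q = enn2real p"
  have q: "1 \<le> q" using False assms one_le_enn2real by (auto simp: q_def)
  have "(\<integral>\<^sup>+ x. epowr (c * g x) q \<partial>M) = epowr c q * (\<integral>\<^sup>+ x. epowr (g x) q \<partial>M)"
    using q by (simp add: epowr_mult nn_integral_cmult)
  then show ?thesis using False q
    by (simp add: Lp_norm_def epowr_mult epowr_epowr flip: q_def)
qed

lemma Lp_norm_diff_lborel_le:
  fixes u :: "'a::euclidean_space \<Rightarrow> ennreal"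
  assumes [measurable]: "u \<in> borel_measurable borel"
  shows "Lp_norm p lborel (\<lambda>y. u (y - w)) \<le> Lp_norm p lborel u"
proof (cases "p = \<infinity>")
  case True
  have "AE y in distr lborel borel ((+) (- w)). u y \<le> esssup lborel u"
    unfolding lborel_distr_plus by (rule esssup_AE)
  then have "AE y in lborel. u (- w + y) \<le> esssup lborel u"
    by (subst (asm) AE_distr_iff) auto
  then show ?thesis using True by (auto simp: Lp_norm_def algebra_simps)
next
  case False
  have "(\<integral>\<^sup>+ x. epowr (u x) a \<partial>lborel) = (\<integral>\<^sup>+ x. epowr (u (x - w)) a \<partial>lborel)" for a
    by (subst lborel_distr_plus[of "- w", symmetric], subst nn_integral_distr)
      (auto simp: algebra_simps)
  then show ?thesis using False by (simp add: Lp_norm_def)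
qed

text \<open>
  The essential supremum of a non-measurable function is \<open>\<infinity>\<close> by convention, so an iterated norm with
  outer exponent \<open>\<infinity>\<close> can only be estimated if the inner norm is known to be measurable. For the inner
  exponent \<open>\<infinity>\<close> this holds because \<open>esssup M (g t) \<le> z\<close> means that the set where \<open>g t\<close> exceeds \<open>z\<close>
  has measure zero, and the measure of this set depends measurably on \<open>t\<close>.
\<close>
lemma measurable_Lp_norm:
  assumes "sigma_finite_measure M"
    and g [measurable]: "(\<lambda>(t, x). g t x) \<in> borel_measurable (N \<Otimes>\<^sub>M M)"
  shows "(\<lambda>t. Lp_norm p M (g t)) \<in> borel_measurable N"
proof (cases "p = \<infinity>")
  case True
  interpret sigma_finite_measure M by fact
  have *: "(\<lambda>t. esssup M (g t)) \<in> borel_measurable N"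
  proof (rule borel_measurableI_le)
    fix z :: ennreal
    have meas: "(\<lambda>t. \<integral>\<^sup>+ x. (if z < g t x then 1 else 0) \<partial>M) \<in> borel_measurable N"
      by measurable
    have "esssup M (g t) \<le> z \<longleftrightarrow> (\<integral>\<^sup>+ x. (if z < g t x then 1 else 0) \<partial>M) = 0" if t: "t \<in> space N" for t
    proof -
      have gt [measurable]: "g t \<in> borel_measurable M"
        using measurable_compose[OF measurable_Pair1'[OF t] g] by simp
      have "esssup M (g t) \<le> z \<longleftrightarrow> (AE x in M. g t x \<le> z)"
      proof
        assume "esssup M (g t) \<le> z"
        with esssup_AE[of "g t" M] show "AE x in M. g t x \<le> z" by (auto elim: eventually_mono)
      qed auto
      also have "\<dots> \<longleftrightarrow> (AE x in M. (if z < g t x then 1 else 0 :: ennreal) = 0)"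
        by (intro AE_cong) (auto simp: not_less)
      also have "\<dots> \<longleftrightarrow> (\<integral>\<^sup>+ x. (if z < g t x then 1 else 0) \<partial>M) = 0"
        by (subst nn_integral_0_iff_AE) auto
      finally show ?thesis .
    qed
    then have "{t \<in> space N. esssup M (g t) \<le> z} =
        {t \<in> space N. (\<integral>\<^sup>+ x. (if z < g t x then 1 else 0) \<partial>M) = 0}"
      by auto
    also have "\<dots> \<in> sets N" using meas by measurable
    finally show "{t \<in> space N. esssup M (g t) \<le> z} \<in> sets N" .
  qed
  with True show ?thesis by (simp add: Lp_norm_def)
next
  case False
  interpret sigma_finite_measure M by fact
  show ?thesis using False unfolding Lp_norm_def by simp
qed

text \<open>
  Interpolation between the exponents \<open>1\<close> and \<open>\<infinity>\<close> by the pointwise bound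
  \<open>u powr p \<le> (c * S) powr (p - 1) * u\<close>. It treats all exponents in the radial variable at once.
\<close>
lemma Lp_norm_le_of_sup_and_integral_le:
  assumes p: "1 \<le> p" and u [measurable]: "u \<in> borel_measurable M"
    and sup: "AE x in M. u x \<le> S" and int: "(\<integral>\<^sup>+ x. u x \<partial>M) \<le> c * S" and c: "1 \<le> c"
  shows "Lp_norm p M u \<le> c * S"
proof (cases "p = \<infinity>")
  case True
  have "S \<le> c * S" using mult_right_mono[OF c, of S] by simp
  then have "AE x in M. u x \<le> c * S" using sup by (auto elim: eventually_mono)
  then show ?thesis using True by (auto simp: Lp_norm_def)
next
  case False
  define q where "q = enn2real p"
  have q: "1 \<le> q" using False p one_le_enn2real by (auto simp: q_def)
  show ?thesis
  proof (cases "c * S = \<infinity>")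
    case fin: False
    have S: "S \<noteq> \<infinity>" using fin c by (auto simp: ennreal_mult_top split: if_splits)
    have "epowr (u x) q \<le> epowr (c * S) (q - 1) * u x" if x: "u x \<le> S" for x
    proof -
      obtain s where s: "S = ennreal s" "0 \<le> s" using S by (cases S) auto
      obtain t where t: "u x = ennreal t" "0 \<le> t" using x S by (cases "u x") (auto simp: top_unique)
      obtain v where v: "c * S = ennreal v" "0 \<le> v" using fin by (cases "c * S") auto
      have "S \<le> c * S" using mult_right_mono[OF c, of S] by simp
      then have tv: "t \<le> v" using x unfolding v(1) s(1) t(1) using s t v by simp
      have "t powr q \<le> v powr (q - 1) * t"
      proof (cases "t = 0")
        case False
        then have "t powr q = t powr (q - 1) * t" using t by (simp add: powr_diff)
        also have "\<dots> \<le> v powr (q - 1) * t"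
          using t q tv by (intro mult_right_mono powr_mono2) auto
        finally show ?thesis .
      qed simp
      then show ?thesis
        using t v by (simp add: epowr_ennreal flip: ennreal_mult)
    qed
    then have "(\<integral>\<^sup>+ x. epowr (u x) q \<partial>M) \<le> (\<integral>\<^sup>+ x. epowr (c * S) (q - 1) * u x \<partial>M)"
      using sup by (intro nn_integral_mono_AE) (auto elim: eventually_mono)
    also have "\<dots> = epowr (c * S) (q - 1) * (\<integral>\<^sup>+ x. u x \<partial>M)" by (rule nn_integral_cmult) simp
    also have "\<dots> \<le> epowr (c * S) (q - 1) * (c * S)" by (rule mult_left_mono[OF int]) simp
    also have "\<dots> = epowr (c * S) q"
    proof -
      obtain v where v: "c * S = ennreal v" "0 \<le> v" using fin by (cases "c * S") auto
      show ?thesis unfolding v(1) using v(2)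
        by (cases "v = 0") (auto simp: epowr_ennreal powr_diff simp flip: ennreal_mult)
    qed
    finally have "epowr (\<integral>\<^sup>+ x. epowr (u x) q \<partial>M) (1 / q) \<le> epowr (epowr (c * S) q) (1 / q)"
      using q by (intro epowr_mono) auto
    then show ?thesis using False q by (simp add: Lp_norm_def epowr_epowr flip: q_def)
  qed simp
qed

text \<open>
  Write \<open>b t\<close> for the norm of \<open>g \<cdot> t\<close> and \<open>B\<close> for the integral of \<open>b\<close>. With respect to the
  probability density \<open>b / B\<close>, the integral of \<open>g y\<close> is \<open>B\<close> times the mean of \<open>g y t / b t\<close>; Jensen's
  inequality moves the power inside the mean, and after integration over \<open>y\<close> each quotient has norm at
  most \<open>1\<close>. To have \<open>b\<close> positive almost everywhere, a small multiple \<open>\<delta>\<close> of a positive integrable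
  function \<open>e\<close> is added to the norm, and \<open>\<delta>\<close> tends to zero at the end.
\<close>
theorem Minkowski_integral:
  assumes M: "sigma_finite_measure M" and N: "sigma_finite_measure N" and p: "1 \<le> p"
    and g [measurable]: "(\<lambda>(y, t). g y t) \<in> borel_measurable (M \<Otimes>\<^sub>M N)"
  shows "Lp_norm p M (\<lambda>y. \<integral>\<^sup>+ t. g y t \<partial>N) \<le> (\<integral>\<^sup>+ t. Lp_norm p M (\<lambda>y. g y t) \<partial>N)"
proof -
  interpret M: sigma_finite_measure M by fact
  interpret N: sigma_finite_measure N by fact
  interpret pair_sigma_finite M N ..
  define a where "a t = Lp_norm p M (\<lambda>y. g y t)" for t
  have g' [measurable]: "(\<lambda>(t, y). g y t) \<in> borel_measurable (N \<Otimes>\<^sub>M M)"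
    using measurable_pair_swap[OF g] by simp
  have a [measurable]: "a \<in> borel_measurable N"
    unfolding a_def[abs_def] by (rule measurable_Lp_norm[OF M]) simp
  define A where "A = (\<integral>\<^sup>+ t. a t \<partial>N)"
  have "Lp_norm p M (\<lambda>y. \<integral>\<^sup>+ t. g y t \<partial>N) \<le> A"
  proof (cases "p = \<infinity>")
    case True
    have "AE y in M. g y t \<le> a t" for t
      using True esssup_AE[of "\<lambda>y. g y t" M] by (simp add: a_def Lp_norm_def)
    then have "AE t in N. AE y in M. g y t \<le> a t" by simp
    moreover have "Measurable.pred (M \<Otimes>\<^sub>M N) (\<lambda>x. g (fst x) (snd x) \<le> a (snd x))"
      by measurable
    ultimately have "AE y in M. AE t in N. g y t \<le> a t"
      by (subst AE_commute) (simp_all add: pred_def)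
    then have "AE y in M. (\<integral>\<^sup>+ t. g y t \<partial>N) \<le> A"
      unfolding A_def by eventually_elim (rule nn_integral_mono_AE)
    then show ?thesis using True by (auto simp: Lp_norm_def)
  next
    case False
    define q where "q = enn2real p"
    have q: "1 \<le> q" using False p one_le_enn2real by (auto simp: q_def)
    have aq: "(\<integral>\<^sup>+ y. epowr (g y t) q \<partial>M) = epowr (a t) q" for t
      using False q by (simp add: a_def Lp_norm_def epowr_epowr flip: q_def)
    show ?thesis
    proof (cases "A = \<infinity>")
      case fin: False
      obtain e where e [measurable]: "e \<in> borel_measurable N" and e_fin: "(\<integral>\<^sup>+ t. e t \<partial>N) \<noteq> \<infinity>"
        and e_pos: "\<And>t. t \<in> space N \<Longrightarrow> 0 < e t \<and> e t < \<infinity>"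
        using N.Ex_finite_integrable_function by blast
      define E where "E = (\<integral>\<^sup>+ t. e t \<partial>N)"
      have main: "Lp_norm p M (\<lambda>y. \<integral>\<^sup>+ t. g y t \<partial>N) \<le> A + ennreal \<delta> * E" if \<delta>: "0 < \<delta>" for \<delta> :: real
      proof -
        define b where "b t = a t + ennreal \<delta> * e t" for t
        have [measurable]: "b \<in> borel_measurable N" unfolding b_def[abs_def] by measurable
        define B where "B = (\<integral>\<^sup>+ t. b t \<partial>N)"
        have B: "B = A + ennreal \<delta> * E"
          by (simp add: B_def b_def A_def E_def nn_integral_add nn_integral_cmult)
        have B_fin: "B \<noteq> \<infinity>" using fin e_fin by (simp add: B E_def ennreal_mult_eq_top_iff)
        show ?thesis
        proof (cases "B = 0")
          case True
          \<comment> \<open>Then the positive function \<open>b\<close> vanishes almost everywhere, so \<open>N\<close> is the zero measure.\<close>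
          have "AE t in N. b t = 0" using True by (simp add: B_def nn_integral_0_iff_AE)
          moreover have "AE t in N. 0 < b t"
            using e_pos \<delta> by (auto simp: b_def intro!: AE_I2 add_pos_pos ennreal_zero_less_mult_iff[THEN iffD2] add_nonneg_pos)
          ultimately have "AE t in N. False" by eventually_elim auto
          then have "(\<integral>\<^sup>+ t. g y t \<partial>N) = (\<integral>\<^sup>+ t. 0 \<partial>N)" for y
            by (intro nn_integral_cong_AE) auto
          then show ?thesis using False q by (simp add: Lp_norm_def flip: q_def)
        next
          case B0: False
          have b_AE: "AE t in N. 0 < b t \<and> b t < \<infinity>"
          proof -
            have "AE t in N. b t \<noteq> \<infinity>"
              using B_fin by (intro nn_integral_noteq_infinite) (auto simp: B_def)
            moreover have "AE t in N. 0 < b t"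
              using e_pos \<delta> by (auto simp: b_def intro!: AE_I2 add_nonneg_pos ennreal_zero_less_mult_iff[THEN iffD2])
            ultimately show ?thesis by eventually_elim (auto simp: less_top)
          qed
          define P where "P = density N (\<lambda>t. b t / B)"
          have P: "prob_space P"
          proof
            have "emeasure P (space P) = (\<integral>\<^sup>+ t. b t / B \<partial>N)"
              by (simp add: P_def emeasure_density cong: nn_integral_cong)
            also have "\<dots> = 1"
              using B0 B_fin by (simp add: nn_integral_divide ennreal_divide_self less_top flip: B_def)
            finally show "emeasure P (space P) = 1" .
          qed
          have gm [measurable]: "(\<lambda>t. g y t) \<in> borel_measurable N" if "y \<in> space M" for y
            using measurable_compose[OF measurable_Pair1'[OF that] g] by simp
          have jensen: "epowr (\<integral>\<^sup>+ t. g y t \<partial>N) q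
              \<le> epowr B q * (\<integral>\<^sup>+ t. b t / B * epowr (g y t / b t) q \<partial>N)" if y: "y \<in> space M" for y
          proof -
            note [measurable] = gm[OF y]
            have "(\<integral>\<^sup>+ t. g y t \<partial>N) = (\<integral>\<^sup>+ t. B * (b t / B * (g y t / b t)) \<partial>N)"
            proof (rule nn_integral_cong_AE)
              show "AE t in N. g y t = B * (b t / B * (g y t / b t))"
                using b_AE
              proof eventually_elim
                case (elim t)
                obtain b' where b': "b t = ennreal b'" "b' > 0"
                  using elim by (cases "b t") auto
                obtain B' where B': "B = ennreal B'" "B' > 0"
                  using B0 B_fin by (cases B) auto
                show ?case
                proof (cases "g y t")
                  case (real r)
                  then show ?thesis using b' B'
                    by (simp add: divide_ennreal flip: ennreal_mult)
                next
                  case top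
                  then show ?thesis using b' B'
                    by (simp add: divide_ennreal ennreal_top_divide ennreal_mult_top)
                qed
              qed
            qed
            also have "\<dots> = B * (\<integral>\<^sup>+ t. g y t / b t \<partial>P)"
              by (simp add: P_def nn_integral_density nn_integral_cmult)
            finally have "epowr (\<integral>\<^sup>+ t. g y t \<partial>N) q = epowr B q * epowr (\<integral>\<^sup>+ t. g y t / b t \<partial>P) q"
              using q by (simp add: epowr_mult)
            also have "\<dots> \<le> epowr B q * (\<integral>\<^sup>+ t. epowr (g y t / b t) q \<partial>P)"
              by (intro mult_left_mono jensen_epowr P q) (auto simp: P_def)
            finally show ?thesis by (simp add: P_def nn_integral_density)
          qed
          have "(\<integral>\<^sup>+ y. epowr (\<integral>\<^sup>+ t. g y t \<partial>N) q \<partial>M)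
              \<le> (\<integral>\<^sup>+ y. epowr B q * (\<integral>\<^sup>+ t. b t / B * epowr (g y t / b t) q \<partial>N) \<partial>M)"
            by (intro nn_integral_mono jensen)
          also have "\<dots> = epowr B q * (\<integral>\<^sup>+ y. (\<integral>\<^sup>+ t. b t / B * epowr (g y t / b t) q \<partial>N) \<partial>M)"
            by (rule nn_integral_cmult) measurable
          also have "(\<integral>\<^sup>+ y. (\<integral>\<^sup>+ t. b t / B * epowr (g y t / b t) q \<partial>N) \<partial>M)
              = (\<integral>\<^sup>+ t. (\<integral>\<^sup>+ y. b t / B * epowr (g y t / b t) q \<partial>M) \<partial>N)"
            by (rule Fubini'[symmetric]) measurable
          also have "\<dots> \<le> (\<integral>\<^sup>+ t. b t / B \<partial>N)"
          proof (rule nn_integral_mono_AE)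
            show "AE t in N. (\<integral>\<^sup>+ y. b t / B * epowr (g y t / b t) q \<partial>M) \<le> b t / B"
              using b_AE
            proof (rule AE_mp, intro AE_I2 impI)
              fix t assume tN: "t \<in> space N" and elim: "0 < b t \<and> b t < \<infinity>"
              have [measurable]: "(\<lambda>y. g y t) \<in> borel_measurable M"
                using measurable_compose[OF measurable_Pair1'[OF tN] g'] by simp
              have "(\<integral>\<^sup>+ y. b t / B * epowr (g y t / b t) q \<partial>M)
                  = (\<integral>\<^sup>+ y. b t / B * epowr (inverse (b t)) q * epowr (g y t) q \<partial>M)"
                using q by (simp add: divide_ennreal_def epowr_mult mult_ac)
              also have "\<dots> = b t / B * epowr (inverse (b t)) q * epowr (a t) q"
                by (simp add: nn_integral_cmult aq)
              also have "\<dots> = b t / B * epowr (inverse (b t) * a t) q"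
                using q by (simp add: epowr_mult mult_ac)
              also have "\<dots> \<le> b t / B * 1"
              proof (rule mult_left_mono)
                have "inverse (b t) * a t \<le> inverse (b t) * b t"
                  by (intro mult_left_mono) (auto simp: b_def)
                also have "\<dots> = 1" using elim by (simp add: mult.commute ennreal_divide_self zero_less_iff_neq_zero flip: divide_ennreal_def)
                finally have "epowr (inverse (b t) * a t) q \<le> epowr 1 q"
                  using q by (intro epowr_mono) auto
                then show "epowr (inverse (b t) * a t) q \<le> 1" by (simp add: epowr_def)
              qed simp
              finally show "(\<integral>\<^sup>+ y. b t / B * epowr (g y t / b t) q \<partial>M) \<le> b t / B" by simp
            qed
          qed
          also have "(\<integral>\<^sup>+ t. b t / B \<partial>N) = 1"
            using B0 B_fin by (simp add: nn_integral_divide ennreal_divide_self less_top flip: B_def)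
          finally have "(\<integral>\<^sup>+ y. epowr (\<integral>\<^sup>+ t. g y t \<partial>N) q \<partial>M) \<le> epowr B q"
            by (simp add: mult_left_mono)
          then have "epowr (\<integral>\<^sup>+ y. epowr (\<integral>\<^sup>+ t. g y t \<partial>N) q \<partial>M) (1 / q) \<le> epowr (epowr B q) (1 / q)"
            using q by (intro epowr_mono) auto
          then show ?thesis using False q by (simp add: Lp_norm_def epowr_epowr B flip: q_def)
        qed
      qed
      show ?thesis
      proof (rule ennreal_le_epsilon)
        fix \<epsilon> :: real assume \<epsilon>: "0 < \<epsilon>"
        obtain E' where E': "E = ennreal E'" "0 \<le> E'" using e_fin by (cases E) (auto simp: E_def)
        have "ennreal (\<epsilon> / (E' + 1)) * E \<le> ennreal \<epsilon>"
          using E' \<epsilon> by (auto simp: ennreal_mult[symmetric] field_simps intro!: ennreal_leI)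
        then show "Lp_norm p M (\<lambda>y. \<integral>\<^sup>+ t. g y t \<partial>N) \<le> A + ennreal \<epsilon>"
          using main[of "\<epsilon> / (E' + 1)"] E' \<epsilon> by (meson add_left_mono add_pos_nonneg add_nonneg_pos divide_pos_pos order_trans zero_less_one)
      qed
    qed simp
  qed
  then show ?thesis by (simp add: A_def a_def)
qed

section \<open>Fourier inversion\<close>

lemma nn_integral_lborel_affine:
  fixes f :: "'a::euclidean_space \<Rightarrow> ennreal"
  assumes [measurable]: "f \<in> borel_measurable borel" and c: "c \<noteq> 0"
  shows "(\<integral>\<^sup>+ x. f x \<partial>lborel) = ennreal (\<bar>c\<bar> ^ DIM('a)) * (\<integral>\<^sup>+ x. f (t + c *\<^sub>R x) \<partial>lborel)"
  by (subst lborel_affine[OF c, of t]) (simp add: nn_integral_density nn_integral_distr nn_integral_cmult)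

lemma integrable_lborel_affine:
  fixes f :: "'a::euclidean_space \<Rightarrow> 'b::{banach, second_countable_topology}"
  assumes f: "integrable lborel f" and c: "c \<noteq> 0"
  shows "integrable lborel (\<lambda>x. f (t + c *\<^sub>R x))"
  using f f[THEN borel_measurable_integrable] c unfolding integrable_iff_bounded
  by (subst (asm) nn_integral_lborel_affine[where c=c and t=t]) (auto simp: ennreal_mult_less_top)

lemma integral_lborel_affine:
  fixes f :: "'a::euclidean_space \<Rightarrow> 'b::{banach, second_countable_topology}"
  assumes [measurable]: "f \<in> borel_measurable borel" and c: "c \<noteq> 0"
  shows "(\<integral>x. f x \<partial>lborel) = (\<bar>c\<bar> ^ DIM('a)) *\<^sub>R (\<integral>x. f (t + c *\<^sub>R x) \<partial>lborel)"
  by (subst lborel_affine[OF c, of t]) (simp add: integral_density integral_distr)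

lemma integrable_cis_mult:
  fixes g :: "'a::euclidean_space \<Rightarrow> complex"
  assumes g: "integrable lborel g" and [measurable]: "h \<in> borel_measurable borel"
  shows "integrable lborel (\<lambda>x. cis (h x) * g x)"
  using g by (rule Bochner_Integration.integrable_bound)
    (use borel_measurable_integrable[OF g] in \<open>auto simp: norm_mult cis_conv_exp\<close>)

lemma measurable_cis [measurable]:
  "f \<in> borel_measurable M \<Longrightarrow> (\<lambda>x. cis (f x)) \<in> borel_measurable M"
  unfolding cis_conv_exp by measurable

lemma gaussian_fourier_real:
  "integrable lborel (\<lambda>x. cis (t * x) * of_real (exp (- x\<^sup>2 / 2)))" (is ?I)
  "(\<integral>x. cis (t * x) * of_real (exp (- x\<^sup>2 / 2)) \<partial>lborel) = of_real (sqrt (2 * pi) * exp (- t\<^sup>2 / 2))" (is ?E)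
proof -
  have *: "exp (- x\<^sup>2 / 2) = sqrt (2 * pi) * std_normal_density x" for x :: real
    by (simp add: std_normal_density_def)
  have "integrable lborel std_normal_density" by simp
  then have 1: "integrable lborel (\<lambda>x. complex_of_real (exp (- x\<^sup>2 / 2)))"
    unfolding * by (intro integrable_of_real integrable_mult_right) auto
  then show ?I by (rule integrable_cis_mult) simp
  have "(\<integral>x. cis (t * x) * of_real (exp (- x\<^sup>2 / 2)) \<partial>lborel)
      = of_real (sqrt (2 * pi)) * (\<integral>x. std_normal_density x *\<^sub>R cis (t * x) \<partial>lborel)"
    unfolding * by (subst integral_mult_right_zero[symmetric]) (auto simp: scaleR_conv_of_real mult_ac)
  also have "(\<integral>x. std_normal_density x *\<^sub>R cis (t * x) \<partial>lborel) = char std_normal_distribution t"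
    by (simp add: char_def integral_density cis_conv_exp)
  finally show ?E by (simp add: char_std_normal_distribution)
qed

text \<open>
  Lebesgue measure and the integrand are products over the orthonormal basis, which reduces the claim
  to the characteristic function of the one-dimensional normal distribution.
\<close>
lemma gaussian_fourier:
  fixes \<eta> :: "'a::euclidean_space"
  shows "integrable lborel (\<lambda>x::'a. complex_of_real (exp (- (norm x)\<^sup>2 / 2)))" (is ?I)
    and "(\<integral>x. cis (x \<bullet> \<eta>) * of_real (exp (- (norm x)\<^sup>2 / 2)) \<partial>lborel) =
           of_real (sqrt (2 * pi) ^ DIM('a) * exp (- (norm \<eta>)\<^sup>2 / 2))" (is ?E)
proof -
  interpret product_sigma_finite "\<lambda>_::'a. lborel :: real measure" ..
  have norm_sq: "(norm x)\<^sup>2 = (\<Sum>b\<in>Basis. (x \<bullet> b)\<^sup>2)" for x :: 'a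
    unfolding power2_norm_eq_inner by (subst euclidean_inner) (simp add: power2_eq_square)
  define F where "F \<eta> b s = cis ((\<eta> \<bullet> b) * s) * complex_of_real (exp (- s\<^sup>2 / 2))" for \<eta> b :: 'a and s
  have F_int: "integrable lborel (F \<eta> b)" for \<eta> b :: 'a
    unfolding F_def by (rule gaussian_fourier_real)
  have F_val: "integral\<^sup>L lborel (F \<eta> b) = of_real (sqrt (2 * pi) * exp (- (\<eta> \<bullet> b)\<^sup>2 / 2))" for \<eta> b :: 'a
    unfolding F_def by (rule gaussian_fourier_real)
  have prod: "cis (x \<bullet> \<eta>) * of_real (exp (- (norm x)\<^sup>2 / 2)) = (\<Prod>b\<in>Basis. F \<eta> b (x \<bullet> b))" for x \<eta> :: 'a
  proof -
    have "cis (x \<bullet> \<eta>) = (\<Prod>b\<in>Basis. cis ((\<eta> \<bullet> b) * (x \<bullet> b)))"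
      by (simp add: cis_conv_exp euclidean_inner[of x \<eta>] sum_distrib_left exp_sum mult_ac)
    moreover have "exp (- (norm x)\<^sup>2 / 2) = (\<Prod>b\<in>Basis. exp (- (x \<bullet> b)\<^sup>2 / 2))"
      by (simp add: norm_sq exp_sum[symmetric] sum_negf sum_divide_distrib)
    ultimately show ?thesis by (simp add: F_def prod.distrib)
  qed
  have comp: "(\<Sum>b'\<in>Basis. f b' *\<^sub>R b') \<bullet> b = f b" if "b \<in> Basis" for f :: "'a \<Rightarrow> real" and b
    using that by simp
  have [measurable]: "(\<lambda>x::'a. \<Prod>b\<in>Basis. F \<eta> b (x \<bullet> b)) \<in> borel_measurable borel" for \<eta>
    unfolding prod[symmetric] by measurable
  have meas2 [measurable]: "(\<lambda>f. \<Sum>b\<in>Basis. f b *\<^sub>R (b::'a)) \<in> (\<Pi>\<^sub>M b\<in>Basis. lborel) \<rightarrow>\<^sub>M borel"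
    by measurable
  have int: "integrable lborel (\<lambda>x::'a. \<Prod>b\<in>Basis. F \<eta> b (x \<bullet> b))" for \<eta>
    by (subst lborel_eq, subst integrable_distr_eq) (auto simp: comp intro!: product_integrable_prod F_int)
  show ?I using int[of 0] unfolding prod[symmetric] by simp
  have "(\<integral>x. cis (x \<bullet> \<eta>) * of_real (exp (- (norm x)\<^sup>2 / 2)) \<partial>lborel)
      = (\<integral>x. (\<Prod>b\<in>Basis. F \<eta> b (x \<bullet> b)) \<partial>lborel)"
    unfolding prod ..
  also have "\<dots> = (\<integral>f. (\<Prod>b\<in>Basis. F \<eta> b (f b)) \<partial>(\<Pi>\<^sub>M b\<in>Basis. lborel))"
    by (subst lborel_eq, subst integral_distr) (auto simp: comp)
  also have "\<dots> = (\<Prod>b\<in>Basis. of_real (sqrt (2 * pi) * exp (- (\<eta> \<bullet> b)\<^sup>2 / 2)))"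
    using product_integral_prod[of Basis "F \<eta>", OF finite_Basis F_int]
    by (simp only: F_val)
  also have "\<dots> = of_real (sqrt (2 * pi) ^ DIM('a) * exp (- (norm \<eta>)\<^sup>2 / 2))"
    by (simp add: prod.distrib norm_sq exp_sum[symmetric] sum_negf sum_divide_distrib flip: of_real_prod of_real_mult)
  finally show ?E .
qed

lemma norm_cis_mult [simp]: "norm (cis t * z) = norm z"
  by (simp add: norm_mult)

lemma integrable_prod_mult:
  fixes f :: "'a::euclidean_space \<Rightarrow> complex" and g :: "'b::euclidean_space \<Rightarrow> complex"
  assumes f: "integrable lborel f" and g: "integrable lborel g"
    and [measurable]: "h \<in> borel_measurable (borel \<Otimes>\<^sub>M borel)"
  shows "integrable (lborel \<Otimes>\<^sub>M lborel) (\<lambda>(x, y). cis (h (x, y)) * (f x * g y))"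
proof -
  note [measurable] = borel_measurable_integrable[OF f] borel_measurable_integrable[OF g]
  show ?thesis
  proof (rule lborel_pair.Fubini_integrable)
    have "integrable lborel (\<lambda>x. norm (f x) * (\<integral>y. norm (g y) \<partial>lborel))"
      using f by simp
    then show "integrable lborel (\<lambda>x. \<integral>y. norm (case (x, y) of (x, y) \<Rightarrow> cis (h (x, y)) * (f x * g y)) \<partial>lborel)"
      by (simp add: norm_mult)
    have "integrable lborel (\<lambda>y. cis (h (x, y)) * (f x * g y))" for x
      by (rule integrable_cis_mult) (use g in auto)
    then show "AE x in lborel. integrable lborel (\<lambda>y. case (x, y) of (x, y) \<Rightarrow> cis (h (x, y)) * (f x * g y))"
      by simp
  qed measurable
qed

text \<open>
  The Gaussian factor \<open>e (\<epsilon> x)\<close> makes the double integral absolutely convergent. After interchanging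
  the integrals, the inner one is the Fourier transform of a Gaussian, hence again a Gaussian, and what
  remains is the average of \<open>g (\<xi>0 + \<epsilon> \<eta>)\<close> with Gaussian weight in \<open>\<eta>\<close>, which tends to \<open>g \<xi>0\<close>.
\<close>
lemma fourier_inversion:
  fixes g :: "'a::euclidean_space \<Rightarrow> complex"
  assumes g: "integrable lborel g" and cont: "continuous_on UNIV g" and bdd: "\<And>\<xi>. norm (g \<xi>) \<le> B"
    and int: "integrable lborel (inv_fourier g)"
  shows "fourier (inv_fourier g) \<xi>0 = g \<xi>0"
proof -
  define e :: "'a \<Rightarrow> complex" where "e x = of_real (exp (- (norm x)\<^sup>2 / 2))" for x
  have e_int: "integrable lborel e" unfolding e_def by (rule gaussian_fourier)
  have e_meas [measurable]: "e \<in> borel_measurable borel" unfolding e_def by measurable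
  have norm_e: "norm (e x) \<le> 1" for x by (simp add: e_def)
  have e0: "e 0 = 1" by (simp add: e_def)
  have e_cont: "continuous_on UNIV e" unfolding e_def by (intro continuous_intros) auto
  have g_meas [measurable]: "g \<in> borel_measurable borel" using cont by (rule borel_measurable_continuous_onI)
  have ig_meas [measurable]: "inv_fourier g \<in> borel_measurable borel"
    using borel_measurable_integrable[OF int] by simp
  define eps where "eps n = 1 / real (Suc n)" for n
  have eps_pos: "eps n > 0" for n by (simp add: eps_def)
  have eps0: "eps \<longlonglongrightarrow> 0" unfolding eps_def by (rule LIMSEQ_Suc[OF lim_1_over_n])
  define I where "I n = (\<integral>x. cis (- (x \<bullet> \<xi>0)) * inv_fourier g x * e (eps n *\<^sub>R x) \<partial>lborel)" for n
  have I_lim: "I \<longlonglongrightarrow> fourier (inv_fourier g) \<xi>0"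
    unfolding I_def fourier_def
  proof (rule integral_dominated_convergence)
    show "integrable lborel (\<lambda>x. norm (inv_fourier g x))" using int by simp
    show "AE x in lborel. norm (cis (- (x \<bullet> \<xi>0)) * inv_fourier g x * e (eps n *\<^sub>R x)) \<le> norm (inv_fourier g x)" for n
      using norm_e by (auto simp: norm_mult intro!: mult_left_le)
    have "(\<lambda>n. e (eps n *\<^sub>R x)) \<longlonglongrightarrow> 1" for x
    proof -
      have "(\<lambda>n. e (eps n *\<^sub>R x)) \<longlonglongrightarrow> e (0 *\<^sub>R x)"
        by (rule continuous_on_tendsto_compose[OF e_cont tendsto_scaleR[OF eps0 tendsto_const]]) auto
      then show ?thesis by (simp add: e0)
    qed
    then show "AE x in lborel. (\<lambda>n. cis (- (x \<bullet> \<xi>0)) * inv_fourier g x * e (eps n *\<^sub>R x))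
        \<longlonglongrightarrow> cis (- (x \<bullet> \<xi>0)) * inv_fourier g x"
      using tendsto_mult[OF tendsto_const] by (intro AE_I2) fastforce
  qed measurable
  have I_eq: "I n = (\<integral>\<eta>. g (\<xi>0 + eps n *\<^sub>R \<eta>) * e \<eta> \<partial>lborel) / of_real (sqrt (2 * pi) ^ DIM('a))" for n
  proof -
    define D where "D = complex_of_real ((2 * pi) ^ DIM('a))"
    define s where "s = sqrt (2 * pi) ^ DIM('a)"
    have Ds: "D = of_real s * of_real s"
      unfolding D_def s_def of_real_mult[symmetric] power_mult_distrib[symmetric] by simp
    have s: "s > 0" by (simp add: s_def)
    have ee_int: "integrable lborel (\<lambda>x. e (eps n *\<^sub>R x))"
      using integrable_lborel_affine[OF e_int, of "eps n" 0] eps_pos[of n] by simp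
    have "I n = (\<integral>x. (\<integral>\<xi>. cis (x \<bullet> (\<xi> - \<xi>0)) * (g \<xi> * e (eps n *\<^sub>R x)) \<partial>lborel) \<partial>lborel) / D"
    proof -
      have "cis (x \<bullet> (\<xi> - \<xi>0)) * (g \<xi> * e (eps n *\<^sub>R x))
          = (cis (- (x \<bullet> \<xi>0)) * e (eps n *\<^sub>R x)) * (cis (x \<bullet> \<xi>) * g \<xi>)" for x \<xi>
        using cis_mult[of "x \<bullet> \<xi>" "- (x \<bullet> \<xi>0)"] by (simp add: inner_diff_right mult_ac)
      then have "(\<integral>\<xi>. cis (x \<bullet> (\<xi> - \<xi>0)) * (g \<xi> * e (eps n *\<^sub>R x)) \<partial>lborel)
          = cis (- (x \<bullet> \<xi>0)) * e (eps n *\<^sub>R x) * (\<integral>\<xi>. cis (x \<bullet> \<xi>) * g \<xi> \<partial>lborel)" for x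
        by (simp only: integral_mult_right_zero)
      note eq = this
      show ?thesis
        unfolding I_def inv_fourier_def D_def[symmetric] eq by (simp add: mult_ac)
    qed
    also have "(\<integral>x. (\<integral>\<xi>. cis (x \<bullet> (\<xi> - \<xi>0)) * (g \<xi> * e (eps n *\<^sub>R x)) \<partial>lborel) \<partial>lborel)
      = (\<integral>\<xi>. (\<integral>x. cis (x \<bullet> (\<xi> - \<xi>0)) * (g \<xi> * e (eps n *\<^sub>R x)) \<partial>lborel) \<partial>lborel)"
      using integrable_prod_mult[OF g ee_int, of "\<lambda>(\<xi>, x). x \<bullet> (\<xi> - \<xi>0)"]
      by (intro lborel_pair.Fubini_integral) auto
    also have "\<dots> = (\<integral>\<xi>. g \<xi> * (\<integral>x. cis (x \<bullet> (\<xi> - \<xi>0)) * e (eps n *\<^sub>R x) \<partial>lborel) \<partial>lborel)"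
      by (simp only: mult.left_commute[of _ "g _"] integral_mult_right_zero)
    also have "\<dots> = (\<bar>eps n\<bar> ^ DIM('a)) *\<^sub>R
        (\<integral>\<eta>. g (\<xi>0 + eps n *\<^sub>R \<eta>) * (\<integral>x. cis (x \<bullet> (eps n *\<^sub>R \<eta>)) * e (eps n *\<^sub>R x) \<partial>lborel) \<partial>lborel)"
      using eps_pos[of n] by (subst integral_lborel_affine[where c="eps n" and t=\<xi>0]) auto
    also have "\<dots> = (\<integral>\<eta>. g (\<xi>0 + eps n *\<^sub>R \<eta>) *
        ((\<bar>eps n\<bar> ^ DIM('a)) *\<^sub>R (\<integral>x. cis ((0 + eps n *\<^sub>R x) \<bullet> \<eta>) * e (0 + eps n *\<^sub>R x) \<partial>lborel)) \<partial>lborel)"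
      by (simp add: mult_ac)
    also have "\<dots> = (\<integral>\<eta>. g (\<xi>0 + eps n *\<^sub>R \<eta>) * (\<integral>x. cis (x \<bullet> \<eta>) * e x \<partial>lborel) \<partial>lborel)"
      using eps_pos[of n]
      by (subst (2) integral_lborel_affine[where c="eps n" and t=0]) auto
    also have "\<dots> = (\<integral>\<eta>. g (\<xi>0 + eps n *\<^sub>R \<eta>) * e \<eta> \<partial>lborel) * of_real s"
      unfolding e_def gaussian_fourier(2) s_def of_real_mult
      by (simp only: mult.left_commute[of "g _" "complex_of_real (sqrt _ ^ _)"] integral_mult_right_zero)
        (rule mult.commute)
    finally show ?thesis using s by (simp add: Ds s_def[symmetric])
  qed
  have lim: "(\<lambda>n. (\<integral>\<eta>. g (\<xi>0 + eps n *\<^sub>R \<eta>) * e \<eta> \<partial>lborel)) \<longlonglongrightarrow> (\<integral>\<eta>. g \<xi>0 * e \<eta> \<partial>lborel)"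
  proof (rule integral_dominated_convergence)
    show "integrable lborel (\<lambda>x. B * norm (e x))" using e_int by simp
    show "AE x in lborel. norm (g (\<xi>0 + eps n *\<^sub>R x) * e x) \<le> B * norm (e x)" for n
      using bdd by (auto simp: norm_mult intro!: mult_right_mono)
    have "(\<lambda>n. g (\<xi>0 + eps n *\<^sub>R x)) \<longlonglongrightarrow> g \<xi>0" for x
    proof -
      have "(\<lambda>n. g (\<xi>0 + eps n *\<^sub>R x)) \<longlonglongrightarrow> g (\<xi>0 + 0 *\<^sub>R x)"
        by (rule continuous_on_tendsto_compose[OF cont tendsto_add[OF tendsto_const tendsto_scaleR[OF eps0 tendsto_const]]]) auto
      then show ?thesis by simp
    qed
    then show "AE x in lborel. (\<lambda>n. g (\<xi>0 + eps n *\<^sub>R x) * e x) \<longlonglongrightarrow> g \<xi>0 * e x"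
      by (auto intro!: tendsto_intros)
  qed measurable
  have val: "(\<integral>\<eta>. g \<xi>0 * e \<eta> \<partial>lborel) = g \<xi>0 * of_real (sqrt (2 * pi) ^ DIM('a))"
    using gaussian_fourier(2)[of "0::'a"] by (simp add: e_def)
  have "I \<longlonglongrightarrow> g \<xi>0 * of_real (sqrt (2 * pi) ^ DIM('a)) / of_real (sqrt (2 * pi) ^ DIM('a))"
    unfolding I_eq using lim unfolding val by (rule tendsto_divide) auto
  then have "I \<longlonglongrightarrow> g \<xi>0" by simp
  with I_lim show ?thesis by (rule LIMSEQ_unique)
qed

text \<open>
  Used in both directions: it turns a Fourier multiplier into a convolution with an integrable kernel,
  and it shows that a convolution with a kernel whose transform is \<open>1\<close> on the support of \<open>g\<close> changes
  nothing.
\<close>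
lemma convolution_inv_fourier:
  fixes h g :: "'a::euclidean_space \<Rightarrow> complex"
  assumes h: "integrable lborel h" and g: "integrable lborel g"
  shows "(\<integral>z. h z * inv_fourier g (x - z) \<partial>lborel) = inv_fourier (\<lambda>\<xi>. g \<xi> * fourier h \<xi>) x"
proof -
  have "(\<integral>z. h z * inv_fourier g (x - z) \<partial>lborel)
      = (\<integral>z. (\<integral>\<xi>. cis ((x - z) \<bullet> \<xi>) * (h z * g \<xi>) \<partial>lborel) \<partial>lborel) / of_real ((2 * pi) ^ DIM('a))"
    unfolding inv_fourier_def
    by (simp add: mult_ac flip: integral_mult_right_zero integral_divide_zero)
  also have "(\<integral>z. (\<integral>\<xi>. cis ((x - z) \<bullet> \<xi>) * (h z * g \<xi>) \<partial>lborel) \<partial>lborel)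
      = (\<integral>\<xi>. (\<integral>z. cis ((x - z) \<bullet> \<xi>) * (h z * g \<xi>) \<partial>lborel) \<partial>lborel)"
    using integrable_prod_mult[OF h g, of "\<lambda>(z, \<xi>). (x - z) \<bullet> \<xi>"]
    by (intro lborel_pair.Fubini_integral[symmetric]) auto
  also have "\<dots> = (\<integral>\<xi>. cis (x \<bullet> \<xi>) * (g \<xi> * fourier h \<xi>) \<partial>lborel)"
  proof -
    have "cis ((x - z) \<bullet> \<xi>) * (h z * g \<xi>) = cis (x \<bullet> \<xi>) * g \<xi> * (cis (- (z \<bullet> \<xi>)) * h z)" for z \<xi>
      using cis_mult[of "x \<bullet> \<xi>" "- (z \<bullet> \<xi>)"] by (simp add: inner_diff_left)
    then show ?thesis
      unfolding fourier_def by (simp only: integral_mult_right_zero mult.assoc)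
  qed
  finally show ?thesis by (simp add: inv_fourier_def)
qed

section \<open>Rapid decay of inverse Fourier transforms\<close>

lemma Ck_SucI:
  assumes "\<And>x. (f has_derivative f' x) (at x)" "\<And>v. Ck n (\<lambda>x. f' x v)"
  shows "Ck (Suc n) f"
proof -
  have "frechet_derivative f (at x) = f' x" for x
    using frechet_derivative_at[OF assms(1)] by simp
  with assms show ?thesis by (auto simp: differentiable_def)
qed

lemma Ck_continuous: "Ck n f \<Longrightarrow> continuous_on UNIV f"
  by (cases n) (auto simp: continuous_on_eq_continuous_at differentiable_imp_continuous_within)

lemma Ck_derivative: "Ck (Suc n) f \<Longrightarrow> (f has_derivative frechet_derivative f (at x)) (at x)"
  by (auto simp: frechet_derivative_works)

lemma Ck_add: "Ck n f \<Longrightarrow> Ck n g \<Longrightarrow> Ck n (\<lambda>x. f x + g x)"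
proof (induction n arbitrary: f g)
  case (Suc n)
  show ?case
    by (rule Ck_SucI[OF has_derivative_add[OF Ck_derivative[OF Suc.prems(1)] Ck_derivative[OF Suc.prems(2)]]])
      (use Suc in auto)
qed (auto intro: continuous_intros)

lemma Ck_cmult: "Ck n f \<Longrightarrow> Ck n (\<lambda>x. c * f x)"
proof (induction n arbitrary: f)
  case (Suc n)
  show ?case
    by (rule Ck_SucI[OF has_derivative_mult_right[OF Ck_derivative[OF Suc.prems(1)]]])
      (use Suc in auto)
qed (auto intro: continuous_intros)

lemma smooth_directional_derivative:
  "smooth f \<Longrightarrow> smooth (\<lambda>x. frechet_derivative f (at x) v)"
  unfolding smooth_def using Ck.simps(2) by blast

lemma smooth_has_derivative:
  "smooth f \<Longrightarrow> (f has_derivative frechet_derivative f (at x)) (at x)"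
  unfolding smooth_def using Ck_derivative by blast

text \<open>
  The product rule expresses the derivative of the product by \<open>f\<close> and by the product of the linear form
  with a derivative of \<open>f\<close>; the induction on the order therefore runs over all smooth \<open>f\<close>
  simultaneously.
\<close>
lemma smooth_linear_mult:
  fixes f :: "'a::euclidean_space \<Rightarrow> real"
  assumes "smooth f"
  shows "smooth (\<lambda>\<xi>. (w \<bullet> \<xi>) * f \<xi>)"
  unfolding smooth_def
proof
  fix n show "Ck n (\<lambda>\<xi>. (w \<bullet> \<xi>) * f \<xi>)"
    using assms
  proof (induction n arbitrary: f)
    case 0
    then have "continuous_on UNIV f" unfolding smooth_def using Ck_continuous by blast
    then show ?case
      unfolding Ck.simps by (intro continuous_on_mult continuous_on_inner continuous_on_const continuous_on_id)
  next
    case (Suc n)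
    show ?case
    proof (rule Ck_SucI)
      show "((\<lambda>\<xi>. (w \<bullet> \<xi>) * f \<xi>) has_derivative
          (\<lambda>v. (w \<bullet> \<xi>) * frechet_derivative f (at \<xi>) v + (w \<bullet> v) * f \<xi>)) (at \<xi>)" for \<xi>
        by (auto intro!: derivative_eq_intros smooth_has_derivative[OF Suc.prems])
      show "Ck n (\<lambda>\<xi>. (w \<bullet> \<xi>) * frechet_derivative f (at \<xi>) v + (w \<bullet> v) * f \<xi>)" for v
        using Suc.prems
        by (intro Ck_add Ck_cmult Suc.IH smooth_directional_derivative) (auto simp: smooth_def)
    qed
  qed
qed

text \<open>
  The strict inequality makes the region where \<open>g\<close> must vanish open, so that derivatives vanish there
  as well.
\<close>
definition test_function :: "real \<Rightarrow> ('a::euclidean_space \<Rightarrow> real) \<Rightarrow> bool" where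
  "test_function R g \<longleftrightarrow> smooth g \<and> (\<forall>\<xi>. R < norm \<xi> \<longrightarrow> g \<xi> = 0)"

lemma test_function_continuous: "test_function R g \<Longrightarrow> continuous_on UNIV g"
  unfolding test_function_def smooth_def using Ck_continuous by blast

lemma test_function_linear_mult:
  "test_function R g \<Longrightarrow> test_function R (\<lambda>\<xi>. (w \<bullet> \<xi>) * g \<xi>)"
  by (auto simp: test_function_def smooth_linear_mult)

lemma test_function_linear_power_mult:
  assumes "test_function R g"
  shows "test_function R (\<lambda>\<xi>. (w \<bullet> \<xi>) ^ M * g \<xi>)"
proof (induction M)
  case (Suc M)
  show ?case using test_function_linear_mult[OF Suc, of w] by (simp add: mult.assoc)
qed (simp add: assms)

lemma test_function_directional_derivative:
  assumes g: "test_function R g"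
  shows "test_function R (\<lambda>\<xi>. frechet_derivative g (at \<xi>) v)"
proof -
  have "frechet_derivative g (at \<xi>) v = 0" if "R < norm \<xi>" for \<xi>
  proof -
    have "open {\<xi>::'a. R < norm \<xi>}" by (intro open_Collect_less continuous_intros)
    then have "(g has_derivative (\<lambda>_. 0)) (at \<xi>)"
      using that g by (intro has_derivative_transform_within_open[OF has_derivative_const[of 0]])
        (auto simp: test_function_def)
    then have "frechet_derivative g (at \<xi>) = (\<lambda>_. 0)" using frechet_derivative_at by metis
    then show ?thesis by simp
  qed
  then show ?thesis
    using g smooth_directional_derivative unfolding test_function_def by blast
qed

lemma test_function_bounded:
  assumes g: "test_function R g"
  obtains B where "0 \<le> B" "\<And>\<xi>. \<bar>g \<xi>\<bar> \<le> B * indicator (cball 0 R) \<xi>"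
proof -
  have "compact (g ` cball 0 R)"
    using test_function_continuous[OF g]
    by (intro compact_continuous_image) (auto intro: continuous_on_subset)
  then obtain B where B: "\<And>y. y \<in> g ` cball 0 R \<Longrightarrow> norm y \<le> B"
    using compact_imp_bounded bounded_iff by metis
  show ?thesis
  proof
    show "0 \<le> max B 0" by simp
    show "\<bar>g \<xi>\<bar> \<le> max B 0 * indicator (cball 0 R) \<xi>" for \<xi>
      using B[of "g \<xi>"] g by (cases "norm \<xi> \<le> R") (auto simp: test_function_def)
  qed
qed

lemma integrable_cball: "integrable lborel (\<lambda>\<xi>. B * indicator (cball (c::'a::euclidean_space) R) \<xi> :: real)"
  by (intro integrable_mult_right integrable_real_indicator)
    (use emeasure_lborel_cball_finite[of c R] in auto)

lemma test_function_integrable: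
  assumes g: "test_function R g"
  shows "integrable lborel (\<lambda>\<xi>. complex_of_real (g \<xi>))"
proof -
  obtain B where B: "0 \<le> B" "\<And>\<xi>. \<bar>g \<xi>\<bar> \<le> B * indicator (cball 0 R) \<xi>"
    using test_function_bounded[OF g] by blast
  have [measurable]: "g \<in> borel_measurable borel"
    using test_function_continuous[OF g] by (rule borel_measurable_continuous_onI)
  show ?thesis
    by (rule Bochner_Integration.integrable_bound[OF integrable_cball[of B 0 R]])
      (use B(2) in \<open>auto intro!: AE_I2 order_trans[OF B(2)]\<close>)
qed

lemma norm_inv_fourier_le:
  fixes g :: "'a::euclidean_space \<Rightarrow> complex"
  shows "norm (inv_fourier g x) \<le> (\<integral>\<xi>. norm (g \<xi>) \<partial>lborel)"
proof -
  have 1: "1 \<le> (2 * pi) ^ DIM('a)"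
    by (rule one_le_power) (use pi_gt3 in simp)
  have "norm (\<integral>\<xi>. cis (x \<bullet> \<xi>) * g \<xi> \<partial>lborel) \<le> (\<integral>\<xi>. norm (g \<xi>) \<partial>lborel)"
    using integral_norm_bound[of lborel "\<lambda>\<xi>. cis (x \<bullet> \<xi>) * g \<xi>"] by simp
  moreover have "norm (\<integral>\<xi>. cis (x \<bullet> \<xi>) * g \<xi> \<partial>lborel) / (2 * pi) ^ DIM('a)
      \<le> norm (\<integral>\<xi>. cis (x \<bullet> \<xi>) * g \<xi> \<partial>lborel) / 1"
    using 1 by (intro divide_left_mono) auto
  ultimately show ?thesis
    by (simp add: inv_fourier_def norm_divide norm_power norm_mult)
qed

lemma iexp_difference_quotient:
  fixes X :: "nat \<Rightarrow> real"
  assumes X: "X \<longlonglongrightarrow> 0" "\<And>n. X n \<noteq> 0"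
  shows "(\<lambda>n. (cis (X n * b) - 1) / of_real (X n)) \<longlonglongrightarrow> \<i> * of_real b"
proof -
  have "((\<lambda>z. exp (\<i> * of_real b * z)) has_field_derivative \<i> * of_real b) (at 0)"
    by (auto intro!: derivative_eq_intros)
  then have *: "((\<lambda>h. (exp (\<i> * of_real b * h) - 1) / h) \<longlongrightarrow> \<i> * of_real b) (at 0)"
    by (simp add: DERIV_def)
  have "filterlim (\<lambda>n. complex_of_real (X n)) (at 0) sequentially"
    using X by (auto simp: filterlim_at intro!: tendsto_eq_intros)
  from filterlim_compose[OF * this] show ?thesis
    by (simp add: cis_conv_exp mult_ac)
qed

lemma norm_cis_minus_one_le: "norm (cis u - 1) \<le> \<bar>u\<bar>"
  using iexp_approx1[of u 0] by (simp add: cis_conv_exp)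

text \<open>
  Integration by parts without coordinates. By translation invariance, the transform of the difference
  quotient of \<open>g\<close> along \<open>v\<close> is a difference quotient of \<open>t \<mapsto> cis (- t (x \<bullet> v))\<close> times the transform of
  \<open>g\<close>; both sides converge as the step tends to zero.
\<close>
lemma inv_fourier_directional_derivative:
  fixes g :: "'a::euclidean_space \<Rightarrow> real"
  assumes g: "test_function R g"
  shows "of_real (x \<bullet> v) * inv_fourier (\<lambda>\<xi>. of_real (g \<xi>)) x
       = \<i> * inv_fourier (\<lambda>\<xi>. of_real (frechet_derivative g (at \<xi>) v)) x"
proof -
  define g' where "g' \<xi> = frechet_derivative g (at \<xi>) v" for \<xi>
  have g': "test_function R g'" unfolding g'_def using g by (rule test_function_directional_derivative)
  have [measurable]: "g \<in> borel_measurable borel" "g' \<in> borel_measurable borel"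
    using test_function_continuous[OF g] test_function_continuous[OF g'] by (auto intro: borel_measurable_continuous_onI)
  obtain B where B: "0 \<le> B" "\<And>\<xi>. \<bar>g' \<xi>\<bar> \<le> B * indicator (cball 0 R) \<xi>"
    using test_function_bounded[OF g'] by blast
  define K where "K = (\<integral>\<xi>. cis (x \<bullet> \<xi>) * of_real (g \<xi>) \<partial>lborel)"
  define X where "X n = 1 / real (Suc n)" for n
  have X0: "X \<longlonglongrightarrow> 0" unfolding X_def by (rule LIMSEQ_Suc[OF lim_1_over_n])
  have Xpos: "0 < X n" "X n \<le> 1" for n by (auto simp: X_def)
  define D where "D n \<xi> = (g (\<xi> + X n *\<^sub>R v) - g \<xi>) / X n" for n \<xi>
  have line: "((\<lambda>t. g (\<xi> + t *\<^sub>R v)) has_real_derivative g' (\<xi> + t *\<^sub>R v)) (at t)" for \<xi> t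
  proof -
    have "smooth g" using g by (simp add: test_function_def)
    have "((\<lambda>t. g (\<xi> + t *\<^sub>R v)) has_derivative (\<lambda>h. frechet_derivative g (at (\<xi> + t *\<^sub>R v)) (h *\<^sub>R v))) (at t)"
      by (rule has_derivative_compose[OF _ smooth_has_derivative[OF \<open>smooth g\<close>]])
        (auto intro!: derivative_eq_intros)
    moreover have "linear (frechet_derivative g (at (\<xi> + t *\<^sub>R v)))"
      using smooth_has_derivative[OF \<open>smooth g\<close>] by (intro linear_frechet_derivative) (auto simp: differentiable_def)
    then have "frechet_derivative g (at (\<xi> + t *\<^sub>R v)) (h *\<^sub>R v) = g' (\<xi> + t *\<^sub>R v) * h" for h
      by (simp add: g'_def linear_cmul)
    ultimately show ?thesis by (simp add: has_field_derivative_def mult_commute_abs)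
  qed
  have "(\<lambda>n. \<integral>\<xi>. cis (x \<bullet> \<xi>) * of_real (D n \<xi>) \<partial>lborel) \<longlonglongrightarrow> (\<integral>\<xi>. cis (x \<bullet> \<xi>) * of_real (g' \<xi>) \<partial>lborel)"
  proof (rule integral_dominated_convergence)
    show "integrable lborel (\<lambda>\<xi>. B * indicator (cball 0 (R + norm v)) \<xi> :: real)" by (rule integrable_cball)
    show "AE \<xi> in lborel. norm (cis (x \<bullet> \<xi>) * of_real (D n \<xi>)) \<le> B * indicator (cball 0 (R + norm v)) \<xi>" for n
    proof (rule AE_I2)
      fix \<xi>
      obtain s where s: "0 < s" "s < X n" "g (\<xi> + X n *\<^sub>R v) - g (\<xi> + 0 *\<^sub>R v) = (X n - 0) * g' (\<xi> + s *\<^sub>R v)"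
        using MVT2[of 0 "X n" "\<lambda>t. g (\<xi> + t *\<^sub>R v)" "\<lambda>t. g' (\<xi> + t *\<^sub>R v)"] line Xpos by auto
      then have "D n \<xi> = g' (\<xi> + s *\<^sub>R v)" using Xpos(1)[of n] by (simp add: D_def)
      moreover have "norm \<xi> \<le> R + norm v" if "norm (\<xi> + s *\<^sub>R v) \<le> R"
      proof -
        have "norm \<xi> \<le> norm (\<xi> + s *\<^sub>R v) + norm (s *\<^sub>R v)"
          using norm_triangle_ineq4[of "\<xi> + s *\<^sub>R v" "s *\<^sub>R v"] by simp
        moreover have "norm (s *\<^sub>R v) \<le> 1 * norm v"
          using s Xpos[of n] mult_right_mono[of s 1 "norm v"] by simp
        ultimately show ?thesis using that by simp
      qed
      ultimately show "norm (cis (x \<bullet> \<xi>) * of_real (D n \<xi>)) \<le> B * indicator (cball 0 (R + norm v)) \<xi>"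
        using B(1) B(2)[of "\<xi> + s *\<^sub>R v"] by (cases "norm (\<xi> + s *\<^sub>R v) \<le> R") simp_all
    qed
    have "(\<lambda>n. D n \<xi>) \<longlonglongrightarrow> g' \<xi>" for \<xi>
    proof -
      have "((\<lambda>h. (g (\<xi> + h *\<^sub>R v) - g \<xi>) / h) \<longlongrightarrow> g' \<xi>) (at 0)"
        using line[of \<xi> 0] by (simp add: DERIV_def)
      moreover have "filterlim X (at 0) sequentially"
        using X0 Xpos(1) by (auto simp: filterlim_at less_imp_neq[symmetric] intro!: always_eventually)
      ultimately show ?thesis unfolding D_def by (rule filterlim_compose)
    qed
    then show "AE \<xi> in lborel. (\<lambda>n. cis (x \<bullet> \<xi>) * of_real (D n \<xi>)) \<longlonglongrightarrow> cis (x \<bullet> \<xi>) * of_real (g' \<xi>)"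
      by (intro AE_I2 tendsto_mult tendsto_const tendsto_of_real)
  qed (unfold D_def, measurable)
  moreover have "(\<integral>\<xi>. cis (x \<bullet> \<xi>) * of_real (D n \<xi>) \<partial>lborel) = (cis (X n * - (x \<bullet> v)) - 1) / of_real (X n) * K" for n
  proof -
    have gi: "integrable lborel (\<lambda>\<xi>. cis (x \<bullet> \<xi>) * of_real (g \<xi>))"
      by (rule integrable_cis_mult[OF test_function_integrable[OF g]]) simp
    have gi': "integrable lborel (\<lambda>\<xi>. cis (x \<bullet> \<xi>) * of_real (g (\<xi> + X n *\<^sub>R v)))"
      using integrable_lborel_affine[OF test_function_integrable[OF g], of 1 "X n *\<^sub>R v"]
      by (intro integrable_cis_mult) (auto simp: add.commute)
    have "(\<integral>\<xi>. cis (x \<bullet> \<xi>) * of_real (g (\<xi> + X n *\<^sub>R v)) \<partial>lborel)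
        = (\<integral>\<xi>. cis (x \<bullet> (- (X n *\<^sub>R v) + 1 *\<^sub>R \<xi>)) * of_real (g (- (X n *\<^sub>R v) + 1 *\<^sub>R \<xi> + X n *\<^sub>R v)) \<partial>lborel)"
      by (subst integral_lborel_affine[where c=1 and t="- (X n *\<^sub>R v)"]) auto
    also have "\<dots> = cis (X n * - (x \<bullet> v)) * K"
    proof -
      have "cis (x \<bullet> (- (X n *\<^sub>R v) + \<xi>)) = cis (X n * - (x \<bullet> v)) * cis (x \<bullet> \<xi>)" for \<xi>
        by (simp add: cis_mult inner_add_right inner_diff_right)
      then show ?thesis unfolding K_def by (simp add: mult.assoc)
    qed
    finally have shift: "(\<integral>\<xi>. cis (x \<bullet> \<xi>) * of_real (g (\<xi> + X n *\<^sub>R v)) \<partial>lborel) = cis (X n * - (x \<bullet> v)) * K" .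
    have "(\<integral>\<xi>. cis (x \<bullet> \<xi>) * of_real (D n \<xi>) \<partial>lborel)
        = (\<integral>\<xi>. (cis (x \<bullet> \<xi>) * of_real (g (\<xi> + X n *\<^sub>R v)) - cis (x \<bullet> \<xi>) * of_real (g \<xi>)) / of_real (X n) \<partial>lborel)"
      by (intro Bochner_Integration.integral_cong) (auto simp: D_def field_simps)
    also have "\<dots> = (cis (X n * - (x \<bullet> v)) * K - K) / of_real (X n)"
      using gi gi' by (simp add: shift flip: K_def)
    finally show ?thesis by (simp add: field_simps)
  qed
  ultimately have "(\<lambda>n. (cis (X n * - (x \<bullet> v)) - 1) / of_real (X n) * K) \<longlonglongrightarrow> (\<integral>\<xi>. cis (x \<bullet> \<xi>) * of_real (g' \<xi>) \<partial>lborel)"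
    by simp
  moreover have "(\<lambda>n. (cis (X n * - (x \<bullet> v)) - 1) / of_real (X n) * K) \<longlonglongrightarrow> \<i> * of_real (- (x \<bullet> v)) * K"
    using Xpos(1) by (intro tendsto_mult tendsto_const iexp_difference_quotient X0) (metis less_irrefl)
  ultimately have "(\<integral>\<xi>. cis (x \<bullet> \<xi>) * of_real (g' \<xi>) \<partial>lborel) = \<i> * of_real (- (x \<bullet> v)) * K"
    by (rule LIMSEQ_unique)
  then show ?thesis
    unfolding inv_fourier_def K_def[symmetric] g'_def[symmetric] by (simp add: field_simps)
qed

lemma inv_fourier_power_bounded:
  fixes g :: "'a::euclidean_space \<Rightarrow> real"
  assumes "test_function R g"
  shows "\<exists>C. \<forall>x. \<bar>x \<bullet> b\<bar> ^ N * norm (inv_fourier (\<lambda>\<xi>. of_real (g \<xi>)) x) \<le> C"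
  using assms
proof (induction N arbitrary: g)
  case 0
  then show ?case using norm_inv_fourier_le[of "\<lambda>\<xi>. of_real (g \<xi>)"] by auto
next
  case (Suc N)
  define g' where "g' \<xi> = frechet_derivative g (at \<xi>) b" for \<xi>
  obtain C where C: "\<And>x. \<bar>x \<bullet> b\<bar> ^ N * norm (inv_fourier (\<lambda>\<xi>. of_real (g' \<xi>)) x) \<le> C"
    using Suc.IH[OF test_function_directional_derivative[OF Suc.prems], of b] by (auto simp: g'_def)
  have "\<bar>x \<bullet> b\<bar> * norm (inv_fourier (\<lambda>\<xi>. of_real (g \<xi>)) x) = norm (inv_fourier (\<lambda>\<xi>. of_real (g' \<xi>)) x)" for x
    using arg_cong[OF inv_fourier_directional_derivative[OF Suc.prems, of x b], of norm]
    by (simp add: norm_mult g'_def)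
  then have eq: "\<bar>x \<bullet> b\<bar> ^ Suc N * norm (inv_fourier (\<lambda>\<xi>. of_real (g \<xi>)) x)
      = \<bar>x \<bullet> b\<bar> ^ N * norm (inv_fourier (\<lambda>\<xi>. of_real (g' \<xi>)) x)" for x
    by (simp add: mult_ac)
  show ?case by (intro exI[of _ C] allI) (simp only: eq C)
qed

definition decay :: "real \<Rightarrow> 'a::euclidean_space \<Rightarrow> real" where
  "decay s x = (1 + norm x) powr (- s)"

lemma decay_nonneg [simp]: "0 \<le> decay s x"
  by (simp add: decay_def)

lemma measurable_decay [measurable]: "decay s \<in> borel_measurable borel"
  unfolding decay_def by measurable

text \<open>
  Each integration by parts along a basis vector \<open>b\<close> gains a factor \<open>x \<bullet> b\<close>, and for every \<open>x\<close> some
  coordinate is at least \<open>norm x / DIM('a)\<close> in absolute value.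
\<close>
lemma inv_fourier_decay:
  fixes g :: "'a::euclidean_space \<Rightarrow> real"
  assumes g: "test_function R g"
  shows "\<exists>C\<ge>0. \<forall>x. norm (inv_fourier (\<lambda>\<xi>. of_real (g \<xi>)) x) \<le> C * decay (real N) x"
proof -
  define h where "h x = norm (inv_fourier (\<lambda>\<xi>. of_real (g \<xi>)) x)" for x
  have "\<forall>b. \<exists>C. \<forall>x. \<bar>x \<bullet> b\<bar> ^ N * h x \<le> C" using inv_fourier_power_bounded[OF g] by (simp add: h_def)
  then obtain C where C: "\<And>b x. \<bar>x \<bullet> b\<bar> ^ N * h x \<le> C b" by metis
  obtain C0 where C0: "\<And>x. h x \<le> C0"
    using norm_inv_fourier_le[of "\<lambda>\<xi>. of_real (g \<xi>)"] by (auto simp: h_def)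
  have h0: "0 \<le> h x" for x by (simp add: h_def)
  have Cb: "0 \<le> C b" for b using C[of 0 b] h0 by (smt (verit) mult_nonneg_nonneg zero_le_power abs_ge_zero)
  define d where "d = real DIM('a)"
  have d: "1 \<le> d" using DIM_positive[where 'a='a] by (simp add: d_def Suc_le_eq)
  define CC where "CC = 2 ^ N * (C0 + d ^ N * (\<Sum>b\<in>Basis. C b))"
  have bound: "(1 + norm x) ^ N * h x \<le> CC" for x
  proof -
    obtain b :: 'a where b: "b \<in> Basis" "norm x \<le> d * \<bar>x \<bullet> b\<bar>"
    proof (rule ccontr)
      assume "\<not> thesis"
      then have "\<And>b. b \<in> Basis \<Longrightarrow> \<bar>x \<bullet> b\<bar> < norm x / d"
        using that d by (fastforce simp: field_simps not_le)
      then have "(\<Sum>b\<in>Basis. \<bar>x \<bullet> b\<bar>) < (\<Sum>b\<in>(Basis::'a set). norm x / d)"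
        by (intro sum_strict_mono) auto
      then have "(\<Sum>b\<in>Basis. \<bar>x \<bullet> b\<bar>) < norm x" using d by (simp add: d_def)
      then show False using norm_le_l1[of x] by simp
    qed
    have "(1 + norm x) ^ N \<le> (2 * max 1 (norm x)) ^ N" by (intro power_mono) auto
    also have "\<dots> = 2 ^ N * (max 1 (norm x)) ^ N" by (rule power_mult_distrib)
    also have "\<dots> \<le> 2 ^ N * (1 + norm x ^ N)" by (intro mult_left_mono) (auto simp: max_def)
    also have "\<dots> \<le> 2 ^ N * (1 + (d * \<bar>x \<bullet> b\<bar>) ^ N)"
      using b by (intro mult_left_mono add_left_mono power_mono) auto
    finally have "(1 + norm x) ^ N * h x \<le> 2 ^ N * (1 + (d * \<bar>x \<bullet> b\<bar>) ^ N) * h x"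
      by (rule mult_right_mono[OF _ h0])
    also have "\<dots> = 2 ^ N * (h x + d ^ N * (\<bar>x \<bullet> b\<bar> ^ N * h x))"
      by (simp add: power_mult_distrib algebra_simps)
    also have "\<dots> \<le> CC"
      unfolding CC_def
    proof (intro mult_left_mono add_mono C0)
      have "\<bar>x \<bullet> b\<bar> ^ N * h x \<le> C b" by (rule C)
      also have "\<dots> \<le> (\<Sum>b\<in>Basis. C b)" using b Cb by (intro member_le_sum) auto
      finally show "\<bar>x \<bullet> b\<bar> ^ N * h x \<le> (\<Sum>b\<in>Basis. C b)" .
    qed (use d in auto)
    finally show ?thesis .
  qed
  have pos: "0 < 1 + norm x" for x :: 'a by (simp add: add_pos_nonneg)
  have "h x \<le> CC * decay (real N) x" for x
    using bound[of x] pos[of x]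
    by (simp add: decay_def powr_minus powr_realpow field_simps)
  moreover have "0 \<le> CC" using bound[of 0] h0[of 0] by simp
  ultimately show ?thesis unfolding h_def by blast
qed

text \<open>
  The point is that the constant does not depend on \<open>w\<close>. One factor \<open>w \<bullet> \<xi>\<close> at a time is expanded in
  coordinates, \<open>w \<bullet> \<xi> = (\<Sum>b\<in>Basis. (w \<bullet> b) * (b \<bullet> \<xi>))\<close>; the coefficients \<open>w \<bullet> b\<close> are at most \<open>1\<close>
  in absolute value, and \<open>b \<bullet> \<xi>\<close> is absorbed into the test function.
\<close>
lemma inv_fourier_linear_power_decay:
  fixes g :: "'a::euclidean_space \<Rightarrow> real"
  assumes "test_function R g"
  shows "\<exists>C\<ge>0. \<forall>w x. norm w \<le> 1 \<longrightarrow>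
    norm (inv_fourier (\<lambda>\<xi>. of_real ((w \<bullet> \<xi>) ^ M * g \<xi>)) x) \<le> C * decay (real N) x"
  using assms
proof (induction M arbitrary: g)
  case 0
  then show ?case using inv_fourier_decay[OF 0, of N] by (auto simp: simp_thms)
next
  case (Suc M)
  have "\<forall>b. \<exists>C\<ge>0. \<forall>w x. norm w \<le> 1 \<longrightarrow>
    norm (inv_fourier (\<lambda>\<xi>. of_real ((w \<bullet> \<xi>) ^ M * ((b \<bullet> \<xi>) * g \<xi>))) x) \<le> C * decay (real N) x"
    using Suc.IH[OF test_function_linear_mult[OF Suc.prems]] by blast
  then obtain C where C: "\<And>b. 0 \<le> C b" "\<And>b w x. norm w \<le> 1 \<Longrightarrow>
    norm (inv_fourier (\<lambda>\<xi>. of_real ((w \<bullet> \<xi>) ^ M * ((b \<bullet> \<xi>) * g \<xi>))) x) \<le> C b * decay (real N) x"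
    by metis
  have "norm (inv_fourier (\<lambda>\<xi>. of_real ((w \<bullet> \<xi>) ^ Suc M * g \<xi>)) x) \<le> (\<Sum>b\<in>Basis. C b) * decay (real N) x"
    if w: "norm w \<le> 1" for w x :: 'a
  proof -
    have exp: "complex_of_real ((w \<bullet> \<xi>) ^ Suc M * g \<xi>)
        = (\<Sum>b\<in>Basis. of_real (w \<bullet> b) * of_real ((w \<bullet> \<xi>) ^ M * ((b \<bullet> \<xi>) * g \<xi>)))" for \<xi>
    proof -
      have "(w \<bullet> \<xi>) ^ Suc M * g \<xi> = (\<Sum>b\<in>Basis. (w \<bullet> b) * (\<xi> \<bullet> b)) * ((w \<bullet> \<xi>) ^ M * g \<xi>)"
        using euclidean_inner[of w \<xi>] by simp
      also have "\<dots> = (\<Sum>b\<in>Basis. (w \<bullet> b) * ((w \<bullet> \<xi>) ^ M * ((b \<bullet> \<xi>) * g \<xi>)))"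
        by (simp add: sum_distrib_right sum_distrib_left mult_ac inner_commute)
      finally show ?thesis by (simp only: of_real_sum of_real_mult)
    qed
    have int: "integrable lborel (\<lambda>\<xi>. cis (x \<bullet> \<xi>) * complex_of_real ((w \<bullet> \<xi>) ^ M * ((b \<bullet> \<xi>) * g \<xi>)))" for b
      by (rule integrable_cis_mult[OF test_function_integrable[OF
            test_function_linear_power_mult[OF test_function_linear_mult[OF Suc.prems]]]]) simp
    have "inv_fourier (\<lambda>\<xi>. of_real ((w \<bullet> \<xi>) ^ Suc M * g \<xi>)) x
        = (\<Sum>b\<in>Basis. of_real (w \<bullet> b) * inv_fourier (\<lambda>\<xi>. of_real ((w \<bullet> \<xi>) ^ M * ((b \<bullet> \<xi>) * g \<xi>))) x)"
    proof -
      have "(\<integral>\<xi>. cis (x \<bullet> \<xi>) * complex_of_real ((w \<bullet> \<xi>) ^ Suc M * g \<xi>) \<partial>lborel)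
          = (\<integral>\<xi>. (\<Sum>b\<in>Basis. of_real (w \<bullet> b) * (cis (x \<bullet> \<xi>) * complex_of_real ((w \<bullet> \<xi>) ^ M * ((b \<bullet> \<xi>) * g \<xi>)))) \<partial>lborel)"
        unfolding exp sum_distrib_left by (simp only: mult.left_commute[of "cis _" "of_real (w \<bullet> _)"])
      also have "\<dots> = (\<Sum>b\<in>Basis. of_real (w \<bullet> b) * (\<integral>\<xi>. cis (x \<bullet> \<xi>) * complex_of_real ((w \<bullet> \<xi>) ^ M * ((b \<bullet> \<xi>) * g \<xi>)) \<partial>lborel))"
        by (subst Bochner_Integration.integral_sum) (auto intro!: integrable_mult_right int simp del: of_real_mult of_real_power)
      finally show ?thesis
        unfolding inv_fourier_def by (simp only: sum_divide_distrib times_divide_eq_right)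
    qed
    also have "norm \<dots> \<le> (\<Sum>b\<in>Basis. C b * decay (real N) x)"
    proof (rule sum_norm_le)
      fix b :: 'a assume b: "b \<in> Basis"
      have "\<bar>w \<bullet> b\<bar> \<le> 1" using Basis_le_norm[OF b, of w] w by simp
      then have "\<bar>w \<bullet> b\<bar> * norm (inv_fourier (\<lambda>\<xi>. of_real ((w \<bullet> \<xi>) ^ M * ((b \<bullet> \<xi>) * g \<xi>))) x) \<le> 1 * (C b * decay (real N) x)"
        using C(2)[OF w] by (intro mult_mono) auto
      then show "norm (of_real (w \<bullet> b) * inv_fourier (\<lambda>\<xi>. of_real ((w \<bullet> \<xi>) ^ M * ((b \<bullet> \<xi>) * g \<xi>))) x) \<le> C b * decay (real N) x"
        by (simp only: norm_mult norm_of_real mult_1)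
    qed
    finally show ?thesis by (simp add: sum_distrib_right)
  qed
  then show ?case using C(1) by (intro exI[of _ "\<Sum>b\<in>Basis. C b"]) (auto intro: sum_nonneg)
qed

text \<open>
  Differentiation along \<open>w\<close> multiplies the symbol by \<open>\<i> * (w \<bullet> \<xi>)\<close>. The statement is a limit of complex
  difference quotients so that its real and imaginary parts are real derivatives.
\<close>
lemma inv_fourier_line_derivative:
  fixes g :: "'a::euclidean_space \<Rightarrow> real"
  assumes g: "test_function R g"
  shows "((\<lambda>h. (inv_fourier (\<lambda>\<xi>. of_real (g \<xi>)) (z + (t + h) *\<^sub>R w) - inv_fourier (\<lambda>\<xi>. of_real (g \<xi>)) (z + t *\<^sub>R w)) / of_real h)
    \<longlongrightarrow> \<i> * inv_fourier (\<lambda>\<xi>. of_real ((w \<bullet> \<xi>) * g \<xi>)) (z + t *\<^sub>R w)) (at 0)"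
  unfolding tendsto_at_iff_sequentially
proof (intro allI impI)
  fix X :: "nat \<Rightarrow> real" assume X: "\<forall>i. X i \<in> UNIV - {0}" "X \<longlonglongrightarrow> 0"
  define y where "y = z + t *\<^sub>R w"
  have y: "z + (t + h) *\<^sub>R w = y + h *\<^sub>R w" for h by (simp add: y_def scaleR_add_left)
  have wg: "test_function R (\<lambda>\<xi>. (w \<bullet> \<xi>) * g \<xi>)" using g by (rule test_function_linear_mult)
  have [measurable]: "g \<in> borel_measurable borel"
    using test_function_continuous[OF g] by (rule borel_measurable_continuous_onI)
  have "(\<lambda>n. \<integral>\<xi>. cis (y \<bullet> \<xi>) * of_real (g \<xi>) * ((cis (X n * (w \<bullet> \<xi>)) - 1) / of_real (X n)) \<partial>lborel)
    \<longlonglongrightarrow> (\<integral>\<xi>. cis (y \<bullet> \<xi>) * of_real (g \<xi>) * (\<i> * of_real (w \<bullet> \<xi>)) \<partial>lborel)"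
  proof (rule integral_dominated_convergence)
    show "integrable lborel (\<lambda>\<xi>. norm (complex_of_real ((w \<bullet> \<xi>) * g \<xi>)))"
      by (rule integrable_norm[OF test_function_integrable[OF wg]])
    show "AE \<xi> in lborel. norm (cis (y \<bullet> \<xi>) * of_real (g \<xi>) * ((cis (X n * (w \<bullet> \<xi>)) - 1) / of_real (X n)))
        \<le> norm (complex_of_real ((w \<bullet> \<xi>) * g \<xi>))" for n
    proof (rule AE_I2)
      fix \<xi>
      have "norm ((cis (X n * (w \<bullet> \<xi>)) - 1) / of_real (X n)) \<le> \<bar>w \<bullet> \<xi>\<bar>"
        using norm_cis_minus_one_le[of "X n * (w \<bullet> \<xi>)"] X(1)
        by (auto simp: norm_divide abs_mult field_simps)
      then have "\<bar>g \<xi>\<bar> * norm ((cis (X n * (w \<bullet> \<xi>)) - 1) / of_real (X n)) \<le> \<bar>g \<xi>\<bar> * \<bar>w \<bullet> \<xi>\<bar>"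
        by (intro mult_left_mono) auto
      then show "norm (cis (y \<bullet> \<xi>) * of_real (g \<xi>) * ((cis (X n * (w \<bullet> \<xi>)) - 1) / of_real (X n)))
        \<le> norm (complex_of_real ((w \<bullet> \<xi>) * g \<xi>))"
        by (simp only: norm_mult norm_cis norm_of_real abs_mult mult_1 mult.commute[of "\<bar>w \<bullet> \<xi>\<bar>" "\<bar>g \<xi>\<bar>"])
    qed
    show "AE \<xi> in lborel. (\<lambda>n. cis (y \<bullet> \<xi>) * of_real (g \<xi>) * ((cis (X n * (w \<bullet> \<xi>)) - 1) / of_real (X n)))
      \<longlonglongrightarrow> cis (y \<bullet> \<xi>) * of_real (g \<xi>) * (\<i> * of_real (w \<bullet> \<xi>))"
      using X by (intro AE_I2 tendsto_mult tendsto_const iexp_difference_quotient) auto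
  qed measurable
  moreover have "(\<integral>\<xi>. cis (y \<bullet> \<xi>) * of_real (g \<xi>) * ((cis (X n * (w \<bullet> \<xi>)) - 1) / of_real (X n)) \<partial>lborel)
      = ((\<integral>\<xi>. cis ((y + X n *\<^sub>R w) \<bullet> \<xi>) * of_real (g \<xi>) \<partial>lborel) - (\<integral>\<xi>. cis (y \<bullet> \<xi>) * of_real (g \<xi>) \<partial>lborel)) / of_real (X n)" for n
  proof -
    have int: "integrable lborel (\<lambda>\<xi>. cis (u \<bullet> \<xi>) * complex_of_real (g \<xi>))" for u
      by (rule integrable_cis_mult[OF test_function_integrable[OF g]]) simp
    have eq: "cis (y \<bullet> \<xi>) * of_real (g \<xi>) * ((cis (X n * (w \<bullet> \<xi>)) - 1) / of_real (X n))
        = (cis ((y + X n *\<^sub>R w) \<bullet> \<xi>) * of_real (g \<xi>) - cis (y \<bullet> \<xi>) * of_real (g \<xi>)) / of_real (X n)" for \<xi>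
      using cis_mult[of "y \<bullet> \<xi>" "X n * (w \<bullet> \<xi>)"] by (simp add: inner_add_left algebra_simps diff_divide_distrib)
    show ?thesis unfolding eq using int by simp
  qed
  moreover have "(\<integral>\<xi>. cis (y \<bullet> \<xi>) * of_real (g \<xi>) * (\<i> * of_real (w \<bullet> \<xi>)) \<partial>lborel)
      = \<i> * (\<integral>\<xi>. cis (y \<bullet> \<xi>) * of_real ((w \<bullet> \<xi>) * g \<xi>) \<partial>lborel)"
    by (subst integral_mult_right_zero[symmetric]) (simp add: mult_ac)
  ultimately have "(\<lambda>n. ((\<integral>\<xi>. cis ((y + X n *\<^sub>R w) \<bullet> \<xi>) * of_real (g \<xi>) \<partial>lborel) - (\<integral>\<xi>. cis (y \<bullet> \<xi>) * of_real (g \<xi>) \<partial>lborel)) / of_real (X n))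
     \<longlonglongrightarrow> \<i> * (\<integral>\<xi>. cis (y \<bullet> \<xi>) * of_real ((w \<bullet> \<xi>) * g \<xi>) \<partial>lborel)"
    by (simp only:)
  from tendsto_divide[OF this tendsto_const, of "of_real ((2 * pi) ^ DIM('a))"]
  show "((\<lambda>h. (inv_fourier (\<lambda>\<xi>. of_real (g \<xi>)) (z + (t + h) *\<^sub>R w) - inv_fourier (\<lambda>\<xi>. of_real (g \<xi>)) (z + t *\<^sub>R w)) / of_real h) \<circ> X)
    \<longlonglongrightarrow> \<i> * inv_fourier (\<lambda>\<xi>. of_real ((w \<bullet> \<xi>) * g \<xi>)) (z + t *\<^sub>R w)"
    unfolding y y_def[symmetric] comp_def inv_fourier_def
    by (simp add: diff_divide_distrib divide_divide_eq_left mult.commute)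
qed

lemma decay_shift_le:
  fixes z v :: "'a::euclidean_space"
  assumes "0 \<le> s" "norm v \<le> 1"
  shows "decay s (z + v) \<le> 2 powr s * decay s z"
proof -
  have "1 + norm z \<le> 2 * (1 + norm (z + v))"
  proof -
    have *: "1 + a \<le> 2 * (1 + b)" if "a \<le> b + c" "c \<le> 1" "0 \<le> b" for a b c :: real
      using that by simp
    have "norm z \<le> norm (z + v) + norm v" using norm_triangle_ineq4[of "z + v" v] by simp
    then show ?thesis using assms(2) by (rule *) simp
  qed
  then have "(1 + norm z) powr s \<le> (2 * (1 + norm (z + v))) powr s"
    using assms by (intro powr_mono2) auto
  also have "\<dots> = 2 powr s * (1 + norm (z + v)) powr s" by (rule powr_mult)
  finally have "(1 + norm z) powr s \<le> 2 powr s * (1 + norm (z + v)) powr s" .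
  moreover have "0 < (1 + norm z) powr s" "0 < (1 + norm (z + v)) powr s"
  proof -
    have "0 < 1 + norm y" for y :: 'a by (simp add: add_pos_nonneg)
    then show "0 < (1 + norm z) powr s" "0 < (1 + norm (z + v)) powr s"
      by (metis powr_gt_zero less_irrefl)+
  qed
  moreover have "inverse B \<le> c * inverse A" if "A \<le> c * B" "0 < A" "0 < B" for A B c :: real
    using that by (simp add: field_simps)
  ultimately show ?thesis by (simp only: decay_def powr_minus)
qed

text \<open>
  Taylor's formula on the line through \<open>z\<close> in direction \<open>w\<close>, for the real and the imaginary part
  separately. The remainder involves the \<open>n\<close>-th derivative at a point at distance at most \<open>1\<close> from \<open>z\<close>,
  where the decay weight is comparable to its value at \<open>z\<close>.
\<close>
lemma inv_fourier_Taylor: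
  fixes g :: "'a::euclidean_space \<Rightarrow> real"
  assumes g: "test_function R g"
  shows "\<exists>C\<ge>0. \<forall>z w. norm w \<le> 1 \<longrightarrow> (\<exists>a::nat \<Rightarrow> complex. \<forall>s. \<bar>s\<bar> \<le> 1 \<longrightarrow>
    norm (inv_fourier (\<lambda>\<xi>. of_real (g \<xi>)) (z + s *\<^sub>R w) - (\<Sum>l<n. a l * of_real s ^ l))
      \<le> C * \<bar>s\<bar> ^ n * decay (real N) z)"
proof -
  obtain C where C: "0 \<le> C" "\<And>w x. norm w \<le> 1 \<Longrightarrow>
    norm (inv_fourier (\<lambda>\<xi>. of_real ((w \<bullet> \<xi>) ^ n * g \<xi>)) x) \<le> C * decay (real N) x"
    using inv_fourier_linear_power_decay[OF g, of n N] by blast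
  define K where "K = 2 * (C * 2 powr real N)"
  have "\<exists>a::nat \<Rightarrow> complex. \<forall>s. \<bar>s\<bar> \<le> 1 \<longrightarrow>
    norm (inv_fourier (\<lambda>\<xi>. of_real (g \<xi>)) (z + s *\<^sub>R w) - (\<Sum>l<n. a l * of_real s ^ l))
      \<le> K * \<bar>s\<bar> ^ n * decay (real N) z" if w: "norm w \<le> 1" for z w
  proof -
    define H where "H l t = \<i> ^ l * inv_fourier (\<lambda>\<xi>. of_real ((w \<bullet> \<xi>) ^ l * g \<xi>)) (z + t *\<^sub>R w)" for l t
    have lim: "((\<lambda>h. (H l (t + h) - H l t) / of_real h) \<longlongrightarrow> H (Suc l) t) (at 0)" for l t
    proof -
      have "((\<lambda>h. \<i> ^ l * ((inv_fourier (\<lambda>\<xi>. of_real ((w \<bullet> \<xi>) ^ l * g \<xi>)) (z + (t + h) *\<^sub>R w)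
          - inv_fourier (\<lambda>\<xi>. of_real ((w \<bullet> \<xi>) ^ l * g \<xi>)) (z + t *\<^sub>R w)) / of_real h))
        \<longlongrightarrow> \<i> ^ l * (\<i> * inv_fourier (\<lambda>\<xi>. of_real ((w \<bullet> \<xi>) * ((w \<bullet> \<xi>) ^ l * g \<xi>))) (z + t *\<^sub>R w))) (at 0)"
        by (intro tendsto_mult tendsto_const inv_fourier_line_derivative[OF test_function_linear_power_mult[OF g]])
      then show ?thesis by (simp add: H_def mult_ac right_diff_distrib diff_divide_distrib)
    qed
    have dRe: "\<forall>l t. DERIV (\<lambda>t. Re (H l t)) t :> Re (H (Suc l) t)"
      using tendsto_Re[OF lim] by (simp add: DERIV_def Re_divide_of_real)
    have dIm: "\<forall>l t. DERIV (\<lambda>t. Im (H l t)) t :> Im (H (Suc l) t)"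
      using tendsto_Im[OF lim] by (simp add: DERIV_def Im_divide_of_real)
    have Hn: "norm (H n t) \<le> C * 2 powr real N * decay (real N) z" if t: "\<bar>t\<bar> \<le> 1" for t
    proof -
      have "norm (t *\<^sub>R w) \<le> 1" using t w by (simp add: mult_le_one)
      then have "decay (real N) (z + t *\<^sub>R w) \<le> 2 powr real N * decay (real N) z"
        by (intro decay_shift_le) auto
      then have "C * decay (real N) (z + t *\<^sub>R w) \<le> C * (2 powr real N * decay (real N) z)"
        using C(1) by (rule mult_left_mono)
      moreover have "norm (H n t) \<le> C * decay (real N) (z + t *\<^sub>R w)"
        using C(2)[OF w] by (simp only: H_def norm_mult norm_power norm_ii power_one mult_1)
      ultimately show ?thesis by (simp add: mult.assoc)
    qed
    define a where "a l = H l 0 / fact l" for l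
    have "norm (H 0 s - (\<Sum>l<n. a l * of_real s ^ l)) \<le> K * \<bar>s\<bar> ^ n * decay (real N) z" if s: "\<bar>s\<bar> \<le> 1" for s
    proof -
      define E where "E = H 0 s - (\<Sum>l<n. a l * of_real s ^ l)"
      have rem: "\<bar>u / fact n * s ^ n\<bar> \<le> C * 2 powr real N * decay (real N) z * \<bar>s\<bar> ^ n"
        if u: "\<bar>u\<bar> \<le> norm (H n t)" and t: "\<bar>t\<bar> \<le> \<bar>s\<bar>" for u t
      proof -
        have "\<bar>u\<bar> / fact n \<le> \<bar>u\<bar> / 1" by (intro divide_left_mono) auto
        also have "\<dots> \<le> C * 2 powr real N * decay (real N) z" using u Hn[of t] s t by simp
        finally have "\<bar>u\<bar> / fact n * \<bar>s\<bar> ^ n \<le> C * 2 powr real N * decay (real N) z * \<bar>s\<bar> ^ n"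
          by (rule mult_right_mono) simp
        then show ?thesis by (simp add: abs_mult power_abs)
      qed
      have al: "a l * of_real s ^ l = of_real (s ^ l / fact l) * H l 0" for l by (simp add: a_def)
      have Re_m: "Re (of_real c * u) = c * Re u" and Im_m: "Im (of_real c * u) = c * Im u" for c u by simp_all
      obtain t where t: "\<bar>t\<bar> \<le> \<bar>s\<bar>" "Re (H 0 s) = (\<Sum>l<n. Re (H l 0) / fact l * s ^ l) + Re (H n t) / fact n * s ^ n"
        using Maclaurin_all_le[of "\<lambda>l t. Re (H l t)" "\<lambda>t. Re (H 0 t)" s n] dRe by auto
      have "Re E = Re (H n t) / fact n * s ^ n"
        unfolding E_def al minus_complex.sel Re_sum Re_m t(2) by (simp add: mult.commute)
      then have 1: "\<bar>Re E\<bar> \<le> C * 2 powr real N * decay (real N) z * \<bar>s\<bar> ^ n"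
        using rem[OF abs_Re_le_cmod t(1)] by simp
      obtain t' where t': "\<bar>t'\<bar> \<le> \<bar>s\<bar>" "Im (H 0 s) = (\<Sum>l<n. Im (H l 0) / fact l * s ^ l) + Im (H n t') / fact n * s ^ n"
        using Maclaurin_all_le[of "\<lambda>l t. Im (H l t)" "\<lambda>t. Im (H 0 t)" s n] dIm by auto
      have "Im E = Im (H n t') / fact n * s ^ n"
        unfolding E_def al minus_complex.sel Im_sum Im_m t'(2) by (simp add: mult.commute)
      then have 2: "\<bar>Im E\<bar> \<le> C * 2 powr real N * decay (real N) z * \<bar>s\<bar> ^ n"
        using rem[OF abs_Im_le_cmod t'(1)] by simp
      show ?thesis using 1 2 cmod_le[of E] by (simp add: K_def E_def[symmetric] mult_ac)
    qed
    moreover have "H 0 s = inv_fourier (\<lambda>\<xi>. of_real (g \<xi>)) (z + s *\<^sub>R w)" for s by (simp add: H_def)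
    ultimately show ?thesis by auto
  qed
  moreover have "0 \<le> K" using C(1) by (simp add: K_def)
  ultimately show ?thesis by blast
qed

section \<open>The kernel of the iterated difference\<close>

text \<open>
  With \<open>H F r = F (r / 2)\<close>, the operator \<open>Delta k\<close> is the product of the factors \<open>1 - 2 ^ j * H\<close> for
  \<open>j \<le> k\<close>; these are the coefficients of its expansion in powers of \<open>H\<close>.
\<close>
primrec delta_coeff :: "nat \<Rightarrow> nat \<Rightarrow> real" where
  "delta_coeff 0 i = (if i = 0 then 1 else if i = 1 then - 1 else 0)"
| "delta_coeff (Suc k) i = delta_coeff k i - 2 ^ (k + 1) * (case i of 0 \<Rightarrow> 0 | Suc j \<Rightarrow> delta_coeff k j)"

lemma delta_coeff_eq_0: "Suc k < i \<Longrightarrow> delta_coeff k i = 0"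
  by (induction k arbitrary: i) (auto split: nat.split)

lemma Delta_eq_sum: "Delta k F r = (\<Sum>i\<le>Suc k. delta_coeff k i * F (r / 2 ^ i))"
proof (induction k arbitrary: r)
  case (Suc k)
  have "(\<Sum>i\<le>Suc (Suc k). delta_coeff (Suc k) i * F (r / 2 ^ i)) =
      (\<Sum>i\<le>Suc (Suc k). delta_coeff k i * F (r / 2 ^ i))
      - 2 ^ (k + 1) * (\<Sum>i\<le>Suc (Suc k). (case i of 0 \<Rightarrow> 0 | Suc j \<Rightarrow> delta_coeff k j) * F (r / 2 ^ i))"
    by (simp only: delta_coeff.simps left_diff_distrib sum_subtractf sum_distrib_left mult.assoc)
  also have "(\<Sum>i\<le>Suc (Suc k). delta_coeff k i * F (r / 2 ^ i)) = Delta k F r"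
    by (subst sum.atMost_Suc) (simp add: Suc delta_coeff_eq_0 del: sum.atMost_Suc)
  also have "(\<Sum>i\<le>Suc (Suc k). (case i of 0 \<Rightarrow> 0 | Suc j \<Rightarrow> delta_coeff k j) * F (r / 2 ^ i)) = Delta k F (r / 2)"
    by (subst sum.atMost_Suc_shift) (simp add: Suc del: sum.atMost_Suc)
  finally show ?case by simp
qed simp

lemma Delta_power: "Delta k (\<lambda>r. r ^ l) r = (\<Prod>j\<le>k. 1 - 2 ^ j / 2 ^ l) * r ^ l"
  by (induction k arbitrary: r) (simp_all add: power_divide field_simps)

text \<open>
  Monomials are eigenfunctions of the halving operator, so \<open>Delta k\<close> multiplies \<open>r ^ l\<close> by the product
  of the factors \<open>1 - 2 ^ j / 2 ^ l\<close>, and the factor with \<open>j = l\<close> vanishes.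
\<close>
lemma delta_coeff_moment:
  assumes "l \<le> k"
  shows "(\<Sum>i\<le>Suc k. delta_coeff k i * (r / 2 ^ i) ^ l) = 0"
proof -
  have "(\<Prod>j\<le>k. 1 - 2 ^ j / 2 ^ l :: real) = 0"
    using assms by (intro prod_zero) auto
  then show ?thesis using Delta_power[of k l r] unfolding Delta_eq_sum by simp
qed

lemma nn_integral_suminf_indicator:
  assumes [measurable]: "\<And>n::nat. B n \<in> sets M"
  shows "(\<integral>\<^sup>+ x. (\<Sum>n. c n * indicator (B n) x) \<partial>M) = (\<Sum>n. c n * emeasure M (B n))"
  by (subst nn_integral_suminf) (simp_all add: nn_integral_cmult_indicator)

text \<open>
  On the dyadic shell with \<open>2 ^ n \<le> 1 + norm x < 2 ^ (n + 1)\<close> the weight is at most \<open>2 powr (- s * n)\<close>, and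
  the ball containing this shell has volume of order \<open>2 ^ (n * DIM('a))\<close>.
\<close>
lemma nn_integral_decay_finite:
  assumes s: "real DIM('a::euclidean_space) < s"
  shows "(\<integral>\<^sup>+ x. ennreal (decay s (x::'a)) \<partial>lborel) < \<infinity>"
proof -
  define V where "V = unit_ball_vol (real DIM('a))"
  have V: "0 \<le> V" unfolding V_def by simp
  define t :: real where "t = 2 powr (real DIM('a) - s)"
  have t: "0 < t" "t < 1"
    using s by (auto simp: t_def powr_less_one)
  have "ennreal (decay s x) \<le> (\<Sum>n. ennreal (2 powr (- s * real n)) * indicator (cball 0 (2 * 2 ^ n)) x)" for x :: 'a
  proof -
    define n where "n = nat \<lfloor>log 2 (1 + norm x)\<rfloor>"
    have x1: "0 < 1 + norm x" by (simp add: add_pos_nonneg)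
    have l0: "0 \<le> log 2 (1 + norm x)" using x1 by (subst zero_le_log_cancel_iff) auto
    have n: "real n \<le> log 2 (1 + norm x)" "log 2 (1 + norm x) < real n + 1"
      using l0 by (simp_all add: n_def of_nat_nat)
    have "2 powr real n \<le> 1 + norm x" using n(1) x1 by (simp add: le_log_iff)
    then have a: "decay s x \<le> (2 powr real n) powr (- s)"
      unfolding decay_def using s by (intro powr_mono2') auto
    have "1 + norm x < 2 powr (real n + 1)" using n(2) x1 by (simp add: log_less_iff)
    then have "x \<in> cball 0 (2 * 2 ^ n)" by (simp add: powr_add powr_realpow)
    then have "ennreal (decay s x) \<le> ennreal (2 powr (- s * real n)) * indicator (cball 0 (2 * 2 ^ n)) x"
      using a by (auto simp: powr_powr mult.commute intro: ennreal_leI)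
    also have "\<dots> = (\<Sum>i\<in>{n}. ennreal (2 powr (- s * real i)) * indicator (cball 0 (2 * 2 ^ i)) x)"
      by (simp only: sum.insert finite.emptyI empty_iff not_False_eq_True sum.empty add_0_right)
    also have "\<dots> \<le> (\<Sum>i. ennreal (2 powr (- s * real i)) * indicator (cball 0 (2 * 2 ^ i)) x)"
      by (rule sum_le_suminf) auto
    finally show ?thesis .
  qed
  then have "(\<integral>\<^sup>+ x. ennreal (decay s (x::'a)) \<partial>lborel)
      \<le> (\<integral>\<^sup>+ x. (\<Sum>n. ennreal (2 powr (- s * real n)) * indicator (cball (0::'a) (2 * 2 ^ n)) x) \<partial>lborel)"
    by (intro nn_integral_mono) simp
  also have "\<dots> = (\<Sum>n. ennreal (2 powr (- s * real n)) * emeasure lborel (cball (0::'a) (2 * 2 ^ n)))"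
    by (rule nn_integral_suminf_indicator) simp
  also have "\<dots> = (\<Sum>n. ennreal (V * 2 ^ DIM('a) * t ^ n))"
  proof (intro arg_cong[where f=suminf] ext)
    fix n
    have eq: "2 powr (- s * real n) * (V * (2 * 2 ^ n) ^ DIM('a)) = V * 2 ^ DIM('a) * t ^ n"
    proof -
      have "t ^ n = 2 powr ((real DIM('a) - s) * real n)"
        using powr_realpow[OF t(1), of n] unfolding t_def powr_powr by simp
      also have "\<dots> = 2 powr (- s * real n) * 2 powr real (n * DIM('a))"
        unfolding powr_add[symmetric] by (simp add: algebra_simps)
      also have "2 powr real (n * DIM('a)) = ((2::real) ^ n) ^ DIM('a)"
        by (subst powr_realpow) (simp_all add: power_mult)
      finally show ?thesis by (simp add: power_mult_distrib)
    qed
    have "emeasure lborel (cball (0::'a) (2 * 2 ^ n)) = ennreal (V * (2 * 2 ^ n) ^ DIM('a))"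
      unfolding V_def by (rule emeasure_cball) simp
    then show "ennreal (2 powr (- s * real n)) * emeasure lborel (cball (0::'a) (2 * 2 ^ n)) = ennreal (V * 2 ^ DIM('a) * t ^ n)"
      unfolding eq[symmetric] using V by (simp only: ennreal_mult powr_ge_zero mult_nonneg_nonneg zero_le_power zero_le_numeral)
  qed
  also have "\<dots> < \<infinity>"
    using t V by (subst suminf_ennreal2) (auto intro!: summable_mult summable_geometric)
  finally show ?thesis .
qed

text \<open>
  A profile that is bounded by \<open>1\<close> and integrable with respect to \<open>dr / r\<close>, whence all its dilates have
  uniformly bounded norms for every exponent.
\<close>
definition bump :: "real \<Rightarrow> real \<Rightarrow> real" where
  "bump \<gamma> r = min (r powr \<gamma>) (r powr (- \<gamma>))"

lemma bump_nonneg [simp]: "0 \<le> bump \<gamma> r" by (simp add: bump_def)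

lemma measurable_bump [measurable]: "bump \<gamma> \<in> borel_measurable borel"
  unfolding bump_def by measurable

lemma bump_le_one: "0 < \<gamma> \<Longrightarrow> 0 < r \<Longrightarrow> bump \<gamma> r \<le> 1"
  by (cases "r \<le> 1") (auto simp: bump_def powr_le1 min_le_iff_disj powr_minus divide_simps ge_one_powr_ge_zero)

lemma bump_low: "r \<le> 1 \<Longrightarrow> 0 < r \<Longrightarrow> 0 < \<gamma> \<Longrightarrow> bump \<gamma> r = r powr \<gamma>"
  by (simp add: bump_def min_absorb1 powr_mono')

lemma bump_high: "1 \<le> r \<Longrightarrow> 0 < \<gamma> \<Longrightarrow> bump \<gamma> r = r powr (- \<gamma>)"
  by (simp add: bump_def min_absorb2 powr_mono)

lemma sets_dr_over_r [measurable_cong, simp]: "sets dr_over_r = sets borel"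
  by (simp add: dr_over_r_def)

lemma space_dr_over_r [simp]: "space dr_over_r = UNIV"
  by (simp add: dr_over_r_def)

lemma nn_integral_dr_over_r:
  assumes [measurable]: "h \<in> borel_measurable borel"
  shows "(\<integral>\<^sup>+ r. h r \<partial>dr_over_r) = (\<integral>\<^sup>+ r. indicator {0<..} r * ennreal (1 / r) * h r \<partial>lborel)"
  unfolding dr_over_r_def by (subst nn_integral_density) auto

lemma nn_integral_dr_over_r_scale:
  assumes [measurable]: "h \<in> borel_measurable borel" and c: "0 < c"
  shows "(\<integral>\<^sup>+ r. h (c * r) \<partial>dr_over_r) = (\<integral>\<^sup>+ r. h r \<partial>dr_over_r)"
proof -
  have "(\<integral>\<^sup>+ r. h r \<partial>dr_over_r)
      = ennreal c * (\<integral>\<^sup>+ r. indicator {0<..} (c * r) * ennreal (1 / (c * r)) * h (c * r) \<partial>lborel)"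
    unfolding nn_integral_dr_over_r[OF assms(1)]
    using c by (subst nn_integral_real_affine[where c=c and t=0]) auto
  also have "\<dots> = (\<integral>\<^sup>+ r. ennreal c * (indicator {0<..} (c * r) * ennreal (1 / (c * r)) * h (c * r)) \<partial>lborel)"
    by (rule nn_integral_cmult[symmetric]) measurable
  also have "\<dots> = (\<integral>\<^sup>+ r. indicator {0<..} r * ennreal (1 / r) * h (c * r) \<partial>lborel)"
  proof (intro nn_integral_cong)
    fix r :: real
    have "ennreal c * ennreal (1 / (c * r)) = ennreal (1 / r)" if "0 < r"
      using c that by (subst ennreal_mult[symmetric]) auto
    then show "ennreal c * (indicator {0<..} (c * r) * ennreal (1 / (c * r)) * h (c * r))
        = indicator {0<..} r * ennreal (1 / r) * h (c * r)"
      using c by (cases "0 < r") (auto simp: zero_less_mult_iff mult.assoc[symmetric])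
  qed
  also have "\<dots> = (\<integral>\<^sup>+ r. h (c * r) \<partial>dr_over_r)"
    by (rule nn_integral_dr_over_r[symmetric]) measurable
  finally show ?thesis ..
qed

lemma AE_dr_over_r_pos: "AE r in dr_over_r. 0 < r"
  unfolding dr_over_r_def by (subst AE_density) (auto simp: indicator_def)

lemma nn_integral_bump_le:
  assumes \<gamma>: "0 < \<gamma>"
  shows "(\<integral>\<^sup>+ r. ennreal (bump \<gamma> r) \<partial>dr_over_r) \<le> ennreal (2 / \<gamma>)"
proof -
  have "(\<integral>\<^sup>+ r. ennreal (bump \<gamma> r) \<partial>dr_over_r)
     \<le> (\<integral>\<^sup>+ r. ennreal (r powr (\<gamma> - 1)) * indicator {0..1} r + ennreal (r powr (- \<gamma> - 1)) * indicator {1..} r \<partial>lborel)"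
    unfolding nn_integral_dr_over_r[OF measurable_compose[OF measurable_bump measurable_ennreal]]
  proof (rule nn_integral_mono)
    fix r :: real
    show "indicator {0<..} r * ennreal (1 / r) * ennreal (bump \<gamma> r)
      \<le> ennreal (r powr (\<gamma> - 1)) * indicator {0..1} r + ennreal (r powr (- \<gamma> - 1)) * indicator {1..} r"
    proof (cases "0 < r")
      case r: True
      show ?thesis
      proof (cases "r \<le> 1")
        case True
        then have "ennreal (1 / r) * ennreal (bump \<gamma> r) = ennreal (r powr (\<gamma> - 1))"
          using r \<gamma> by (subst ennreal_mult[symmetric]) (auto simp: bump_low powr_diff)
        then show ?thesis using r True by (simp add: add_increasing2)
      next
        case False
        then have "ennreal (1 / r) * ennreal (bump \<gamma> r) = ennreal (r powr (- \<gamma> - 1))"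
          using r \<gamma> by (subst ennreal_mult[symmetric]) (auto simp: bump_high powr_diff)
        then show ?thesis using r False by simp
      qed
    qed simp
  qed
  also have "\<dots> = (\<integral>\<^sup>+ r. ennreal (r powr (\<gamma> - 1)) * indicator {0..1} r \<partial>lborel)
      + (\<integral>\<^sup>+ r. ennreal (r powr (- \<gamma> - 1)) * indicator {1..} r \<partial>lborel)"
    by (rule nn_integral_add) auto
  also have "(\<integral>\<^sup>+ r. ennreal (r powr (\<gamma> - 1)) * indicator {0..1} r \<partial>lborel) = ennreal (1 / \<gamma>)"
    using has_integral_powr_from_0[of "\<gamma> - 1" 1] \<gamma> by (intro nn_integral_has_integral_lebesgue') auto
  also have "(\<integral>\<^sup>+ r. ennreal (r powr (- \<gamma> - 1)) * indicator {1..} r \<partial>lborel) = ennreal (1 / \<gamma>)"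
    using has_integral_powr_to_inf[of "- \<gamma> - 1" 1] \<gamma> by (intro nn_integral_has_integral_lebesgue') auto
  also have "ennreal (1 / \<gamma>) + ennreal (1 / \<gamma>) = ennreal (2 / \<gamma>)"
    using \<gamma> by (subst ennreal_plus[symmetric]) auto
  finally show ?thesis .
qed

definition ball_integral :: "('a::euclidean_space \<Rightarrow> complex) \<Rightarrow> real \<Rightarrow> 'a \<Rightarrow> complex" where
  "ball_integral u r z = (\<integral>x. indicator (cball z r) x *\<^sub>R u x \<partial>lborel)"

text \<open>
  The difference operator applied to the radius of \<open>ball_integral\<close>, expanded in coefficients
  because \<open>Delta\<close> acts on real functions of the radius, while Littlewood-Paley blocks are complex-valued.
\<close>
definition ball_delta :: "nat \<Rightarrow> ('a::euclidean_space \<Rightarrow> complex) \<Rightarrow> real \<Rightarrow> 'a \<Rightarrow> complex" where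
  "ball_delta k u r z = (\<Sum>i\<le>Suc k. of_real (delta_coeff k i) * ball_integral u (r / 2 ^ i) z)"

lemma measurable_inv_fourier [measurable]:
  assumes [measurable]: "g \<in> borel_measurable borel"
  shows "inv_fourier g \<in> borel_measurable borel"
  unfolding inv_fourier_def[abs_def] by measurable

lemma ball_integral_rescale:
  fixes u :: "'a::euclidean_space \<Rightarrow> complex"
  assumes [measurable]: "u \<in> borel_measurable borel" and s: "0 < s"
  shows "ball_integral u s z = of_real (s ^ DIM('a)) * (\<integral>w. indicator (cball 0 1) w *\<^sub>R u (z + s *\<^sub>R w) \<partial>lborel)"
proof -
  have "(\<lambda>x. indicator (cball z s) x *\<^sub>R u x) \<in> borel_measurable borel"
    by (intro borel_measurable_scaleR borel_measurable_indicator assms) simp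
  then have "ball_integral u s z = (\<bar>s\<bar> ^ DIM('a)) *\<^sub>R (\<integral>w. indicator (cball z s) (z + s *\<^sub>R w) *\<^sub>R u (z + s *\<^sub>R w) \<partial>lborel)"
    unfolding ball_integral_def using s by (subst integral_lborel_affine[where c=s and t=z]) auto
  also have "(\<lambda>w. indicator (cball z s) (z + s *\<^sub>R w) :: real) = indicator (cball 0 1)"
    using s by (auto simp: indicator_def dist_norm fun_eq_iff)
  finally show ?thesis using s by (simp add: scaleR_conv_of_real)
qed

text \<open>
  In polar form a ball integral is \<open>r ^ d\<close> times an average over the unit ball, so the Taylor
  polynomial of degree \<open>m\<close> contributes only the powers \<open>r ^ d, \<dots>, r ^ (d + m)\<close>. All of them are
  annihilated and the remainder survives.
\<close>
lemma delta_Taylor_cancel: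
  fixes a :: "nat \<Rightarrow> complex" and U :: "real \<Rightarrow> complex"
  assumes r: "0 \<le> r" "r \<le> 1" and k: "d + m \<le> k" and K: "0 \<le> K"
    and U: "\<And>s. \<bar>s\<bar> \<le> 1 \<Longrightarrow> norm (U s - (\<Sum>l<Suc m. a l * of_real s ^ l)) \<le> K * \<bar>s\<bar> ^ Suc m"
  shows "norm (\<Sum>i\<le>Suc k. of_real (delta_coeff k i * (r / 2 ^ i) ^ d) * U (r / 2 ^ i))
    \<le> (\<Sum>i\<le>Suc k. \<bar>delta_coeff k i\<bar>) * (K * r ^ (d + Suc m))"
proof -
  define s where "s i = r / 2 ^ i" for i :: nat
  have s: "0 \<le> s i" "s i \<le> r" for i
    using r by (auto simp: s_def field_simps mult_le_cancel_left1)
  define E where "E i = U (s i) - (\<Sum>l<Suc m. a l * of_real (s i) ^ l)" for i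
  have poly: "(\<Sum>i\<le>Suc k. of_real (delta_coeff k i * s i ^ d) * (\<Sum>l<Suc m. a l * of_real (s i) ^ l)) = 0"
  proof -
    have "(\<Sum>i\<le>Suc k. of_real (delta_coeff k i * s i ^ d) * (\<Sum>l<Suc m. a l * of_real (s i) ^ l))
        = (\<Sum>i\<le>Suc k. \<Sum>l<Suc m. a l * of_real (delta_coeff k i * s i ^ (d + l)))"
      unfolding sum_distrib_left by (intro sum.cong refl) (simp add: power_add mult_ac)
    also have "\<dots> = (\<Sum>l<Suc m. \<Sum>i\<le>Suc k. a l * of_real (delta_coeff k i * s i ^ (d + l)))"
      by (rule sum.swap)
    also have "\<dots> = (\<Sum>l<Suc m. a l * of_real (\<Sum>i\<le>Suc k. delta_coeff k i * s i ^ (d + l)))"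
      by (simp only: sum_distrib_left of_real_sum)
    also have "\<dots> = 0"
      using k by (intro sum.neutral) (auto simp only: s_def delta_coeff_moment of_real_0 mult_zero_right lessThan_iff less_Suc_eq_le)
    finally show ?thesis .
  qed
  have "(\<Sum>i\<le>Suc k. of_real (delta_coeff k i * s i ^ d) * U (s i))
      = (\<Sum>i\<le>Suc k. of_real (delta_coeff k i * s i ^ d) * E i)
      + (\<Sum>i\<le>Suc k. of_real (delta_coeff k i * s i ^ d) * (\<Sum>l<Suc m. a l * of_real (s i) ^ l))"
    unfolding sum.distrib[symmetric] by (simp only: E_def distrib_left[symmetric] diff_add_cancel)
  then have eq: "(\<Sum>i\<le>Suc k. of_real (delta_coeff k i * s i ^ d) * U (s i))
      = (\<Sum>i\<le>Suc k. of_real (delta_coeff k i * s i ^ d) * E i)"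
    using poly by simp
  have "norm (\<Sum>i\<le>Suc k. of_real (delta_coeff k i * s i ^ d) * E i)
    \<le> (\<Sum>i\<le>Suc k. \<bar>delta_coeff k i\<bar> * (K * r ^ (d + Suc m)))"
  proof (rule sum_norm_le)
    fix i
    have "norm (E i) \<le> K * s i ^ Suc m" using U[of "s i"] s[of i] r by (simp add: E_def)
    then have "s i ^ d * norm (E i) \<le> s i ^ d * (K * s i ^ Suc m)" using s by (intro mult_left_mono) auto
    also have "\<dots> = K * s i ^ (d + Suc m)" by (simp add: power_add mult_ac)
    also have "\<dots> \<le> K * r ^ (d + Suc m)" using s K by (intro mult_left_mono power_mono) auto
    finally have "\<bar>delta_coeff k i\<bar> * (s i ^ d * norm (E i)) \<le> \<bar>delta_coeff k i\<bar> * (K * r ^ (d + Suc m))"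
      by (intro mult_left_mono) auto
    then show "norm (of_real (delta_coeff k i * s i ^ d) * E i) \<le> \<bar>delta_coeff k i\<bar> * (K * r ^ (d + Suc m))"
      using s by (simp add: norm_mult norm_power abs_mult mult_ac)
  qed
  then show ?thesis unfolding eq[unfolded s_def] by (simp only: sum_distrib_right s_def)
qed

text \<open>
  The main estimate. For \<open>r \<le> 1\<close> cancellation of the Taylor polynomial yields a factor
  \<open>r ^ (DIM('a) + m + 1)\<close> together with the decay of the derivatives. For \<open>r \<ge> 1\<close> the ball integrals
  are bounded by the integral of the decay weight over the ball of radius \<open>r\<close>, and on this ball
  \<open>r powr (- \<alpha> - d)\<close> is at most a constant times \<open>r powr (- \<alpha> / 2) * decay (d + \<alpha> / 2) w\<close>: one half of
  the exponent \<open>\<alpha>\<close> pays for decay in \<open>r\<close>, the other half for integrability in \<open>w\<close>. The variables are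
  separated in the bound, which is what allows the norm in \<open>r\<close> to be taken before the norm in \<open>z\<close>.
\<close>
theorem ball_delta_kernel_bound:
  fixes g :: "'a::euclidean_space \<Rightarrow> real"
  assumes g: "test_function R g" and \<alpha>: "0 < \<alpha>" "\<alpha> < real m + 1" and k: "DIM('a) + m \<le> k"
  defines "\<gamma> \<equiv> min (real m + 1 - \<alpha>) (\<alpha> / 2)"
  obtains G :: "'a \<Rightarrow> ennreal" where "G \<in> borel_measurable borel" "(\<integral>\<^sup>+ z. G z \<partial>lborel) < \<infinity>"
    "\<And>r z. 0 < r \<Longrightarrow> ennreal (r powr (- \<alpha> - real DIM('a)) * norm (ball_delta k (inv_fourier (\<lambda>\<xi>. of_real (g \<xi>))) r z))
       \<le> ennreal (bump \<gamma> r) * G z"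
proof -
  define \<psi> where "\<psi> = inv_fourier (\<lambda>\<xi>. complex_of_real (g \<xi>))"
  define d where "d = DIM('a)"
  \<comment> \<open>\<open>N\<close> and \<open>\<sigma>\<close> both exceed the dimension, so both decay weights are integrable.\<close>
  define N where "N = Suc d"
  define \<sigma> where "\<sigma> = real d + \<alpha> / 2"
  have \<gamma>: "0 < \<gamma>" "\<gamma> \<le> real m + 1 - \<alpha>" "\<gamma> \<le> \<alpha> / 2" using \<alpha> by (auto simp: \<gamma>_def min_def)
  have [measurable]: "g \<in> borel_measurable borel"
    using test_function_continuous[OF g] by (rule borel_measurable_continuous_onI)
  have [measurable]: "\<psi> \<in> borel_measurable borel" unfolding \<psi>_def by measurable
  obtain C0 where C0: "0 \<le> C0" "\<And>x. norm (\<psi> x) \<le> C0 * decay (real N) x"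
    using inv_fourier_decay[OF g, of N] by (auto simp: \<psi>_def)
  obtain C1 where C1: "0 \<le> C1" "\<And>z w. norm w \<le> 1 \<Longrightarrow> (\<exists>a::nat \<Rightarrow> complex. \<forall>s. \<bar>s\<bar> \<le> 1 \<longrightarrow>
    norm (\<psi> (z + s *\<^sub>R w) - (\<Sum>l<Suc m. a l * of_real s ^ l)) \<le> C1 * \<bar>s\<bar> ^ Suc m * decay (real N) z)"
    using inv_fourier_Taylor[OF g, of "Suc m" N] unfolding \<psi>_def by blast
  have bdd: "norm (\<psi> x) \<le> C0" for x
  proof -
    have "decay (real N) x \<le> 1" by (simp add: decay_def powr_minus divide_simps ge_one_powr_ge_zero)
    then show ?thesis using C0(2)[of x] mult_left_mono[of "decay (real N) x" 1 C0] C0(1) by simp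
  qed
  define S where "S = (\<Sum>i\<le>Suc k. \<bar>delta_coeff k i\<bar>)"
  have S: "0 \<le> S" by (auto simp: S_def intro: sum_nonneg)
  define V where "V = measure lborel (cball (0::'a) 1)"
  have V: "0 \<le> V" by (simp add: V_def)
  define A where "A = S * C1 * V"
  define B where "B = S * 2 powr \<sigma> * C0"
  have AB: "0 \<le> A" "0 \<le> B" using S C0 C1 V by (auto simp: A_def B_def)
  define G where "G z = ennreal (A * decay (real N) z)
     + ennreal B * (\<integral>\<^sup>+ w. ennreal (decay \<sigma> w) * ennreal (decay (real N) (z + w)) \<partial>lborel)" for z :: 'a
  have G_meas: "G \<in> borel_measurable borel" unfolding G_def[abs_def] by measurable
  have G_int: "(\<integral>\<^sup>+ z. G z \<partial>lborel) < \<infinity>"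
  proof -
    have 1: "(\<integral>\<^sup>+ z. ennreal (decay (real N) (z::'a)) \<partial>lborel) < \<infinity>"
      by (rule nn_integral_decay_finite) (simp add: N_def d_def)
    have 2: "(\<integral>\<^sup>+ z. ennreal (decay \<sigma> (z::'a)) \<partial>lborel) < \<infinity>"
      by (rule nn_integral_decay_finite) (use \<alpha> in \<open>simp add: \<sigma>_def d_def\<close>)
    have "(\<integral>\<^sup>+ z. (\<integral>\<^sup>+ w. ennreal (decay \<sigma> w) * ennreal (decay (real N) (z + w)) \<partial>lborel) \<partial>(lborel::'a measure))
        = (\<integral>\<^sup>+ w. (\<integral>\<^sup>+ z. ennreal (decay \<sigma> w) * ennreal (decay (real N) (z + w)) \<partial>lborel) \<partial>(lborel::'a measure))"
      by (rule lborel_pair.Fubini'[symmetric]) measurable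
    also have "\<dots> = (\<integral>\<^sup>+ w. ennreal (decay \<sigma> w) * (\<integral>\<^sup>+ z. ennreal (decay (real N) (z + w)) \<partial>lborel) \<partial>(lborel::'a measure))"
      by (intro nn_integral_cong nn_integral_cmult) measurable
    also have "\<dots> = (\<integral>\<^sup>+ w. ennreal (decay \<sigma> w) * (\<integral>\<^sup>+ z. ennreal (decay (real N) (z::'a)) \<partial>lborel) \<partial>(lborel::'a measure))"
    proof -
      have "(\<integral>\<^sup>+ z. ennreal (decay (real N) (z + w)) \<partial>lborel) = (\<integral>\<^sup>+ z. ennreal (decay (real N) (z::'a)) \<partial>lborel)" for w :: 'a
        using nn_integral_lborel_affine[of "\<lambda>z. ennreal (decay (real N) z)" 1 w, symmetric] by (simp add: add.commute)
      then show ?thesis by (simp only:)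
    qed
    also have "\<dots> = (\<integral>\<^sup>+ w. ennreal (decay \<sigma> (w::'a)) \<partial>lborel) * (\<integral>\<^sup>+ z. ennreal (decay (real N) (z::'a)) \<partial>lborel)"
      by (rule nn_integral_multc) measurable
    also have "\<dots> < \<infinity>" using 1 2 by (simp add: ennreal_mult_less_top)
    finally have 3: "(\<integral>\<^sup>+ z. (\<integral>\<^sup>+ w. ennreal (decay \<sigma> w) * ennreal (decay (real N) (z + w)) \<partial>lborel) \<partial>(lborel::'a measure)) < \<infinity>" .
    have "(\<integral>\<^sup>+ z. G z \<partial>lborel) = ennreal A * (\<integral>\<^sup>+ z. ennreal (decay (real N) (z::'a)) \<partial>lborel)
        + ennreal B * (\<integral>\<^sup>+ z. (\<integral>\<^sup>+ w. ennreal (decay \<sigma> w) * ennreal (decay (real N) (z + w)) \<partial>lborel) \<partial>(lborel::'a measure))"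
      unfolding G_def using AB
      by (subst nn_integral_add) (auto simp: ennreal_mult nn_integral_cmult)
    then show ?thesis using 1 3 by (simp add: ennreal_mult_less_top)
  qed
  have "ennreal (r powr (- \<alpha> - real d) * norm (ball_delta k \<psi> r z)) \<le> ennreal (bump \<gamma> r) * G z" if r: "0 < r" for r z
  proof (cases "r \<le> 1")
    case True
    define Q where "Q w = (\<Sum>i\<le>Suc k. of_real (delta_coeff k i * (r / 2 ^ i) ^ d) * \<psi> (z + (r / 2 ^ i) *\<^sub>R w))" for w
    have int: "integrable lborel (\<lambda>w. indicator (cball 0 1) w *\<^sub>R \<psi> (z + s *\<^sub>R w))" for s
      by (rule Bochner_Integration.integrable_bound[OF integrable_cball[of C0 0 1]])
        (use bdd C0 in \<open>auto simp: indicator_def\<close>)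
    have "ball_delta k \<psi> r z = (\<Sum>i\<le>Suc k. of_real (delta_coeff k i * (r / 2 ^ i) ^ d) *
        (\<integral>w. indicator (cball 0 1) w *\<^sub>R \<psi> (z + (r / 2 ^ i) *\<^sub>R w) \<partial>lborel))"
      unfolding ball_delta_def using r by (intro sum.cong refl) (simp add: ball_integral_rescale d_def)
    also have "\<dots> = (\<integral>w. indicator (cball 0 1) w *\<^sub>R Q w \<partial>lborel)"
      unfolding Q_def scaleR_sum_right
      by (subst Bochner_Integration.integral_sum) (auto simp only: mult_scaleR_right[symmetric] int integral_mult_right_zero intro!: integrable_mult_right)
    finally have D: "ball_delta k \<psi> r z = (\<integral>w. indicator (cball 0 1) w *\<^sub>R Q w \<partial>lborel)" .
    have Q: "norm (Q w) \<le> S * (C1 * decay (real N) z * r ^ (d + Suc m))" if w: "norm w \<le> 1" for w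
    proof -
      obtain a :: "nat \<Rightarrow> complex" where a: "\<And>s. \<bar>s\<bar> \<le> 1 \<Longrightarrow>
          norm (\<psi> (z + s *\<^sub>R w) - (\<Sum>l<Suc m. a l * of_real s ^ l)) \<le> C1 * \<bar>s\<bar> ^ Suc m * decay (real N) z"
        using C1(2)[OF w, of z] by blast
      show ?thesis unfolding Q_def S_def
        by (rule delta_Taylor_cancel[where a=a])
          (use r True k a C1(1) in \<open>auto simp: d_def mult_ac simp del: power_Suc\<close>)
    qed
    have "norm (ball_delta k \<psi> r z) \<le> (\<integral>w. indicator (cball 0 1) w * (S * (C1 * decay (real N) z * r ^ (d + Suc m))) \<partial>(lborel::'a measure))"
      unfolding D
    proof (rule Bochner_Integration.integral_norm_bound_integral)
      show "integrable lborel (\<lambda>w. indicator (cball 0 1) w *\<^sub>R Q w)"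
        unfolding Q_def scaleR_sum_right mult_scaleR_right[symmetric]
        by (intro Bochner_Integration.integrable_sum integrable_mult_right int)
      show "integrable (lborel::'a measure) (\<lambda>w. indicator (cball 0 1) w * (S * (C1 * decay (real N) z * r ^ (d + Suc m))))"
        using integrable_cball[of "S * (C1 * decay (real N) z * r ^ (d + Suc m))" "0::'a" 1] by (simp add: mult.commute)
      show "norm (indicator (cball 0 1) w *\<^sub>R Q w) \<le> indicator (cball 0 1) w * (S * (C1 * decay (real N) z * r ^ (d + Suc m)))" for w
        using Q[of w] by (auto simp: indicator_def)
    qed
    also have "\<dots> = A * decay (real N) z * r ^ (d + Suc m)"
      by (simp add: V_def A_def mult_ac)
    finally have "r powr (- \<alpha> - real d) * norm (ball_delta k \<psi> r z)
        \<le> r powr (- \<alpha> - real d) * (A * decay (real N) z * r ^ (d + Suc m))"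
      by (intro mult_left_mono) auto
    also have "\<dots> = r powr (real m + 1 - \<alpha>) * (A * decay (real N) z)"
    proof -
      have "r ^ (d + Suc m) = r powr real (d + Suc m)" by (rule powr_realpow[OF r, symmetric])
      then have "r powr (- \<alpha> - real d) * r ^ (d + Suc m) = r powr (real m + 1 - \<alpha>)"
        by (simp only: powr_add[symmetric]) (simp add: algebra_simps)
      then show ?thesis by (metis mult.assoc mult.commute)
    qed
    also have "\<dots> \<le> bump \<gamma> r * (A * decay (real N) z)"
      using r True \<gamma> AB by (intro mult_right_mono) (auto simp: bump_low powr_mono')
    finally have "ennreal (r powr (- \<alpha> - real d) * norm (ball_delta k \<psi> r z)) \<le> ennreal (bump \<gamma> r * (A * decay (real N) z))"
      by (rule ennreal_leI)
    also have "\<dots> = ennreal (bump \<gamma> r) * ennreal (A * decay (real N) z)"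
      using AB by (intro ennreal_mult) auto
    also have "\<dots> \<le> ennreal (bump \<gamma> r) * G z"
      unfolding G_def by (intro mult_left_mono) auto
    finally show ?thesis .
  next
    case False
    then have r1: "1 \<le> r" by simp
    define H where "H = (\<integral>\<^sup>+ w. indicator (cball 0 r) w * ennreal (C0 * decay (real N) (z + w)) \<partial>(lborel::'a measure))"
    have ball: "ennreal (norm (ball_integral \<psi> s z)) \<le> H" if s: "s \<le> r" for s
    proof -
      have "ennreal (norm (ball_integral \<psi> s z)) \<le> (\<integral>\<^sup>+ x. ennreal (norm (indicator (cball z s) x *\<^sub>R \<psi> x)) \<partial>lborel)"
        unfolding ball_integral_def by (rule integral_norm_bound_ennreal)
          (rule Bochner_Integration.integrable_bound[OF integrable_cball[of C0 z s]],
            use bdd C0 in \<open>auto simp: indicator_def\<close>)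
      also have "\<dots> \<le> (\<integral>\<^sup>+ x. indicator (cball z r) x * ennreal (C0 * decay (real N) x) \<partial>lborel)"
        using s C0 by (intro nn_integral_mono) (auto simp: indicator_def intro!: ennreal_leI)
      also have "\<dots> = H"
        unfolding H_def by (subst nn_integral_lborel_affine[where c=1 and t=z])
          (auto simp: indicator_def dist_norm intro!: nn_integral_cong)
      finally show ?thesis .
    qed
    have "ennreal (norm (ball_delta k \<psi> r z)) \<le> ennreal (\<Sum>i\<le>Suc k. \<bar>delta_coeff k i\<bar> * norm (ball_integral \<psi> (r / 2 ^ i) z))"
      unfolding ball_delta_def by (intro ennreal_leI sum_norm_le) (simp add: norm_mult)
    also have "\<dots> = (\<Sum>i\<le>Suc k. ennreal \<bar>delta_coeff k i\<bar> * ennreal (norm (ball_integral \<psi> (r / 2 ^ i) z)))"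
      by (subst sum_ennreal[symmetric]) (simp_all add: ennreal_mult del: sum.atMost_Suc)
    also have "\<dots> \<le> (\<Sum>i\<le>Suc k. ennreal \<bar>delta_coeff k i\<bar> * H)"
    proof (intro sum_mono mult_left_mono ball)
      show "r / 2 ^ i \<le> r" for i using r by (simp add: field_simps mult_le_cancel_left1)
    qed simp
    also have "\<dots> = ennreal S * H"
      unfolding S_def sum_distrib_right[symmetric] by (subst sum_ennreal) simp_all
    finally have nb: "ennreal (norm (ball_delta k \<psi> r z)) \<le> ennreal S * H" .
    have "ennreal (r powr (- \<alpha> - real d)) * H \<le> ennreal (bump \<gamma> r) *
        (ennreal (2 powr \<sigma> * C0) * (\<integral>\<^sup>+ w. ennreal (decay \<sigma> w) * ennreal (decay (real N) (z + w)) \<partial>lborel))"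
    proof -
      have "ennreal (r powr (- \<alpha> - real d)) * H
          = (\<integral>\<^sup>+ w. ennreal (r powr (- \<alpha> - real d)) * (indicator (cball 0 r) w * ennreal (C0 * decay (real N) (z + w))) \<partial>(lborel::'a measure))"
        unfolding H_def by (rule nn_integral_cmult[symmetric])
          (intro borel_measurable_times_ennreal borel_measurable_indicator; simp)
      also have "\<dots> \<le> (\<integral>\<^sup>+ w. ennreal (bump \<gamma> r * (2 powr \<sigma> * C0)) * (ennreal (decay \<sigma> w) * ennreal (decay (real N) (z + w))) \<partial>(lborel::'a measure))"
      proof (rule nn_integral_mono)
        fix w :: 'a
        show "ennreal (r powr (- \<alpha> - real d)) * (indicator (cball 0 r) w * ennreal (C0 * decay (real N) (z + w)))
          \<le> ennreal (bump \<gamma> r * (2 powr \<sigma> * C0)) * (ennreal (decay \<sigma> w) * ennreal (decay (real N) (z + w)))"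
        proof (cases "norm w \<le> r")
          case True
          have w1: "0 < 1 + norm w" by (simp add: add_pos_nonneg)
          have "r powr (- \<alpha> - real d) = r powr (- (\<alpha> / 2)) * r powr (- \<sigma>)"
            by (simp add: \<sigma>_def powr_add[symmetric])
          also have "\<dots> \<le> r powr (- \<gamma>) * (2 powr \<sigma> * decay \<sigma> w)"
          proof (intro mult_mono)
            show "r powr (- (\<alpha> / 2)) \<le> r powr (- \<gamma>)" using r1 \<gamma> by (intro powr_mono) auto
            have "r powr (- \<sigma>) \<le> ((1 + norm w) / 2) powr (- \<sigma>)"
              using r1 True w1 \<alpha> by (intro powr_mono2') (auto simp: \<sigma>_def)
            also have "\<dots> = 2 powr \<sigma> * decay \<sigma> w"
              using w1 by (simp add: decay_def powr_divide powr_minus field_simps)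
            finally show "r powr (- \<sigma>) \<le> 2 powr \<sigma> * decay \<sigma> w" .
          qed auto
          finally have "r powr (- \<alpha> - real d) \<le> bump \<gamma> r * (2 powr \<sigma> * decay \<sigma> w)"
            using r1 \<gamma> by (simp add: bump_high)
          then have "r powr (- \<alpha> - real d) * (C0 * decay (real N) (z + w))
              \<le> bump \<gamma> r * (2 powr \<sigma> * decay \<sigma> w) * (C0 * decay (real N) (z + w))"
            using C0 by (intro mult_right_mono) auto
          then have "ennreal (r powr (- \<alpha> - real d) * (C0 * decay (real N) (z + w)))
              \<le> ennreal (bump \<gamma> r * (2 powr \<sigma> * C0) * (decay \<sigma> w * decay (real N) (z + w)))"
            by (intro ennreal_leI) (simp add: mult_ac)
          also have "\<dots> = ennreal (bump \<gamma> r * (2 powr \<sigma> * C0)) * (ennreal (decay \<sigma> w) * ennreal (decay (real N) (z + w)))"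
            using C0 by (subst ennreal_mult) (auto simp: ennreal_mult)
          also have "ennreal (r powr (- \<alpha> - real d) * (C0 * decay (real N) (z + w)))
              = ennreal (r powr (- \<alpha> - real d)) * (indicator (cball 0 r) w * ennreal (C0 * decay (real N) (z + w)))"
            using True C0 by (subst ennreal_mult) auto
          finally show ?thesis .
        qed simp
      qed
      also have "\<dots> = ennreal (bump \<gamma> r * (2 powr \<sigma> * C0)) * (\<integral>\<^sup>+ w. ennreal (decay \<sigma> w) * ennreal (decay (real N) (z + w)) \<partial>lborel)"
        by (rule nn_integral_cmult) measurable
      finally show ?thesis using C0 by (simp add: ennreal_mult mult.assoc)
    qed
    then have "ennreal S * (ennreal (r powr (- \<alpha> - real d)) * H) \<le> ennreal S * (ennreal (bump \<gamma> r) *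
        (ennreal (2 powr \<sigma> * C0) * (\<integral>\<^sup>+ w. ennreal (decay \<sigma> w) * ennreal (decay (real N) (z + w)) \<partial>lborel)))"
      by (rule mult_left_mono) simp
    also have "\<dots> = ennreal (bump \<gamma> r) * (ennreal B * (\<integral>\<^sup>+ w. ennreal (decay \<sigma> w) * ennreal (decay (real N) (z + w)) \<partial>lborel))"
      using S C0 by (simp add: B_def ennreal_mult mult_ac)
    also have "\<dots> \<le> ennreal (bump \<gamma> r) * G z" unfolding G_def by (intro mult_left_mono) auto
    finally have "ennreal S * (ennreal (r powr (- \<alpha> - real d)) * H) \<le> ennreal (bump \<gamma> r) * G z" .
    moreover have "ennreal (r powr (- \<alpha> - real d) * norm (ball_delta k \<psi> r z))
        \<le> ennreal S * (ennreal (r powr (- \<alpha> - real d)) * H)"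
      using mult_left_mono[OF nb, of "ennreal (r powr (- \<alpha> - real d))"] by (simp add: ennreal_mult mult_ac)
    ultimately show ?thesis by (rule order_trans[rotated])
  qed
  then show ?thesis using G_meas G_int that unfolding \<psi>_def d_def by blast
qed

section \<open>Ball integrals of convolutions\<close>

lemma inv_fourier_rescale:
  fixes g :: "'a::euclidean_space \<Rightarrow> complex"
  assumes [measurable]: "g \<in> borel_measurable borel" and c: "0 < c"
  shows "inv_fourier (\<lambda>\<xi>. g (\<xi> /\<^sub>R c)) x = of_real (c ^ DIM('a)) * inv_fourier g (c *\<^sub>R x)"
proof -
  have "(\<integral>\<xi>. cis (x \<bullet> \<xi>) * g (\<xi> /\<^sub>R c) \<partial>lborel)
      = (\<bar>c\<bar> ^ DIM('a)) *\<^sub>R (\<integral>\<xi>. cis (x \<bullet> (0 + c *\<^sub>R \<xi>)) * g ((0 + c *\<^sub>R \<xi>) /\<^sub>R c) \<partial>lborel)"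
    using c by (intro integral_lborel_affine) auto
  then show ?thesis
    using c by (simp add: inv_fourier_def scaleR_conv_of_real)
qed

lemma measurable_fourier [measurable]:
  assumes [measurable]: "g \<in> borel_measurable borel"
  shows "fourier g \<in> borel_measurable borel"
  unfolding fourier_def[abs_def] by measurable

lemma norm_fourier_le: "norm (fourier g \<xi>) \<le> (\<integral>x. norm (g x) \<partial>lborel)"
  unfolding fourier_def using integral_norm_bound[of lborel "\<lambda>x. cis (- (x \<bullet> \<xi>)) * g x"] by simp

lemma integrable_mult_fourier:
  fixes h g :: "'a::euclidean_space \<Rightarrow> complex"
  assumes h: "integrable lborel h" and g: "integrable lborel g"
  shows "integrable lborel (\<lambda>\<xi>. g \<xi> * fourier h \<xi>)"
proof (rule Bochner_Integration.integrable_bound)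
  note [measurable] = borel_measurable_integrable[OF h] borel_measurable_integrable[OF g]
  show "integrable lborel (\<lambda>\<xi>. norm (g \<xi>) * (\<integral>x. norm (h x) \<partial>lborel))" using g by simp
  show "(\<lambda>\<xi>. g \<xi> * fourier h \<xi>) \<in> borel_measurable lborel" by measurable
  show "AE \<xi> in lborel. norm (g \<xi> * fourier h \<xi>) \<le> norm (norm (g \<xi>) * (\<integral>x. norm (h x) \<partial>lborel))"
    by (auto simp: norm_mult abs_mult intro!: mult_left_mono order_trans[OF norm_fourier_le])
qed

lemma inv_fourier_diff:
  fixes g h :: "'a::euclidean_space \<Rightarrow> complex"
  assumes "integrable lborel g" "integrable lborel h"
  shows "inv_fourier (\<lambda>\<xi>. g \<xi> - h \<xi>) x = inv_fourier g x - inv_fourier h x"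
  unfolding inv_fourier_def
  by (simp add: right_diff_distrib diff_divide_distrib integrable_cis_mult[OF assms(1)] integrable_cis_mult[OF assms(2)])

lemma integrable_convolution:
  fixes h g :: "'a::euclidean_space \<Rightarrow> complex"
  assumes h: "integrable lborel h" and g: "integrable lborel g"
  shows "integrable (lborel \<Otimes>\<^sub>M lborel) (\<lambda>(z, x). h z * g (x - z))"
    and "integrable lborel (\<lambda>x. \<integral>z. h z * g (x - z) \<partial>lborel)"
proof -
  note [measurable] = borel_measurable_integrable[OF h] borel_measurable_integrable[OF g]
  have shift: "integrable lborel (\<lambda>x. g (x - z))" for z
    using integrable_lborel_affine[OF g, of 1 "- z"] by simp
  have norm_shift: "(\<integral>x. norm (g (x - z)) \<partial>lborel) = (\<integral>x. norm (g x) \<partial>lborel)" for z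
    using integral_lborel_affine[of "\<lambda>x. norm (g x)" 1 "- z"] by simp
  show *: "integrable (lborel \<Otimes>\<^sub>M lborel) (\<lambda>(z, x). h z * g (x - z))"
  proof (rule lborel_pair.Fubini_integrable)
    show "integrable lborel (\<lambda>z. \<integral>x. norm (case (z, x) of (z, x) \<Rightarrow> h z * g (x - z)) \<partial>lborel)"
      using h by (simp add: norm_mult norm_shift)
    show "AE z in lborel. integrable lborel (\<lambda>x. case (z, x) of (z, x) \<Rightarrow> h z * g (x - z))"
      using shift by simp
  qed measurable
  show "integrable lborel (\<lambda>x. \<integral>z. h z * g (x - z) \<partial>lborel)"
    by (rule lborel_pair.integrable_snd[OF *])
qed

text \<open>
  Joint measurability in radius and centre: the ball is described by the measurable condition
  \<open>dist z x \<le> r\<close> on all three variables.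
\<close>
lemma measurable_ball_integral_pair:
  fixes u :: "'a::euclidean_space \<Rightarrow> complex"
  assumes [measurable]: "u \<in> borel_measurable borel"
  shows "(\<lambda>p. ball_integral u (fst p) (snd p)) \<in> borel_measurable (borel \<Otimes>\<^sub>M borel)"
proof -
  have "ball_integral u r z = (\<integral>x. (if dist z x \<le> r then u x else 0) \<partial>lborel)" for r z
    unfolding ball_integral_def by (intro Bochner_Integration.integral_cong) (auto simp: indicator_def)
  then show ?thesis by simp
qed

lemma measurable_ball_integral [measurable]:
  fixes u :: "'a::euclidean_space \<Rightarrow> complex"
  assumes u: "u \<in> borel_measurable borel" and [measurable]: "r \<in> borel_measurable M" "z \<in> M \<rightarrow>\<^sub>M borel"
  shows "(\<lambda>x. ball_integral u (r x) (z x)) \<in> borel_measurable M"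
  using measurable_compose[OF _ measurable_ball_integral_pair[OF u], of "\<lambda>x. (r x, z x)" M] by simp

lemma measurable_ball_delta [measurable]:
  fixes u :: "'a::euclidean_space \<Rightarrow> complex"
  assumes [measurable]: "u \<in> borel_measurable borel" "r \<in> borel_measurable M" "z \<in> M \<rightarrow>\<^sub>M borel"
  shows "(\<lambda>x. ball_delta k u (r x) (z x)) \<in> borel_measurable M"
  unfolding ball_delta_def by measurable

lemma integrable_indicator_cball:
  fixes u :: "'a::euclidean_space \<Rightarrow> complex"
  assumes "integrable lborel u"
  shows "integrable lborel (\<lambda>x. indicator (cball z r) x *\<^sub>R u x)"
  using integrable_mult_indicator[of "cball z r" lborel u] assms by simp

lemma norm_ball_integral_le:
  fixes u :: "'a::euclidean_space \<Rightarrow> complex"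
  assumes u: "integrable lborel u"
  shows "norm (ball_integral u r z) \<le> (\<integral>x. norm (u x) \<partial>lborel)"
  unfolding ball_integral_def
  by (rule Bochner_Integration.integral_norm_bound_integral)
    (use u integrable_indicator_cball[OF u] in \<open>auto simp: indicator_def\<close>)

text \<open>
  By Fubini, the ball integral acts on the kernel instead of on \<open>h\<close>; the dilation of the kernel becomes
  a dilation of radius and centre.
\<close>
lemma ball_integral_convolution:
  fixes h \<psi> :: "'a::euclidean_space \<Rightarrow> complex"
  assumes h: "integrable lborel h" and \<psi>: "integrable lborel \<psi>" and c: "0 < c"
  shows "ball_integral (\<lambda>x. \<integral>z. h z * (of_real (c ^ DIM('a)) * \<psi> (c *\<^sub>R (x - z))) \<partial>lborel) r y
       = (\<integral>z. h z * ball_integral \<psi> (c * r) (c *\<^sub>R (y - z)) \<partial>lborel)"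
proof -
  note [measurable] = borel_measurable_integrable[OF h] borel_measurable_integrable[OF \<psi>]
  define g where "g x = of_real (c ^ DIM('a)) * \<psi> (c *\<^sub>R x)" for x
  have g: "integrable lborel g"
    unfolding g_def using integrable_lborel_affine[OF \<psi>, of c 0] c by simp
  note [measurable] = borel_measurable_integrable[OF g]
  have cb [measurable]: "cball y r \<in> sets borel" by simp
  have int: "integrable (lborel \<Otimes>\<^sub>M lborel) (\<lambda>(z, x). indicator (cball y r) x *\<^sub>R (h z * g (x - z)))"
    by (rule Bochner_Integration.integrable_bound[OF integrable_convolution(1)[OF h g]])
      (auto simp: indicator_def)
  have "ball_integral (\<lambda>x. \<integral>z. h z * g (x - z) \<partial>lborel) r y
      = (\<integral>x. (\<integral>z. indicator (cball y r) x *\<^sub>R (h z * g (x - z)) \<partial>lborel) \<partial>lborel)"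
    unfolding ball_integral_def by (simp only: integral_scaleR_right)
  also have "\<dots> = (\<integral>z. (\<integral>x. indicator (cball y r) x *\<^sub>R (h z * g (x - z)) \<partial>lborel) \<partial>lborel)"
    by (rule lborel_pair.Fubini_integral[OF int])
  also have "\<dots> = (\<integral>z. h z * ball_integral \<psi> (c * r) (c *\<^sub>R (y - z)) \<partial>lborel)"
  proof (intro Bochner_Integration.integral_cong refl)
    fix z
    have "ball_integral \<psi> (c * r) (c *\<^sub>R (y - z))
        = (\<bar>c\<bar> ^ DIM('a)) *\<^sub>R (\<integral>x. indicator (cball (c *\<^sub>R (y - z)) (c * r)) (- (c *\<^sub>R z) + c *\<^sub>R x) *\<^sub>R \<psi> (- (c *\<^sub>R z) + c *\<^sub>R x) \<partial>lborel)"
      unfolding ball_integral_def using c by (intro integral_lborel_affine) (auto intro!: borel_measurable_scaleR borel_measurable_indicator)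
    also have "\<dots> = (\<integral>x. indicator (cball y r) x *\<^sub>R g (x - z) \<partial>lborel)"
    proof -
      have *: "- (c *\<^sub>R z) + c *\<^sub>R x = c *\<^sub>R (x - z)" for x by (simp add: algebra_simps)
      have "dist (c *\<^sub>R (y - z)) (c *\<^sub>R (x - z)) = c * dist y x" for x
        using c by (simp add: dist_norm flip: scaleR_diff_right)
      then have "indicator (cball (c *\<^sub>R (y - z)) (c * r)) (c *\<^sub>R (x - z)) = (indicator (cball y r) x :: real)" for x
        using c by (simp add: indicator_def)
      then show ?thesis
        unfolding * integral_scaleR_right[symmetric] g_def using c by (simp add: scaleR_conv_of_real mult_ac)
    qed
    finally show "(\<integral>x. indicator (cball y r) x *\<^sub>R (h z * g (x - z)) \<partial>lborel) = h z * ball_integral \<psi> (c * r) (c *\<^sub>R (y - z))"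
      by (simp only: mult_scaleR_right[symmetric] integral_mult_right_zero)
  qed
  finally show ?thesis by (simp only: g_def)
qed

text \<open>
  For \<open>z\<close> inside the ball around \<open>y\<close> the dilated balls exhaust the space, for \<open>z\<close> outside they escape
  to infinity, and the sphere in between is a null set. So the integrals of \<open>\<psi>\<close> over the dilated balls
  tend to the indicator of the ball.
\<close>
lemma ball_integral_mollify_tendsto:
  fixes h \<psi> :: "'a::euclidean_space \<Rightarrow> complex"
  assumes h: "integrable lborel h" and \<psi>: "integrable lborel \<psi>" and one: "(\<integral>x. \<psi> x \<partial>lborel) = 1"
  shows "(\<lambda>J. \<integral>z. h z * ball_integral \<psi> (2 ^ J * r) (2 ^ J *\<^sub>R (y - z)) \<partial>lborel) \<longlonglongrightarrow> ball_integral h r y"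
  unfolding ball_integral_def[of h]
proof (rule integral_dominated_convergence)
  note [measurable] = borel_measurable_integrable[OF h] borel_measurable_integrable[OF \<psi>]
  show "(\<lambda>x. indicator (cball y r) x *\<^sub>R h x) \<in> borel_measurable lborel"
    using borel_measurable_integrable[OF integrable_indicator_cball[OF h]] .
  show "(\<lambda>z. h z * ball_integral \<psi> (2 ^ J * r) (2 ^ J *\<^sub>R (y - z))) \<in> borel_measurable lborel" for J
    by measurable
  show "integrable lborel (\<lambda>z. norm (h z) * (\<integral>x. norm (\<psi> x) \<partial>lborel))" using h by simp
  show "AE z in lborel. norm (h z * ball_integral \<psi> (2 ^ J * r) (2 ^ J *\<^sub>R (y - z))) \<le> norm (h z) * (\<integral>x. norm (\<psi> x) \<partial>lborel)" for J
    by (auto simp: norm_mult intro!: mult_left_mono norm_ball_integral_le \<psi>)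
  have null: "sphere y r \<in> null_sets lborel"
    using negligible_sphere[of y r] by (auto simp: null_sets_completion_iff negligible_iff_null_sets negligible_convex_frontier)
  have "(\<lambda>J. ball_integral \<psi> (2 ^ J * r) (2 ^ J *\<^sub>R (y - z))) \<longlonglongrightarrow> indicator (cball y r) z *\<^sub>R (\<integral>x. \<psi> x \<partial>lborel)"
    if z: "z \<notin> sphere y r" for z
    unfolding ball_integral_def integral_scaleR_right[symmetric]
  proof (rule integral_dominated_convergence)
    show "integrable lborel (\<lambda>x. norm (\<psi> x))" using \<psi> by simp
    show "AE x in lborel. norm (indicator (cball (2 ^ J *\<^sub>R (y - z)) (2 ^ J * r)) x *\<^sub>R \<psi> x) \<le> norm (\<psi> x)" for J
      by (auto simp: indicator_def)
    show "(\<lambda>x. indicator (cball (2 ^ J *\<^sub>R (y - z)) (2 ^ J * r)) x *\<^sub>R \<psi> x) \<in> borel_measurable lborel" for J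
      using borel_measurable_integrable[OF integrable_indicator_cball[OF \<psi>]] .
    have "(\<lambda>J. indicator (cball (2 ^ J *\<^sub>R (y - z)) (2 ^ J * r)) x :: real) \<longlonglongrightarrow> indicator (cball y r) z" for x
    proof -
      \<comment> \<open>Divide the condition on \<open>x\<close> by \<open>2 ^ J\<close>.\<close>
      have eq: "indicator (cball (2 ^ J *\<^sub>R (y - z)) (2 ^ J * r)) x = (if norm (y - z - (1 / 2) ^ J *\<^sub>R x) \<le> r then 1 else 0 :: real)" for J
      proof -
        have "2 ^ J *\<^sub>R (y - z) - x = 2 ^ J *\<^sub>R (y - z - (1 / 2) ^ J *\<^sub>R x)"
          by (simp add: scaleR_diff_right power_one_over)
        then have "dist (2 ^ J *\<^sub>R (y - z)) x = 2 ^ J * norm (y - z - (1 / 2) ^ J *\<^sub>R x)"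
          by (simp only: dist_norm norm_scaleR) simp
        then show ?thesis by (simp add: indicator_def)
      qed
      have lim: "(\<lambda>J. norm (y - z - (1 / 2) ^ J *\<^sub>R x)) \<longlonglongrightarrow> norm (y - z)"
        by (rule tendsto_eq_intros LIMSEQ_power_zero | simp)+
      show ?thesis
      proof (cases "norm (y - z) < r")
        case True
        have "eventually (\<lambda>J. norm (y - z - (1 / 2) ^ J *\<^sub>R x) < r) sequentially"
          by (rule order_tendstoD(2)[OF lim True])
        then have "eventually (\<lambda>J. indicator (cball (2 ^ J *\<^sub>R (y - z)) (2 ^ J * r)) x = (indicator (cball y r) z :: real)) sequentially"
          by eventually_elim (use True in \<open>simp add: eq dist_norm\<close>)
        then show ?thesis by (rule tendsto_eventually)
      next
        case False
        then have "r < norm (y - z)" using z by (simp add: dist_norm)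
        have "eventually (\<lambda>J. r < norm (y - z - (1 / 2) ^ J *\<^sub>R x)) sequentially"
          by (rule order_tendstoD(1)[OF lim \<open>r < norm (y - z)\<close>])
        then have "eventually (\<lambda>J. indicator (cball (2 ^ J *\<^sub>R (y - z)) (2 ^ J * r)) x = (indicator (cball y r) z :: real)) sequentially"
          by eventually_elim (use \<open>r < norm (y - z)\<close> in \<open>simp add: eq dist_norm\<close>)
        then show ?thesis by (rule tendsto_eventually)
      qed
    qed
    then show "AE x in lborel. (\<lambda>J. indicator (cball (2 ^ J *\<^sub>R (y - z)) (2 ^ J * r)) x *\<^sub>R \<psi> x) \<longlonglongrightarrow> indicator (cball y r) z *\<^sub>R \<psi> x"
      by (intro AE_I2 tendsto_scaleR tendsto_const)
    show "(\<lambda>x. indicator (cball y r) z *\<^sub>R \<psi> x) \<in> borel_measurable lborel" by measurable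
  qed
  then have "(\<lambda>J. h z * ball_integral \<psi> (2 ^ J * r) (2 ^ J *\<^sub>R (y - z))) \<longlonglongrightarrow> h z * (indicator (cball y r) z *\<^sub>R 1)"
    if "z \<notin> sphere y r" for z
    using that unfolding one by (intro tendsto_mult tendsto_const) blast
  then have lim: "(\<lambda>J. h z * ball_integral \<psi> (2 ^ J * r) (2 ^ J *\<^sub>R (y - z))) \<longlonglongrightarrow> indicator (cball y r) z *\<^sub>R h z"
    if "z \<notin> sphere y r" for z
    using that by (simp add: scaleR_conv_of_real mult.commute)
  show "AE z in lborel. (\<lambda>J. h z * ball_integral \<psi> (2 ^ J * r) (2 ^ J *\<^sub>R (y - z))) \<longlonglongrightarrow> indicator (cball y r) z *\<^sub>R h z"
    using AE_not_in[OF null] by eventually_elim (rule lim)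
qed

section \<open>Littlewood-Paley blocks\<close>

lemma lp_cutoff_test_function:
  assumes "lp_cutoff \<phi>"
  shows "test_function 2 \<phi>"
  using assms by (auto simp: lp_cutoff_def test_function_def)

lemma integrable_inv_fourier_test_function:
  fixes g :: "'a::euclidean_space \<Rightarrow> real"
  assumes g: "test_function R g"
  shows "integrable lborel (inv_fourier (\<lambda>\<xi>. of_real (g \<xi>)))"
proof -
  have [measurable]: "g \<in> borel_measurable borel"
    using test_function_continuous[OF g] by (rule borel_measurable_continuous_onI)
  obtain C where C: "0 \<le> C" "\<And>x. norm (inv_fourier (\<lambda>\<xi>. of_real (g \<xi>)) x) \<le> C * decay (real (Suc DIM('a))) x"
    using inv_fourier_decay[OF g, of "Suc DIM('a)"] by blast
  show ?thesis
  proof (rule integrableI_bounded)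
    have "(\<integral>\<^sup>+ x. ennreal (norm (inv_fourier (\<lambda>\<xi>. of_real (g \<xi>)) x)) \<partial>lborel)
        \<le> (\<integral>\<^sup>+ x. ennreal C * ennreal (decay (real (Suc DIM('a))) (x::'a)) \<partial>lborel)"
      using C by (intro nn_integral_mono) (simp add: ennreal_mult[symmetric] ennreal_leI del: of_nat_Suc)
    also have "\<dots> = ennreal C * (\<integral>\<^sup>+ x. ennreal (decay (real (Suc DIM('a))) (x::'a)) \<partial>lborel)"
      by (rule nn_integral_cmult) measurable
    also have "\<dots> < \<infinity>"
      using nn_integral_decay_finite[where 'a='a, of "real (Suc DIM('a))"]
      by (simp add: ennreal_mult_less_top)
    finally show "(\<integral>\<^sup>+ x. ennreal (norm (inv_fourier (\<lambda>\<xi>. of_real (g \<xi>)) x)) \<partial>lborel) < \<infinity>" .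
  qed measurable
qed

context
  fixes \<phi> :: "'a::euclidean_space \<Rightarrow> real"
begin

definition low_symbol :: "nat \<Rightarrow> 'a \<Rightarrow> complex" where
  "low_symbol J \<xi> = of_real (\<phi> (\<xi> /\<^sub>R 2 ^ J))"

definition mollifier :: "'a \<Rightarrow> complex" where
  "mollifier = inv_fourier (\<lambda>\<xi>. of_real (\<phi> \<xi>))"

context
  assumes \<phi>: "lp_cutoff \<phi>"
begin

lemma measurable_cutoff: "\<phi> \<in> borel_measurable borel"
  using test_function_continuous[OF lp_cutoff_test_function[OF \<phi>]] by (rule borel_measurable_continuous_onI)

lemma integrable_mollifier: "integrable lborel mollifier"
  unfolding mollifier_def by (rule integrable_inv_fourier_test_function[OF lp_cutoff_test_function[OF \<phi>]])

lemma measurable_mollifier [measurable]: "mollifier \<in> borel_measurable borel"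
  using borel_measurable_integrable[OF integrable_mollifier] by simp

lemma integrable_low_symbol: "integrable lborel (low_symbol J)"
  using integrable_lborel_affine[OF test_function_integrable[OF lp_cutoff_test_function[OF \<phi>]], of "inverse (2 ^ J)" 0]
  by (simp add: low_symbol_def[abs_def])

lemma inv_fourier_low_symbol:
  "inv_fourier (low_symbol J) x = of_real ((2 ^ J) ^ DIM('a)) * mollifier (2 ^ J *\<^sub>R x)"
  unfolding low_symbol_def[abs_def] mollifier_def
  using measurable_cutoff by (intro inv_fourier_rescale[where g="\<lambda>\<xi>. of_real (\<phi> \<xi>)"]) auto

lemma integrable_inv_fourier_low_symbol: "integrable lborel (inv_fourier (low_symbol J))"
proof -
  have "integrable lborel (\<lambda>x. of_real ((2 ^ J) ^ DIM('a)) * mollifier (0 + 2 ^ J *\<^sub>R x))"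
    by (intro integrable_mult_right integrable_lborel_affine integrable_mollifier) simp
  moreover have "inv_fourier (low_symbol J) = (\<lambda>x. of_real ((2 ^ J) ^ DIM('a)) * mollifier (0 + 2 ^ J *\<^sub>R x))"
    by (simp only: inv_fourier_low_symbol[abs_def] add_0)
  ultimately show ?thesis by simp
qed

text \<open>
  Fourier inversion for the dilated cutoffs. It is needed at the origin, where it says that the mollifier
  has integral \<open>1\<close>, and at all frequencies for the reproducing formula of the blocks.
\<close>
lemma fourier_inv_fourier_low_symbol: "fourier (inv_fourier (low_symbol J)) \<xi> = low_symbol J \<xi>"
proof -
  obtain B where B: "0 \<le> B" "\<And>\<xi>. \<bar>\<phi> \<xi>\<bar> \<le> B * indicator (cball 0 2) \<xi>"
    using test_function_bounded[OF lp_cutoff_test_function[OF \<phi>]] by blast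
  show ?thesis
  proof (rule fourier_inversion[OF integrable_low_symbol _ _ integrable_inv_fourier_low_symbol])
    show "continuous_on UNIV (low_symbol J)"
      unfolding low_symbol_def[abs_def]
      by (intro continuous_on_of_real continuous_on_compose2[OF test_function_continuous[OF lp_cutoff_test_function[OF \<phi>]]])
        (auto intro!: continuous_intros)
    show "norm (low_symbol J \<xi>) \<le> B" for \<xi>
    proof -
      have "B * indicator (cball 0 2) (\<xi> /\<^sub>R 2 ^ J) \<le> B" using B(1) by (simp add: indicator_def)
      then show ?thesis unfolding low_symbol_def using B(2)[of "\<xi> /\<^sub>R 2 ^ J"] by simp
    qed
  qed
qed

lemma integral_mollifier: "(\<integral>x. mollifier x \<partial>lborel) = 1"
proof -
  have "inv_fourier (low_symbol 0) = mollifier" by (simp add: inv_fourier_low_symbol[abs_def])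
  then have "(\<integral>x. mollifier x \<partial>lborel) = low_symbol 0 0"
    using fourier_inv_fourier_low_symbol[of 0 0] by (simp add: fourier_def)
  then show ?thesis using \<phi> by (simp add: low_symbol_def lp_cutoff_def)
qed

lemma lp_piece_eq_low_symbol:
  "of_real (lp_piece \<phi> j \<xi>) = (if j = 0 then low_symbol 0 \<xi> else low_symbol j \<xi> - low_symbol (j - 1) \<xi>)"
  by (simp add: lp_piece_def low_symbol_def)

lemma integrable_lp_piece: "integrable lborel (\<lambda>\<xi>. complex_of_real (lp_piece \<phi> j \<xi>))"
  unfolding lp_piece_eq_low_symbol using integrable_low_symbol by (cases j) auto

text \<open>
  The piece is supported where \<open>norm \<xi> \<le> 2 ^ (j + 1)\<close>, and there the next low-frequency cutoff equals
  \<open>1\<close>.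
\<close>
lemma lp_piece_mult_low_symbol: "of_real (lp_piece \<phi> j \<xi>) * low_symbol (Suc j) \<xi> = of_real (lp_piece \<phi> j \<xi>)"
proof (cases "norm \<xi> \<le> 2 ^ Suc j")
  case True
  then have "norm (\<xi> /\<^sub>R 2 ^ Suc j) \<le> 1" by (simp add: field_simps)
  then have "low_symbol (Suc j) \<xi> = 1" using \<phi> unfolding low_symbol_def lp_cutoff_def by simp
  then show ?thesis by simp
next
  case False
  have z: "\<phi> (\<xi> /\<^sub>R 2 ^ i) = 0" if "i \<le> j" for i
  proof -
    have "2 * 2 ^ i \<le> (2 ^ Suc j :: real)" using that by simp
    then have "2 * 2 ^ i \<le> norm \<xi>" using False by linarith
    then have "2 \<le> norm (\<xi> /\<^sub>R 2 ^ i)" by (simp add: field_simps)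
    then show ?thesis using \<phi> by (simp add: lp_cutoff_def)
  qed
  have "lp_piece \<phi> j \<xi> = 0" using z[of j] z[of "j - 1"] z[of 0] by (simp add: lp_piece_def)
  then show ?thesis by simp
qed

context
  fixes f :: "'a \<Rightarrow> real"
  assumes f: "integrable lborel f"
begin

lemma lp_block_telescope: "(\<Sum>j\<le>J. lp_block \<phi> j f x) = (\<integral>z. of_real (f z) * inv_fourier (low_symbol J) (x - z) \<partial>lborel)"
proof -
  have F: "integrable lborel (\<lambda>z. complex_of_real (f z))" using f by simp
  define A where "A J x = inv_fourier (\<lambda>\<xi>. low_symbol J \<xi> * fourier (\<lambda>x. of_real (f x)) \<xi>) x" for J x
  have int: "integrable lborel (\<lambda>\<xi>. low_symbol J \<xi> * fourier (\<lambda>x. of_real (f x)) \<xi>)" for J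
    by (rule integrable_mult_fourier[OF F integrable_low_symbol])
  have step: "lp_block \<phi> (Suc j) f x = A (Suc j) x - A j x" for j
    unfolding lp_block_def A_def lp_piece_eq_low_symbol
    by (subst inv_fourier_diff[OF int int, symmetric]) (simp add: left_diff_distrib)
  have "(\<Sum>j\<le>J. lp_block \<phi> j f x) = A J x"
    by (induction J) (simp_all add: step, simp add: lp_block_def A_def lp_piece_eq_low_symbol)
  then show ?thesis
    unfolding A_def by (simp add: convolution_inv_fourier[OF F integrable_low_symbol])
qed

lemma lp_block_eq_convolution: "lp_block \<phi> j f x = (\<integral>z. of_real (f z) * inv_fourier (\<lambda>\<xi>. of_real (lp_piece \<phi> j \<xi>)) (x - z) \<partial>lborel)"
  unfolding lp_block_def using f by (subst convolution_inv_fourier) (auto intro: integrable_lp_piece)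

lemma integrable_lp_block: "integrable lborel (lp_block \<phi> j f)"
proof -
  have "integrable lborel (inv_fourier (\<lambda>\<xi>. complex_of_real (lp_piece \<phi> j \<xi>)))"
  proof (cases j)
    case 0
    then show ?thesis using integrable_inv_fourier_low_symbol[of 0] by (simp add: lp_piece_eq_low_symbol)
  next
    case (Suc i)
    have "inv_fourier (\<lambda>\<xi>. low_symbol j \<xi> - low_symbol i \<xi>) = (\<lambda>x. inv_fourier (low_symbol j) x - inv_fourier (low_symbol i) x)"
      by (rule ext) (rule inv_fourier_diff[OF integrable_low_symbol integrable_low_symbol])
    then show ?thesis
      using Suc integrable_inv_fourier_low_symbol[of j] integrable_inv_fourier_low_symbol[of i]
      by (simp add: lp_piece_eq_low_symbol)
  qed
  then show ?thesis
    unfolding lp_block_eq_convolution[abs_def] using f by (intro integrable_convolution(2)) auto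
qed

lemma measurable_lp_block [measurable]: "lp_block \<phi> j f \<in> borel_measurable borel"
  using borel_measurable_integrable[OF integrable_lp_block] by simp

text \<open>
  Frequency localisation enters through this formula: estimates for all blocks are transferred to
  dilates of one fixed kernel, the mollifier.
\<close>
lemma lp_block_reproducing:
  "lp_block \<phi> j f x = (\<integral>z. lp_block \<phi> j f z * inv_fourier (low_symbol (Suc j)) (x - z) \<partial>lborel)"
proof -
  define P where "P \<xi> = of_real (lp_piece \<phi> j \<xi>) * fourier (\<lambda>x. of_real (f x)) \<xi>" for \<xi>
  have P: "integrable lborel P"
    unfolding P_def using f by (intro integrable_mult_fourier integrable_lp_piece) auto
  have fj: "lp_block \<phi> j f = inv_fourier P" by (simp add: lp_block_def P_def[abs_def])
  have [measurable]: "P \<in> borel_measurable borel" using borel_measurable_integrable[OF P] by simp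
  have [measurable]: "inv_fourier (low_symbol (Suc j)) \<in> borel_measurable borel"
    using borel_measurable_integrable[OF integrable_inv_fourier_low_symbol] by simp
  \<comment> \<open>Substitute \<open>x - z\<close> for \<open>z\<close>, so that the mollifier becomes the convolving function.\<close>
  have "(\<integral>z. inv_fourier P z * inv_fourier (low_symbol (Suc j)) (x - z) \<partial>lborel)
      = (\<integral>z. inv_fourier P (x + (- 1) *\<^sub>R z) * inv_fourier (low_symbol (Suc j)) (x - (x + (- 1) *\<^sub>R z)) \<partial>lborel)"
    by (subst integral_lborel_affine[where c="- 1" and t=x]) auto
  also have "\<dots> = (\<integral>z. inv_fourier (low_symbol (Suc j)) z * inv_fourier P (x - z) \<partial>lborel)"
    by (simp add: mult.commute)
  also have "\<dots> = inv_fourier (\<lambda>\<xi>. P \<xi> * fourier (inv_fourier (low_symbol (Suc j))) \<xi>) x"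
    by (rule convolution_inv_fourier[OF integrable_inv_fourier_low_symbol P])
  also have "(\<lambda>\<xi>. P \<xi> * fourier (inv_fourier (low_symbol (Suc j))) \<xi>) = P"
  proof
    fix \<xi>
    have "P \<xi> * low_symbol (Suc j) \<xi> = (of_real (lp_piece \<phi> j \<xi>) * low_symbol (Suc j) \<xi>) * fourier (\<lambda>x. of_real (f x)) \<xi>"
      by (simp add: P_def)
    then show "P \<xi> * fourier (inv_fourier (low_symbol (Suc j))) \<xi> = P \<xi>"
      by (simp add: fourier_inv_fourier_low_symbol lp_piece_mult_low_symbol P_def)
  qed
  finally show ?thesis unfolding fj by (rule sym)
qed

lemma ball_delta_lp_block:
  "ball_delta k (lp_block \<phi> j f) r y
    = (\<integral>z. lp_block \<phi> j f z * ball_delta k mollifier (2 ^ Suc j * r) (2 ^ Suc j *\<^sub>R (y - z)) \<partial>lborel)"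
proof -
  let ?c = "2 ^ Suc j :: real"
  have B: "ball_integral (lp_block \<phi> j f) s y = (\<integral>z. lp_block \<phi> j f z * ball_integral mollifier (?c * s) (?c *\<^sub>R (y - z)) \<partial>lborel)" for s
  proof -
    have "ball_integral (lp_block \<phi> j f) s y
        = ball_integral (\<lambda>x. \<integral>z. lp_block \<phi> j f z * (of_real (?c ^ DIM('a)) * mollifier (?c *\<^sub>R (x - z))) \<partial>lborel) s y"
      by (rule arg_cong[where f="\<lambda>u. ball_integral u s y"], rule ext, subst lp_block_reproducing)
        (simp only: inv_fourier_low_symbol)
    also have "\<dots> = (\<integral>z. lp_block \<phi> j f z * ball_integral mollifier (?c * s) (?c *\<^sub>R (y - z)) \<partial>lborel)"
      by (rule ball_integral_convolution[OF integrable_lp_block integrable_mollifier]) simp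
    finally show ?thesis .
  qed
  have int: "integrable lborel (\<lambda>z. lp_block \<phi> j f z * ball_integral mollifier s (?c *\<^sub>R (y - z)))" for s
  proof (rule Bochner_Integration.integrable_bound)
    show "integrable lborel (\<lambda>z. norm (lp_block \<phi> j f z) * (\<integral>x. norm (mollifier x) \<partial>lborel))"
      using integrable_lp_block by simp
    show "AE z in lborel. norm (lp_block \<phi> j f z * ball_integral mollifier s (?c *\<^sub>R (y - z)))
        \<le> norm (norm (lp_block \<phi> j f z) * (\<integral>x. norm (mollifier x) \<partial>lborel))"
      by (auto simp: norm_mult abs_mult intro!: mult_left_mono order_trans[OF norm_ball_integral_le[OF integrable_mollifier]])
    show "(\<lambda>z. lp_block \<phi> j f z * ball_integral mollifier s (?c *\<^sub>R (y - z))) \<in> borel_measurable lborel"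
      by measurable
  qed
  have "ball_delta k (lp_block \<phi> j f) r y
     = (\<Sum>i\<le>Suc k. \<integral>z. of_real (delta_coeff k i) * (lp_block \<phi> j f z * ball_integral mollifier (?c * (r / 2 ^ i)) (?c *\<^sub>R (y - z))) \<partial>lborel)"
    unfolding ball_delta_def B by (simp only: integral_mult_right_zero)
  also have "\<dots> = (\<integral>z. (\<Sum>i\<le>Suc k. of_real (delta_coeff k i) * (lp_block \<phi> j f z * ball_integral mollifier (?c * (r / 2 ^ i)) (?c *\<^sub>R (y - z)))) \<partial>lborel)"
    by (rule Bochner_Integration.integral_sum[symmetric]) (intro integrable_mult_right int)
  also have "\<dots> = (\<integral>z. lp_block \<phi> j f z * ball_delta k mollifier (?c * r) (?c *\<^sub>R (y - z)) \<partial>lborel)"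
    unfolding ball_delta_def sum_distrib_left by (simp only: mult.left_commute times_divide_eq_right)
  finally show ?thesis .
qed

text \<open>
  The blocks recover the masses of balls, not merely the function in some weak sense: the partial sums
  are mollifications of \<open>f\<close>.
\<close>
lemma ball_delta_sum_lp_blocks:
  "(\<lambda>J. \<Sum>j\<le>J. ball_delta k (lp_block \<phi> j f) r y) \<longlonglongrightarrow> ball_delta k (\<lambda>x. of_real (f x)) r y"
proof -
  have F: "integrable lborel (\<lambda>z. complex_of_real (f z))" using f by simp
  have "(\<Sum>j\<le>J. ball_integral (lp_block \<phi> j f) s y)
      = (\<integral>z. of_real (f z) * ball_integral mollifier (2 ^ J * s) (2 ^ J *\<^sub>R (y - z)) \<partial>lborel)" for J s
  proof -
    have "(\<Sum>j\<le>J. ball_integral (lp_block \<phi> j f) s y) = ball_integral (\<lambda>x. \<Sum>j\<le>J. lp_block \<phi> j f x) s y"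
      unfolding ball_integral_def scaleR_sum_right
      by (rule Bochner_Integration.integral_sum[symmetric]) (rule integrable_indicator_cball[OF integrable_lp_block])
    also have "\<dots> = (\<integral>z. of_real (f z) * ball_integral mollifier (2 ^ J * s) (2 ^ J *\<^sub>R (y - z)) \<partial>lborel)"
      unfolding lp_block_telescope inv_fourier_low_symbol
      by (rule ball_integral_convolution[OF F integrable_mollifier]) simp
    finally show ?thesis .
  qed
  then have lim: "(\<lambda>J. \<Sum>j\<le>J. ball_integral (lp_block \<phi> j f) s y) \<longlonglongrightarrow> ball_integral (\<lambda>x. of_real (f x)) s y" for s
    using ball_integral_mollify_tendsto[OF F integrable_mollifier integral_mollifier, of s y] by simp
  have "(\<Sum>j\<le>J. ball_delta k (lp_block \<phi> j f) r y)
      = (\<Sum>i\<le>Suc k. of_real (delta_coeff k i) * (\<Sum>j\<le>J. ball_integral (lp_block \<phi> j f) (r / 2 ^ i) y))" for J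
    unfolding ball_delta_def sum_distrib_left by (rule sum.swap)
  moreover have "(\<lambda>J. \<Sum>i\<le>Suc k. of_real (delta_coeff k i) * (\<Sum>j\<le>J. ball_integral (lp_block \<phi> j f) (r / 2 ^ i) y))
      \<longlonglongrightarrow> ball_delta k (\<lambda>x. of_real (f x)) r y"
    unfolding ball_delta_def by (intro tendsto_sum tendsto_mult tendsto_const lim)
  ultimately show ?thesis by (simp only:)
qed

end

end

end

section \<open>From the kernel to the SBE norm\<close>

lemma sigma_finite_dr_over_r: "sigma_finite_measure dr_over_r"
  unfolding dr_over_r_def
  by (subst sigma_finite_measure.sigma_finite_iff_density_finite[OF sigma_finite_lborel]) (auto simp: ennreal_mult_eq_top_iff split: split_indicator)

text \<open>
  Since \<open>\<alpha>\<close> is not an integer, it lies strictly between \<open>m = \<lfloor>\<alpha>\<rfloor>\<close> and \<open>m + 1\<close>, and the difference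
  operator annihilates the powers up to \<open>d + m\<close>. For an integer \<open>\<alpha>\<close> one power would be missing.
\<close>
lemma SBE_exponent_bounds:
  assumes "0 < \<alpha>" "\<alpha> \<notin> \<nat>"
  shows "\<alpha> < real (nat \<lfloor>\<alpha>\<rfloor>) + 1" "d + nat \<lfloor>\<alpha>\<rfloor> \<le> nat \<lceil>\<alpha> + real d - 1\<rceil>"
proof -
  define m where "m = nat \<lfloor>\<alpha>\<rfloor>"
  have m: "real m \<le> \<alpha>" "\<alpha> < real m + 1" using assms(1) by (auto simp: m_def of_nat_nat)
  then show "\<alpha> < real (nat \<lfloor>\<alpha>\<rfloor>) + 1" by (simp add: m_def)
  have "real m \<noteq> \<alpha>" using assms(2) of_nat_in_Nats by metis
  then have "real m < \<alpha>" using m by simp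
  then have "of_int (int (d + m) - 1) < \<alpha> + real d - 1" by simp
  then have "int (d + m) - 1 < \<lceil>\<alpha> + real d - 1\<rceil>" by (simp only: less_ceiling_iff)
  then show "d + nat \<lfloor>\<alpha>\<rfloor> \<le> nat \<lceil>\<alpha> + real d - 1\<rceil>" by (simp add: m_def[symmetric])
qed

lemma ball_mass_density:
  fixes f :: "'a::euclidean_space \<Rightarrow> real"
  assumes f: "integrable lborel f" and nonneg: "AE x in lborel. 0 \<le> f x"
  shows "of_real (ball_mass (density lborel (\<lambda>x. ennreal (f x))) r y) = ball_integral (\<lambda>x. of_real (f x)) r y"
proof -
  have [measurable]: "f \<in> borel_measurable borel" using borel_measurable_integrable[OF f] by simp
  have int: "integrable lborel (\<lambda>x. f x * indicator (cball y r) x)"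
    using integrable_mult_indicator[of "cball y r" lborel f] f by (simp add: mult.commute)
  have "emeasure (density lborel (\<lambda>x. ennreal (f x))) (cball y r) = (\<integral>\<^sup>+ x. ennreal (f x) * indicator (cball y r) x \<partial>lborel)"
    by (rule emeasure_density) auto
  also have "\<dots> = (\<integral>\<^sup>+ x. ennreal (f x * indicator (cball y r) x) \<partial>lborel)"
    by (intro nn_integral_cong) (auto simp: indicator_def)
  also have "\<dots> = ennreal (\<integral>x. f x * indicator (cball y r) x \<partial>lborel)"
    using nonneg by (intro nn_integral_eq_integral int) (auto elim: eventually_mono simp: indicator_def)
  finally have "ball_mass (density lborel (\<lambda>x. ennreal (f x))) r y = (\<integral>x. f x * indicator (cball y r) x \<partial>lborel)"
    unfolding ball_mass_def measure_def using nonneg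
    by (simp, intro enn2real_ennreal integral_nonneg_AE) (auto elim: eventually_mono simp: indicator_def)
  then have "of_real (ball_mass (density lborel (\<lambda>x. ennreal (f x))) r y) = (\<integral>x. complex_of_real (f x * indicator (cball y r) x) \<partial>lborel)"
    by (simp only: integral_complex_of_real)
  also have "\<dots> = ball_integral (\<lambda>x. of_real (f x)) r y"
    unfolding ball_integral_def by (intro Bochner_Integration.integral_cong) (auto simp: indicator_def)
  finally show ?thesis .
qed

lemma of_real_Delta_ball_mass:
  fixes f :: "'a::euclidean_space \<Rightarrow> real"
  assumes f: "integrable lborel f" and nonneg: "AE x in lborel. 0 \<le> f x"
  shows "of_real (Delta k (\<lambda>\<rho>. ball_mass (density lborel (\<lambda>x. ennreal (f x))) \<rho> y) r)
    = ball_delta k (\<lambda>x. of_real (f x)) r y"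
  unfolding Delta_eq_sum ball_delta_def ball_mass_density[OF assms, symmetric] by simp

lemma besov_norm_one_eq_suminf:
  "besov_norm \<phi> s p 1 f = (\<Sum>j. ennreal (2 powr (real j * s)) * Lp_norm p lborel (\<lambda>x. ennreal (norm (lp_block \<phi> j f x))))"
  unfolding besov_norm_def by (subst Lp_norm_def) (simp add: nn_integral_count_space_nat)

lemma Lp_norm_suminf_le:
  assumes "sigma_finite_measure M" "1 \<le> p" and [measurable]: "\<And>j::nat. g j \<in> borel_measurable M"
  shows "Lp_norm p M (\<lambda>y. \<Sum>j. g j y) \<le> (\<Sum>j. Lp_norm p M (g j))"
proof -
  have "(\<lambda>(y, j). g j y) \<in> borel_measurable (M \<Otimes>\<^sub>M count_space UNIV)"
    using measurable_pair_swap[OF measurable_pair_measure_countable1[where A=UNIV and f="\<lambda>(j, y). g j y" and N=M and K=borel]]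
    by simp
  from Minkowski_integral[OF assms(1) sigma_finite_measure_count_space_countable assms(2) this]
  show ?thesis by (simp add: nn_integral_count_space_nat)
qed

lemma Lp_norm_convolution_le:
  fixes u K :: "'a::euclidean_space \<Rightarrow> ennreal"
  assumes p: "1 \<le> p" and [measurable]: "u \<in> borel_measurable borel" "K \<in> borel_measurable borel"
  shows "Lp_norm p lborel (\<lambda>y. \<integral>\<^sup>+ w. K w * u (y - t *\<^sub>R w) \<partial>lborel) \<le> (\<integral>\<^sup>+ w. K w \<partial>lborel) * Lp_norm p lborel u"
proof -
  have "Lp_norm p lborel (\<lambda>y. \<integral>\<^sup>+ w. K w * u (y - t *\<^sub>R w) \<partial>lborel)
      \<le> (\<integral>\<^sup>+ w. Lp_norm p lborel (\<lambda>y. K w * u (y - t *\<^sub>R w)) \<partial>lborel)"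
    by (rule Minkowski_integral[OF sigma_finite_lborel sigma_finite_lborel p]) measurable
  also have "\<dots> \<le> (\<integral>\<^sup>+ w. K w * Lp_norm p lborel u \<partial>lborel)"
  proof (rule nn_integral_mono)
    fix w
    have "Lp_norm p lborel (\<lambda>y. K w * u (y - t *\<^sub>R w)) \<le> K w * Lp_norm p lborel (\<lambda>y. u (y - t *\<^sub>R w))"
      by (rule Lp_norm_cmult_le[OF _ p]) measurable
    also have "\<dots> \<le> K w * Lp_norm p lborel u"
      by (intro mult_left_mono Lp_norm_diff_lborel_le) auto
    finally show "Lp_norm p lborel (\<lambda>y. K w * u (y - t *\<^sub>R w)) \<le> K w * Lp_norm p lborel u" .
  qed
  also have "\<dots> = (\<integral>\<^sup>+ w. K w \<partial>lborel) * Lp_norm p lborel u"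
    by (rule nn_integral_multc) measurable
  finally show ?thesis .
qed

lemma ennreal_norm_le_suminf_of_LIMSEQ:
  fixes a :: "nat \<Rightarrow> 'b::real_normed_vector"
  assumes lim: "(\<lambda>J. \<Sum>j\<le>J. a j) \<longlonglongrightarrow> l"
  shows "ennreal (norm l) \<le> (\<Sum>j. ennreal (norm (a j)))"
proof (rule LIMSEQ_le_const2)
  show "(\<lambda>J. ennreal (norm (\<Sum>j\<le>J. a j))) \<longlonglongrightarrow> ennreal (norm l)"
    by (intro tendsto_ennrealI tendsto_norm lim)
  have "ennreal (norm (\<Sum>j\<le>J. a j)) \<le> (\<Sum>j. ennreal (norm (a j)))" for J
  proof -
    have "ennreal (norm (\<Sum>j\<le>J. a j)) \<le> ennreal (\<Sum>j\<le>J. norm (a j))"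
      by (intro ennreal_leI norm_sum)
    also have "\<dots> = (\<Sum>j\<le>J. ennreal (norm (a j)))" by (rule sum_ennreal[symmetric]) simp
    also have "\<dots> \<le> (\<Sum>j. ennreal (norm (a j)))" by (rule sum_le_suminf) auto
    finally show ?thesis .
  qed
  then show "\<exists>N. \<forall>J\<ge>N. ennreal (norm (\<Sum>j\<le>J. a j)) \<le> (\<Sum>j. ennreal (norm (a j)))" by blast
qed

text \<open>
  The hypothesis on the kernel is applied at radius \<open>2 ^ (j + 1) * r\<close>. The dilation produces
  \<open>2 powr ((j + 1) * (\<alpha> + d))\<close>, and the Jacobian of the substitution in \<open>z\<close> removes the part with \<open>d\<close>,
  which leaves the weight of the Besov norm up to the constant \<open>2 powr \<alpha>\<close>.
\<close>
lemma lp_block_kernel_estimate: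
  fixes f :: "'a::euclidean_space \<Rightarrow> real" and G :: "'a \<Rightarrow> ennreal"
  assumes \<phi>: "lp_cutoff \<phi>" and f: "integrable lborel f" and [measurable]: "G \<in> borel_measurable borel"
    and G: "\<And>r z. 0 < r \<Longrightarrow> ennreal (r powr (- \<alpha> - real DIM('a)) * norm (ball_delta k (mollifier \<phi>) r z))
       \<le> ennreal (bump \<gamma> r) * G z"
    and r: "0 < r"
  shows "ennreal (r powr (- \<alpha> - real DIM('a)) * norm (ball_delta k (lp_block \<phi> j f) r y))
    \<le> ennreal (bump \<gamma> (2 ^ Suc j * r)) *
       (ennreal ((2 ^ Suc j) powr \<alpha>) * (\<integral>\<^sup>+ w. G w * ennreal (norm (lp_block \<phi> j f (y - (1 / 2 ^ Suc j) *\<^sub>R w))) \<partial>lborel))"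
proof -
  define c :: real where "c = 2 ^ Suc j"
  define u where "u = lp_block \<phi> j f"
  define D where "D = ball_delta k (mollifier \<phi>)"
  have c: "0 < c" by (simp add: c_def)
  have [measurable]: "u \<in> borel_measurable borel" unfolding u_def by (rule measurable_lp_block[OF \<phi> f])
  have psi [measurable]: "mollifier \<phi> \<in> borel_measurable borel" by (rule measurable_mollifier[OF \<phi>])
  have D_meas [measurable]: "(\<lambda>z. D s (z' z)) \<in> borel_measurable borel"
    if [measurable]: "z' \<in> borel_measurable borel" for s and z' :: "'a \<Rightarrow> 'a"
    unfolding D_def by measurable
  have eq: "ball_delta k u r y = (\<integral>z. u z * D (c * r) (c *\<^sub>R (y - z)) \<partial>lborel)"
    unfolding u_def D_def c_def by (rule ball_delta_lp_block[OF \<phi> f])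
  have "ennreal (norm (ball_delta k u r y)) \<le> (\<integral>\<^sup>+ z. ennreal (norm (u z * D (c * r) (c *\<^sub>R (y - z)))) \<partial>lborel)"
    unfolding eq
  proof (cases "integrable lborel (\<lambda>z. u z * D (c * r) (c *\<^sub>R (y - z)))")
    case True
    then show "ennreal (norm (\<integral>z. u z * D (c * r) (c *\<^sub>R (y - z)) \<partial>lborel))
        \<le> (\<integral>\<^sup>+ z. ennreal (norm (u z * D (c * r) (c *\<^sub>R (y - z)))) \<partial>lborel)"
      by (rule integral_norm_bound_ennreal)
  qed (simp add: not_integrable_integral_eq)
  then have "ennreal (r powr (- \<alpha> - real DIM('a)) * norm (ball_delta k u r y))
      \<le> ennreal (r powr (- \<alpha> - real DIM('a))) * (\<integral>\<^sup>+ z. ennreal (norm (u z * D (c * r) (c *\<^sub>R (y - z)))) \<partial>lborel)"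
    by (simp add: ennreal_mult mult_left_mono)
  also have "\<dots> = (\<integral>\<^sup>+ z. ennreal (r powr (- \<alpha> - real DIM('a))) * ennreal (norm (u z * D (c * r) (c *\<^sub>R (y - z)))) \<partial>lborel)"
    by (rule nn_integral_cmult[symmetric]) measurable
  also have "\<dots> \<le> (\<integral>\<^sup>+ z. ennreal (c powr (\<alpha> + real DIM('a))) * (ennreal (bump \<gamma> (c * r)) * (G (c *\<^sub>R (y - z)) * ennreal (norm (u z)))) \<partial>lborel)"
  proof (rule nn_integral_mono)
    fix z
    have "r powr (- \<alpha> - real DIM('a)) = c powr (\<alpha> + real DIM('a)) * (c * r) powr (- \<alpha> - real DIM('a))"
      using c r by (simp add: powr_mult powr_add[symmetric] mult.assoc[symmetric])
    then have "ennreal (r powr (- \<alpha> - real DIM('a))) * ennreal (norm (u z * D (c * r) (c *\<^sub>R (y - z))))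
        = ennreal (c powr (\<alpha> + real DIM('a))) *
          (ennreal ((c * r) powr (- \<alpha> - real DIM('a)) * norm (D (c * r) (c *\<^sub>R (y - z)))) * ennreal (norm (u z)))"
      by (simp add: norm_mult ennreal_mult[symmetric] mult_ac)
    also have "\<dots> \<le> ennreal (c powr (\<alpha> + real DIM('a))) *
          (ennreal (bump \<gamma> (c * r)) * G (c *\<^sub>R (y - z)) * ennreal (norm (u z)))"
      unfolding D_def using c r by (intro mult_left_mono mult_right_mono G) auto
    finally show "ennreal (r powr (- \<alpha> - real DIM('a))) * ennreal (norm (u z * D (c * r) (c *\<^sub>R (y - z))))
      \<le> ennreal (c powr (\<alpha> + real DIM('a))) * (ennreal (bump \<gamma> (c * r)) * (G (c *\<^sub>R (y - z)) * ennreal (norm (u z))))"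
      by (simp add: mult.assoc)
  qed
  also have "\<dots> = ennreal (c powr (\<alpha> + real DIM('a))) * (ennreal (bump \<gamma> (c * r)) *
      (\<integral>\<^sup>+ z. G (c *\<^sub>R (y - z)) * ennreal (norm (u z)) \<partial>lborel))"
    by (simp add: nn_integral_cmult)
  also have "(\<integral>\<^sup>+ z. G (c *\<^sub>R (y - z)) * ennreal (norm (u z)) \<partial>lborel)
      = ennreal (\<bar>- 1 / c\<bar> ^ DIM('a)) * (\<integral>\<^sup>+ w. G (c *\<^sub>R (y - (y + (- 1 / c) *\<^sub>R w))) * ennreal (norm (u (y + (- 1 / c) *\<^sub>R w))) \<partial>lborel)"
    using c by (intro nn_integral_lborel_affine) auto
  also have "\<dots> = ennreal ((1 / c) ^ DIM('a)) * (\<integral>\<^sup>+ w. G w * ennreal (norm (u (y - (1 / c) *\<^sub>R w))) \<partial>lborel)"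
    using c by simp
  also have "ennreal (c powr (\<alpha> + real DIM('a))) * (ennreal (bump \<gamma> (c * r)) * (ennreal ((1 / c) ^ DIM('a)) * (\<integral>\<^sup>+ w. G w * ennreal (norm (u (y - (1 / c) *\<^sub>R w))) \<partial>lborel)))
    = ennreal (bump \<gamma> (c * r)) * (ennreal (c powr \<alpha>) * (\<integral>\<^sup>+ w. G w * ennreal (norm (u (y - (1 / c) *\<^sub>R w))) \<partial>lborel))"
  proof -
    have "c powr (\<alpha> + real DIM('a)) * (1 / c) ^ DIM('a) = c powr \<alpha>"
      using c by (simp add: powr_add powr_realpow power_one_over)
    then have "ennreal (c powr \<alpha>) = ennreal (c powr (\<alpha> + real DIM('a))) * ennreal ((1 / c) ^ DIM('a))"
      using c by (subst ennreal_mult[symmetric]) auto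
    then show ?thesis by (simp only: mult_ac)
  qed
  finally show ?thesis by (simp only: c_def u_def)
qed

text \<open>
  For each \<open>y\<close>, the function \<open>U y\<close> of the radius is dominated by the sum over \<open>j\<close> of \<open>T j y\<close> times a bump
  centred at \<open>r = 2 powr (- j - 1)\<close>. The bumps are at most \<open>1\<close> and have the same integral, so every norm in
  \<open>r\<close> is bounded by a multiple of \<open>S y = (\<Sum>j. T j y)\<close>. Here \<open>T j\<close> is a superposition of translates
  of the \<open>j\<close>-th block with weight \<open>2 powr ((j + 1) * \<alpha>) * G w\<close>, and the triangle inequality for the norm in
  \<open>y\<close> gives the terms of the Besov norm.
\<close>
theorem proposition2p3:
  fixes \<alpha> :: real and p q :: ennreal and \<phi> :: "'a::euclidean_space \<Rightarrow> real"
  assumes "1 \<le> q" and "0 < \<alpha>" and "\<alpha> \<notin> \<nat>" and "1 \<le> p" and "lp_cutoff \<phi>"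
  shows "\<exists>C::real. \<forall>(\<mu>::'a measure) (f::'a \<Rightarrow> real).
           finite_measure \<mu> \<and> compactly_supported \<mu> \<and>
           f \<in> borel_measurable borel \<and> (AE x in lborel. 0 \<le> f x) \<and>
           \<mu> = density lborel (\<lambda>x. ennreal (f x)) \<and>
           f \<in> besov_space \<phi> \<alpha> q 1 \<longrightarrow>
           SBE_norm \<alpha> p q \<mu> \<le> ennreal C * besov_norm \<phi> \<alpha> q 1 f"
proof -
  define d where "d = DIM('a)"
  define m where "m = nat \<lfloor>\<alpha>\<rfloor>"
  define k where "k = nat \<lceil>\<alpha> + real d - 1\<rceil>"
  define \<gamma> where "\<gamma> = min (real m + 1 - \<alpha>) (\<alpha> / 2)"
  have m: "\<alpha> < real m + 1" "DIM('a) + m \<le> k"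
    using SBE_exponent_bounds[OF assms(2,3)] by (simp_all add: m_def k_def d_def)
  have \<gamma>: "0 < \<gamma>" using assms(2) m by (simp add: \<gamma>_def)
  obtain G :: "'a \<Rightarrow> ennreal" where G_meas [measurable]: "G \<in> borel_measurable borel"
    and G_int: "(\<integral>\<^sup>+ z. G z \<partial>lborel) < \<infinity>"
    and G: "\<And>r z. 0 < r \<Longrightarrow> ennreal (r powr (- \<alpha> - real d) * norm (ball_delta k (mollifier \<phi>) r z)) \<le> ennreal (bump \<gamma> r) * G z"
    using ball_delta_kernel_bound[OF lp_cutoff_test_function[OF assms(5)] assms(2) m]
    unfolding \<gamma>_def d_def mollifier_def by metis
  \<comment> \<open>\<open>2 / \<gamma>\<close> bounds the integral of the bumps, and \<open>1\<close> bounds the bumps themselves.\<close>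
  define c where "c = ennreal (max 1 (2 / \<gamma>))"
  have c: "1 \<le> c" "ennreal (2 / \<gamma>) \<le> c" by (auto simp: c_def intro!: ennreal_leI simp flip: ennreal_1)
  define C where "C = enn2real (c * ennreal (2 powr \<alpha>) * (\<integral>\<^sup>+ z. G z \<partial>lborel))"
  have C: "ennreal C = c * ennreal (2 powr \<alpha>) * (\<integral>\<^sup>+ z. G z \<partial>lborel)"
    unfolding C_def using G_int by (intro ennreal_enn2real) (simp add: c_def ennreal_mult_less_top)
  have "SBE_norm \<alpha> p q (density lborel (\<lambda>x. ennreal (f x))) \<le> ennreal C * besov_norm \<phi> \<alpha> q 1 f"
    if f: "integrable lborel f" and nonneg: "AE x in lborel. 0 \<le> f x" for f :: "'a \<Rightarrow> real"
  proof -
    have [measurable]: "f \<in> borel_measurable borel" using borel_measurable_integrable[OF f] by simp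
    define v where "v j x = ennreal (norm (lp_block \<phi> j f x))" for j x
    have [measurable]: "v j \<in> borel_measurable borel" for j
      using measurable_lp_block[OF assms(5) f, of j] unfolding v_def[abs_def] by measurable
    define T where "T j y = ennreal ((2 ^ Suc j) powr \<alpha>) * (\<integral>\<^sup>+ w. G w * v j (y - (1 / 2 ^ Suc j) *\<^sub>R w) \<partial>lborel)" for j y
    have T_meas [measurable]: "T j \<in> borel_measurable borel" for j unfolding T_def[abs_def] by measurable
    define S where "S y = (\<Sum>j. T j y)" for y
    have S_meas [measurable]: "S \<in> borel_measurable borel" unfolding S_def[abs_def] by measurable
    define U where "U y r = ennreal \<bar>r powr (- \<alpha> - real d) * Delta k (\<lambda>\<rho>. ball_mass (density lborel (\<lambda>x. ennreal (f x))) \<rho> y) r\<bar>" for y r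
    have U: "U y r = ennreal (r powr (- \<alpha> - real d) * norm (ball_delta k (\<lambda>x. of_real (f x)) r y))" for y r
      unfolding U_def of_real_Delta_ball_mass[OF f nonneg, symmetric] by (simp add: abs_mult)
    have U_meas: "(\<lambda>(y, r). U y r) \<in> borel_measurable (lborel \<Otimes>\<^sub>M dr_over_r)"
      unfolding U by measurable
    have Uy [measurable]: "U y \<in> borel_measurable dr_over_r" for y
      using measurable_compose[OF measurable_Pair1'[of y lborel] U_meas] by simp
    have U_le: "U y r \<le> (\<Sum>j. ennreal (bump \<gamma> (2 ^ Suc j * r)) * T j y)" if r: "0 < r" for y r
    proof -
      have "U y r \<le> ennreal (r powr (- \<alpha> - real d)) * (\<Sum>j. ennreal (norm (ball_delta k (lp_block \<phi> j f) r y)))"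
        unfolding U using ennreal_norm_le_suminf_of_LIMSEQ[OF ball_delta_sum_lp_blocks[OF assms(5) f]]
        by (simp add: ennreal_mult mult_left_mono)
      also have "\<dots> = (\<Sum>j. ennreal (r powr (- \<alpha> - real d) * norm (ball_delta k (lp_block \<phi> j f) r y)))"
        by (simp add: ennreal_mult)
      also have "\<dots> \<le> (\<Sum>j. ennreal (bump \<gamma> (2 ^ Suc j * r)) * T j y)"
        unfolding T_def v_def
        by (intro suminf_le lp_block_kernel_estimate[OF assms(5) f G_meas G[unfolded d_def] r, folded d_def]) auto
      finally show ?thesis .
    qed
    have inner: "Lp_norm p dr_over_r (U y) \<le> c * S y" for y
    proof (rule Lp_norm_le_of_sup_and_integral_le[OF assms(4) Uy _ _ c(1)])
      show "AE r in dr_over_r. U y r \<le> S y"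
        using AE_dr_over_r_pos
      proof eventually_elim
        case (elim r)
        have "U y r \<le> (\<Sum>j. ennreal (bump \<gamma> (2 ^ Suc j * r)) * T j y)" by (rule U_le[OF elim])
        also have "\<dots> \<le> (\<Sum>j. 1 * T j y)"
          using \<gamma> elim by (intro suminf_le mult_right_mono) (auto intro!: bump_le_one)
        finally show ?case by (simp add: S_def)
      qed
      have "(\<integral>\<^sup>+ r. U y r \<partial>dr_over_r) \<le> (\<integral>\<^sup>+ r. (\<Sum>j. ennreal (bump \<gamma> (2 ^ Suc j * r)) * T j y) \<partial>dr_over_r)"
        by (intro nn_integral_mono_AE eventually_mono[OF AE_dr_over_r_pos] U_le)
      also have "\<dots> = (\<Sum>j. (\<integral>\<^sup>+ r. ennreal (bump \<gamma> (2 ^ Suc j * r)) \<partial>dr_over_r) * T j y)"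
      proof -
        have b [measurable]: "(\<lambda>r. ennreal (bump \<gamma> (2 ^ Suc j * r))) \<in> borel_measurable dr_over_r" for j
          by measurable
        show ?thesis
          by (subst nn_integral_suminf) (measurable, simp only: nn_integral_multc[OF b])
      qed
      also have "\<dots> \<le> (\<Sum>j. c * T j y)"
      proof (intro suminf_le mult_right_mono)
        show "(\<integral>\<^sup>+ r. ennreal (bump \<gamma> (2 ^ Suc j * r)) \<partial>dr_over_r) \<le> c" for j
          using nn_integral_dr_over_r_scale[of "\<lambda>r. ennreal (bump \<gamma> r)" "2 ^ Suc j"] nn_integral_bump_le[OF \<gamma>] c(2)
          by simp
      qed auto
      also have "\<dots> = c * S y" by (simp add: S_def)
      finally show "(\<integral>\<^sup>+ r. U y r \<partial>dr_over_r) \<le> c * S y" .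
    qed
    have "SBE_norm \<alpha> p q (density lborel (\<lambda>x. ennreal (f x))) = Lp_norm q lborel (\<lambda>y. Lp_norm p dr_over_r (U y))"
      by (simp add: SBE_norm_def Let_def U_def[abs_def] k_def d_def)
    also have "\<dots> \<le> Lp_norm q lborel (\<lambda>y. c * S y)"
      by (rule Lp_norm_mono[OF _ assms(1) inner]) (rule measurable_Lp_norm[OF sigma_finite_dr_over_r U_meas])
    also have "\<dots> \<le> c * Lp_norm q lborel S"
      by (rule Lp_norm_cmult_le[OF _ assms(1)]) simp
    also have "\<dots> \<le> c * (\<Sum>j. Lp_norm q lborel (T j))"
      unfolding S_def[abs_def]
      by (intro mult_left_mono Lp_norm_suminf_le sigma_finite_lborel assms(1)) auto
    also have "\<dots> \<le> c * (\<Sum>j. ennreal ((2 ^ Suc j) powr \<alpha>) * ((\<integral>\<^sup>+ w. G w \<partial>lborel) * Lp_norm q lborel (v j)))"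
    proof (intro mult_left_mono suminf_le)
      show "Lp_norm q lborel (T j) \<le> ennreal ((2 ^ Suc j) powr \<alpha>) * ((\<integral>\<^sup>+ w. G w \<partial>lborel) * Lp_norm q lborel (v j))" for j
      proof -
        have "Lp_norm q lborel (T j) \<le> ennreal ((2 ^ Suc j) powr \<alpha>) * Lp_norm q lborel (\<lambda>y. \<integral>\<^sup>+ w. G w * v j (y - (1 / 2 ^ Suc j) *\<^sub>R w) \<partial>lborel)"
          unfolding T_def[abs_def] by (rule Lp_norm_cmult_le[OF _ assms(1)]) measurable
        also have "\<dots> \<le> ennreal ((2 ^ Suc j) powr \<alpha>) * ((\<integral>\<^sup>+ w. G w \<partial>lborel) * Lp_norm q lborel (v j))"
          by (intro mult_left_mono Lp_norm_convolution_le assms(1)) auto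
        finally show ?thesis .
      qed
    qed auto
    also have "\<dots> = c * (\<Sum>j. (ennreal (2 powr \<alpha>) * (\<integral>\<^sup>+ w. G w \<partial>lborel)) * (ennreal (2 powr (real j * \<alpha>)) * Lp_norm q lborel (v j)))"
    proof -
      have "ennreal ((2 ^ Suc j) powr \<alpha>) = ennreal (2 powr \<alpha>) * ennreal (2 powr (real j * \<alpha>))" for j
      proof -
        have "(2 ^ Suc j) powr \<alpha> = (2 powr real (Suc j)) powr \<alpha>" by (subst powr_realpow) auto
        also have "\<dots> = 2 powr \<alpha> * 2 powr (real j * \<alpha>)"
          by (simp add: powr_powr powr_add[symmetric] algebra_simps)
        finally show ?thesis by (simp add: ennreal_mult)
      qed
      then show ?thesis by (simp only: mult_ac)
    qed
    also have "\<dots> = ennreal C * besov_norm \<phi> \<alpha> q 1 f"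
      unfolding C besov_norm_one_eq_suminf v_def[abs_def] by (simp add: mult.assoc)
    finally show ?thesis .
  qed
  then show ?thesis by (intro exI[of _ C]) (auto simp: besov_space_def)
qed

end
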